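(* Let $G,H$ be finitely generated groups of polynomial growth and let $\Phi:G\to H$ be a quasi-isometry. Let $N\le G$ and $M\le H$ be finite-index torsion-free nilpotent subgroups, and let $\Psi:N\to M$ be a quasi-isometry at bounded distance from $\Phi|_N$, with $\Psi(e_N)=e_M$. Assume that $\Psi$ has bounded Abelian defect, i.e. $$\Delta_{\mathrm{ab}}(\Psi):=\sup_{x,y\in N}\big\|\pi_M(\Psi(xy))-\pi_M(\Psi(x))-\pi_M(\Psi(y))\big\|<\infty.$$ Let $F_G$ and $F_H$ be the coarse harmonic coordinates on $G$ and $H$ constructed from a basis $\{\varphi_i\}_{i=1}^r$ of $\mathrm{Hom}(N_{\mathrm{ab}},\mathbb R)$ and its image $\{T_\Psi(\varphi_i)\}_{i=1}^r$ in $\mathrm{Hom}(M_{\mathrm{ab}},\mathbb R)$. Then $$\sup_{x\in G}\big\|F_H(\Phi(x))-F_G(x)\big\|<\infty.$$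
   Context: $\pi_N:N\to N_{\mathrm{ab}}\otimes_{\mathbb Z}\mathbb R$ is the composition of the Abelianization $N\to N_{\mathrm{ab}}=N/[N,N]$ with the canonical map to $N_{\mathrm{ab}}\otimes_{\mathbb Z}\mathbb R$; similarly $\pi_M$. Norms on these finite-dimensional spaces are fixed arbitrarily. Map $T_\Psi$: for a quasi-isometry $\Psi:N\to M$ with $\Psi(e_N)=e_M$ and bounded Abelian defect there is a unique linear map $L_{ab}:N_{\mathrm{ab}}\otimes\mathbb R\to M_{\mathrm{ab}}\otimes\mathbb R$ with $\sup_{x\in N}\|\pi_M(\Psi(x))-L_{ab}(\pi_N(x))\|<\infty$, and $L_{ab}$ is an isomorphism; $T_\Psi:\mathrm{Hom}(N_{\mathrm{ab}},\mathbb R)\to\mathrm{Hom}(M_{\mathrm{ab}},\mathbb R)$ is $T_\Psi(\varphi)=\varphi\circ L_{ab}^{-1}$, where homomorphisms to $\mathbb R$ are regarded as linear functionals on $N_{\mathrm{ab}}\otimes\mathbb R$, $M_{\mathrm{ab}}\otimes\mathbb R$. Coarse harmonic coordinates: $F_N(n)=(\varphi_i(\pi_N(n)))_{i=1}^r$ for $n\in N$, and $F_M(m)=(T_\Psi(\varphi_i)(\pi_M(m)))_{i=1}^r$ for $m\in M$. Fix right coset decompositions $G=\bigsqcup_{j=1}^kNg_j$ with $g_1=e_G$ and $H=\bigsqcup_{j=1}^{l}Mh_j$ with $h_1=e_H$; define $F_G(ng_j):=F_N(n)$ for $n\in N$ and $F_H(mh_j):=F_M(m)$ for $m\in M$. 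*)

theory Defs
  imports "HOL-Analysis.Analysis" "HOL-Algebra.Free_Abelian_Groups" "HOL-Algebra.Generated_Groups"
    "HOL-Algebra.Module"
begin

section \<open>Groups with word metrics\<close>

definition finite_generating_set :: "('a, 'm) monoid_scheme \<Rightarrow> 'a set \<Rightarrow> bool" where
  "finite_generating_set G S \<longleftrightarrow> finite S \<and> S \<subseteq> carrier G \<and> generate G S = carrier G"

definition finitely_generated :: "('a, 'm) monoid_scheme \<Rightarrow> bool" where
  "finitely_generated G \<longleftrightarrow> (\<exists>S. finite_generating_set G S)"

definition word_length :: "('a, 'm) monoid_scheme \<Rightarrow> 'a set \<Rightarrow> 'a \<Rightarrow> nat" where
  "word_length G S x =
    (LEAST n. \<exists>ws. set ws \<subseteq> S \<union> m_inv G ` S \<and> length ws = n \<and> x = foldr (mult G) ws \<one>\<^bsub>G\<^esub>)"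

text \<open>The left-invariant word metric.\<close>

definition word_dist :: "('a, 'm) monoid_scheme \<Rightarrow> 'a set \<Rightarrow> 'a \<Rightarrow> 'a \<Rightarrow> real" where
  "word_dist G S x y = real (word_length G S (inv\<^bsub>G\<^esub> x \<otimes>\<^bsub>G\<^esub> y))"

text \<open>
  Word metrics of different finite generating sets are bi-Lipschitz equivalent, so the next three
  notions do not depend on the generating sets whose existence they assert.
\<close>

definition polynomial_growth :: "('a, 'm) monoid_scheme \<Rightarrow> bool" where
  "polynomial_growth G \<longleftrightarrow>
    (\<exists>S. finite_generating_set G S \<and>
      (\<exists>(C::real) (d::nat). \<forall>n\<ge>1. real (card {x \<in> carrier G. word_length G S x \<le> n}) \<le> C * real n ^ d))"

definition quasi_isometry ::
    "('a, 'm) monoid_scheme \<Rightarrow> ('b, 'n) monoid_scheme \<Rightarrow> ('a \<Rightarrow> 'b) \<Rightarrow> bool" where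
  "quasi_isometry G H f \<longleftrightarrow>
    f \<in> carrier G \<rightarrow> carrier H \<and>
    (\<exists>S T. finite_generating_set G S \<and> finite_generating_set H T \<and>
      (\<exists>(A::real) (B::real). A \<ge> 1 \<and> B \<ge> 0 \<and>
        (\<forall>x\<in>carrier G. \<forall>y\<in>carrier G.
           word_dist G S x y / A - B \<le> word_dist H T (f x) (f y) \<and>
           word_dist H T (f x) (f y) \<le> A * word_dist G S x y + B) \<and>
        (\<forall>z\<in>carrier H. \<exists>x\<in>carrier G. word_dist H T (f x) z \<le> B)))"

definition at_bounded_distance ::
    "'a set \<Rightarrow> ('b, 'n) monoid_scheme \<Rightarrow> ('a \<Rightarrow> 'b) \<Rightarrow> ('a \<Rightarrow> 'b) \<Rightarrow> bool" where
  "at_bounded_distance A H f g \<longleftrightarrow>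
    (\<exists>T. finite_generating_set H T \<and> bdd_above ((\<lambda>x. word_dist H T (f x) (g x)) ` A))"

section \<open>Torsion-free nilpotent subgroups of finite index\<close>

definition torsion_free :: "('a, 'm) monoid_scheme \<Rightarrow> bool" where
  "torsion_free G \<longleftrightarrow>
    (\<forall>x\<in>carrier G. \<forall>n::nat. n > 0 \<longrightarrow> x [^]\<^bsub>G\<^esub> n = \<one>\<^bsub>G\<^esub> \<longrightarrow> x = \<one>\<^bsub>G\<^esub>)"

primrec lower_central_series :: "('a, 'm) monoid_scheme \<Rightarrow> nat \<Rightarrow> 'a set" where
  "lower_central_series G 0 = carrier G"
| "lower_central_series G (Suc n) =
    generate G (\<Union>x\<in>lower_central_series G n. \<Union>y\<in>carrier G.
      {x \<otimes>\<^bsub>G\<^esub> y \<otimes>\<^bsub>G\<^esub> inv\<^bsub>G\<^esub> x \<otimes>\<^bsub>G\<^esub> inv\<^bsub>G\<^esub> y})"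

definition nilpotent_group :: "('a, 'm) monoid_scheme \<Rightarrow> bool" where
  "nilpotent_group G \<longleftrightarrow> (\<exists>n. lower_central_series G n = {\<one>\<^bsub>G\<^esub>})"

definition finite_index :: "'a set \<Rightarrow> ('a, 'm) monoid_scheme \<Rightarrow> bool" where
  "finite_index N G \<longleftrightarrow> finite (rcosets\<^bsub>G\<^esub> N)"

section \<open>Tensoring an abelian group with the reals\<close>

text \<open>
  For a (multiplicatively written) abelian group \<open>A\<close>, the tensor product of \<open>A\<close> with the additive
  group of the reals over the integers is the free abelian group on \<open>carrier A \<times> UNIV\<close> modulo the
  subgroup generated by the bilinearity relations. It is a real vector space via the second factor.
\<close>

definition tensor_free :: "('a, 'm) monoid_scheme \<Rightarrow> (('a \<times> real) \<Rightarrow>\<^sub>0 int) monoid" where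
  "tensor_free A = free_Abelian_group (carrier A \<times> UNIV)"

definition tensor_relations :: "('a, 'm) monoid_scheme \<Rightarrow> (('a \<times> real) \<Rightarrow>\<^sub>0 int) set" where
  "tensor_relations A =
    {frag_of (a \<otimes>\<^bsub>A\<^esub> b, r) - frag_of (a, r) - frag_of (b, r) | a b r. a \<in> carrier A \<and> b \<in> carrier A} \<union>
    {frag_of (a, r + s) - frag_of (a, r) - frag_of (a, s) | a r s. a \<in> carrier A}"

definition tensor_kernel :: "('a, 'm) monoid_scheme \<Rightarrow> (('a \<times> real) \<Rightarrow>\<^sub>0 int) set" where
  "tensor_kernel A = generate (tensor_free A) (tensor_relations A)"

text \<open>
  The fields \<open>mult\<close> and \<open>one\<close> of a module record play no role. In the definition of \<open>smult\<close>, all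
  the cosets in the union coincide.
\<close>

definition real_tensor ::
    "('a, 'm) monoid_scheme \<Rightarrow> (real, (('a \<times> real) \<Rightarrow>\<^sub>0 int) set) module" where
  "real_tensor A =
    \<lparr>carrier = carrier (tensor_free A Mod tensor_kernel A),
     monoid.mult = (\<lambda>_ _. undefined),
     one = undefined,
     zero = \<one>\<^bsub>tensor_free A Mod tensor_kernel A\<^esub>,
     add = mult (tensor_free A Mod tensor_kernel A),
     smult = (\<lambda>r U. \<Union>c\<in>U.
       tensor_kernel A #>\<^bsub>tensor_free A\<^esub> frag_extend (\<lambda>(a, s). frag_of (a, r * s)) c)\<rparr>"

definition pure_tensor :: "('a, 'm) monoid_scheme \<Rightarrow> 'a \<Rightarrow> real \<Rightarrow> (('a \<times> real) \<Rightarrow>\<^sub>0 int) set" where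
  "pure_tensor A a r = tensor_kernel A #>\<^bsub>tensor_free A\<^esub> frag_of (a, r)"

definition linear_between ::
    "(real, 'v) module \<Rightarrow> (real, 'w) module \<Rightarrow> ('v \<Rightarrow> 'w) \<Rightarrow> bool" where
  "linear_between V W L \<longleftrightarrow>
    L \<in> carrier V \<rightarrow> carrier W \<and>
    (\<forall>x\<in>carrier V. \<forall>y\<in>carrier V. L (x \<oplus>\<^bsub>V\<^esub> y) = L x \<oplus>\<^bsub>W\<^esub> L y) \<and>
    (\<forall>r. \<forall>x\<in>carrier V. L (r \<odot>\<^bsub>V\<^esub> x) = r \<odot>\<^bsub>W\<^esub> L x)"

definition is_norm :: "(real, 'v) module \<Rightarrow> ('v \<Rightarrow> real) \<Rightarrow> bool" where
  "is_norm V \<nu> \<longleftrightarrow>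
    (\<forall>x\<in>carrier V. 0 \<le> \<nu> x \<and> (\<nu> x = 0 \<longleftrightarrow> x = \<zero>\<^bsub>V\<^esub>)) \<and>
    (\<forall>r. \<forall>x\<in>carrier V. \<nu> (r \<odot>\<^bsub>V\<^esub> x) = \<bar>r\<bar> * \<nu> x) \<and>
    (\<forall>x\<in>carrier V. \<forall>y\<in>carrier V. \<nu> (x \<oplus>\<^bsub>V\<^esub> y) \<le> \<nu> x + \<nu> y)"

section \<open>Real-valued homomorphisms\<close>

definition real_hom :: "('a, 'm) monoid_scheme \<Rightarrow> ('a \<Rightarrow> real) set" where
  "real_hom A = {\<phi>. \<forall>a\<in>carrier A. \<forall>b\<in>carrier A. \<phi> (a \<otimes>\<^bsub>A\<^esub> b) = \<phi> a + \<phi> b}"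

text \<open>Only the values on \<open>carrier A\<close> of the members of \<open>real_hom A\<close> are relevant.\<close>

definition real_hom_basis :: "('a, 'm) monoid_scheme \<Rightarrow> nat \<Rightarrow> (nat \<Rightarrow> 'a \<Rightarrow> real) \<Rightarrow> bool" where
  "real_hom_basis A r \<phi> \<longleftrightarrow>
    (\<forall>i\<in>{1..r}. \<phi> i \<in> real_hom A) \<and>
    (\<forall>c::nat \<Rightarrow> real. (\<forall>a\<in>carrier A. (\<Sum>i=1..r. c i * \<phi> i a) = 0) \<longrightarrow> (\<forall>i\<in>{1..r}. c i = 0)) \<and>
    (\<forall>\<psi>\<in>real_hom A. \<exists>c::nat \<Rightarrow> real. \<forall>a\<in>carrier A. \<psi> a = (\<Sum>i=1..r. c i * \<phi> i a))"

text \<open>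
  A homomorphism \<open>\<phi>\<close> regarded as a linear functional on the tensor product, characterised by
  sending the pure tensor of \<open>a\<close> and \<open>r\<close> to \<open>r * \<phi> a\<close>. The value does not depend on the
  representative of the coset \<open>U\<close>.
\<close>

definition functional_of :: "('a \<Rightarrow> real) \<Rightarrow> (('a \<times> real) \<Rightarrow>\<^sub>0 int) set \<Rightarrow> real" where
  "functional_of \<phi> U =
    the_elem ((\<lambda>c. \<Sum>(a, r)\<in>Poly_Mapping.keys c. of_int (Poly_Mapping.lookup c (a, r)) * (r * \<phi> a)) ` U)"

section \<open>Abelianization and the induced linear map\<close>

definition abelianization :: "('a, 'm) monoid_scheme \<Rightarrow> 'a set monoid" where
  "abelianization G = G Mod derived G (carrier G)"

abbreviation real_abelianization ::
    "('a, 'm) monoid_scheme \<Rightarrow> (real, (('a set \<times> real) \<Rightarrow>\<^sub>0 int) set) module" where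
  "real_abelianization G \<equiv> real_tensor (abelianization G)"

definition ab_proj :: "('a, 'm) monoid_scheme \<Rightarrow> 'a \<Rightarrow> (('a set \<times> real) \<Rightarrow>\<^sub>0 int) set" where
  "ab_proj G x = pure_tensor (abelianization G) (derived G (carrier G) #>\<^bsub>G\<^esub> x) 1"

text \<open>
  In the remaining definitions, \<open>\<nu>\<close> is a norm on \<open>real_abelianization M\<close>. It only serves to express
  boundedness, so by finite dimensionality its choice does not matter.
\<close>

definition bounded_abelian_defect ::
    "('a, 'm) monoid_scheme \<Rightarrow> ('b, 'n) monoid_scheme \<Rightarrow> ((('b set \<times> real) \<Rightarrow>\<^sub>0 int) set \<Rightarrow> real) \<Rightarrow>
      ('a \<Rightarrow> 'b) \<Rightarrow> bool" where
  "bounded_abelian_defect N M \<nu> \<Psi> \<longleftrightarrow>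
    bdd_above ((\<lambda>(x, y). \<nu> (ab_proj M (\<Psi> (x \<otimes>\<^bsub>N\<^esub> y))
        \<ominus>\<^bsub>real_abelianization M\<^esub> ab_proj M (\<Psi> x) \<ominus>\<^bsub>real_abelianization M\<^esub> ab_proj M (\<Psi> y)))
      ` (carrier N \<times> carrier N))"

text \<open>The restriction to \<open>extensional\<close> functions makes the linear map unique as a HOL function.\<close>

definition L_ab ::
    "('a, 'm) monoid_scheme \<Rightarrow> ('b, 'n) monoid_scheme \<Rightarrow> ((('b set \<times> real) \<Rightarrow>\<^sub>0 int) set \<Rightarrow> real) \<Rightarrow>
      ('a \<Rightarrow> 'b) \<Rightarrow> (('a set \<times> real) \<Rightarrow>\<^sub>0 int) set \<Rightarrow> (('b set \<times> real) \<Rightarrow>\<^sub>0 int) set" where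
  "L_ab N M \<nu> \<Psi> =
    (THE L. L \<in> extensional (carrier (real_abelianization N)) \<and>
       linear_between (real_abelianization N) (real_abelianization M) L \<and>
       bdd_above ((\<lambda>x. \<nu> (ab_proj M (\<Psi> x) \<ominus>\<^bsub>real_abelianization M\<^esub> L (ab_proj N x))) ` carrier N))"

definition T_map ::
    "('a, 'm) monoid_scheme \<Rightarrow> ('b, 'n) monoid_scheme \<Rightarrow> ((('b set \<times> real) \<Rightarrow>\<^sub>0 int) set \<Rightarrow> real) \<Rightarrow>
      ('a \<Rightarrow> 'b) \<Rightarrow> ('a set \<Rightarrow> real) \<Rightarrow> 'b set \<Rightarrow> real" where
  "T_map N M \<nu> \<Psi> \<phi> =
    (\<lambda>b. functional_of \<phi>
       (inv_into (carrier (real_abelianization N)) (L_ab N M \<nu> \<Psi>) (pure_tensor (abelianization M) b 1)))"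

section \<open>Coarse harmonic coordinates\<close>

definition harmonic_coords ::
    "('a, 'm) monoid_scheme \<Rightarrow> (nat \<Rightarrow> 'a set \<Rightarrow> real) \<Rightarrow> 'a \<Rightarrow> nat \<Rightarrow> real" where
  "harmonic_coords N \<phi> x i = functional_of (\<phi> i) (ab_proj N x)"

definition coset_decomposition ::
    "('a, 'm) monoid_scheme \<Rightarrow> 'a set \<Rightarrow> nat \<Rightarrow> (nat \<Rightarrow> 'a) \<Rightarrow> bool" where
  "coset_decomposition G N k g \<longleftrightarrow>
    g ` {1..k} \<subseteq> carrier G \<and> k \<ge> 1 \<and> g 1 = \<one>\<^bsub>G\<^esub> \<and>
    carrier G = (\<Union>j\<in>{1..k}. N #>\<^bsub>G\<^esub> g j) \<and>
    disjoint_family_on (\<lambda>j. N #>\<^bsub>G\<^esub> g j) {1..k}"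

definition extend_by_cosets ::
    "('a, 'm) monoid_scheme \<Rightarrow> 'a set \<Rightarrow> nat \<Rightarrow> (nat \<Rightarrow> 'a) \<Rightarrow> ('a \<Rightarrow> 'c) \<Rightarrow> 'a \<Rightarrow> 'c" where
  "extend_by_cosets G N k g F x = F (THE n. n \<in> N \<and> (\<exists>j\<in>{1..k}. x = n \<otimes>\<^bsub>G\<^esub> g j))"

end

theory Submission
  imports Defs
begin

text \<open>
  Composing \<open>\<pi>\<^sub>M \<circ> \<Psi>\<close> with the coordinates of \<open>M\<^sub>a\<^sub>b \<otimes> \<real>\<close> gives quasimorphisms on \<open>N\<close>. A homogeneous
  quasimorphism on a nilpotent group is a homomorphism, since it vanishes successively on the terms of
  the lower central series; hence the linear map \<open>L\<close> with \<open>\<pi>\<^sub>M \<circ> \<Psi> = L \<circ> \<pi>\<^sub>N + O(1)\<close> exists.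

  Injectivity of \<open>L\<close> rests on the fact that a Lipschitz path in a nilpotent group with bounded
  abelianization has zero speed: the error of such a path in \<open>\<gamma>\<^sub>i / \<gamma>\<^sub>i\<^sub>+\<^sub>1\<close>, \<open>i \<ge> 2\<close>, is a product of
  central commutators, and \<open>[x, y] ^ (k * q) = [x ^ k, y ^ q]\<close> has length \<open>O(k + q)\<close>. A path in \<open>N\<close>
  along a kernel vector of \<open>L\<close> would have positive speed, but its image under \<open>\<Psi>\<close> zero speed.
  Surjectivity follows by applying the existence of linear approximations to a coarse inverse of \<open>\<Psi>\<close>.

  The difference of the two coordinate maps at \<open>x \<in> N\<close> is then a linear functional of
  \<open>\<pi>\<^sub>M (\<Psi> x) - L (\<pi>\<^sub>N x)\<close>, so it is bounded; passing to \<open>G\<close> and \<open>H\<close> changes it by a bounded amount.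
\<close>

section \<open>Length functions\<close>

text \<open>Three obstacles shape the argument. A kernel vector of L need not be rational, so no
  element of N need point along it; the test path follows integer points near the ray, and as \<Psi>
  is no homomorphism, its image in M is merely a Lipschitz path. The descent along the lower central
  series fixes a block length at each level and replaces it by a multiple at the next; to be
  repeatable, each estimate must hold uniformly in the starting point. This uniformity comes from
  local finiteness of the word metric: all increments over a given number of steps lie in one finite
  set. Finally, equality of the ranks of N and M is not known beforehand, so surjectivity of L
  cannot be read off from injectivity by counting dimensions. A coarse inverse supplies it, and
  injectivity comes first because it makes the function pulled back along L a norm.\<close>

definition length_function :: "('a, 'm) monoid_scheme \<Rightarrow> ('a \<Rightarrow> real) \<Rightarrow> bool" where
  "length_function G L \<longleftrightarrow>
    L \<one>\<^bsub>G\<^esub> = 0 \<and> (\<forall>x\<in>carrier G. 0 \<le> L x \<and> L (inv\<^bsub>G\<^esub> x) = L x) \<and>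
    (\<forall>x\<in>carrier G. \<forall>y\<in>carrier G. L (x \<otimes>\<^bsub>G\<^esub> y) \<le> L x + L y)"

lemma length_functionD:
  assumes "length_function G L"
  shows "L \<one>\<^bsub>G\<^esub> = 0" "x \<in> carrier G \<Longrightarrow> 0 \<le> L x" "x \<in> carrier G \<Longrightarrow> L (inv\<^bsub>G\<^esub> x) = L x"
    "x \<in> carrier G \<Longrightarrow> y \<in> carrier G \<Longrightarrow> L (x \<otimes>\<^bsub>G\<^esub> y) \<le> L x + L y"
  using assms unfolding length_function_def by auto

context group
begin

lemma foldr_mult_closed: "set ws \<subseteq> carrier G \<Longrightarrow> foldr (\<otimes>) ws \<one> \<in> carrier G"
  by (induction ws) auto

lemma foldr_mult_append:
  assumes "set ws \<subseteq> carrier G" "set vs \<subseteq> carrier G"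
  shows "foldr (\<otimes>) (ws @ vs) \<one> = foldr (\<otimes>) ws \<one> \<otimes> foldr (\<otimes>) vs \<one>"
  using assms by (induction ws) (auto simp: foldr_mult_closed m_assoc)

lemma foldr_mult_inv:
  assumes "set ws \<subseteq> carrier G"
  shows "inv (foldr (\<otimes>) ws \<one>) = foldr (\<otimes>) (rev (map (m_inv G) ws)) \<one>"
  using assms
proof (induction ws)
  case (Cons a ws)
  have "foldr (\<otimes>) (rev (map (m_inv G) (a # ws))) \<one>
      = foldr (\<otimes>) (rev (map (m_inv G) ws)) \<one> \<otimes> foldr (\<otimes>) [inv a] \<one>"
    using Cons.prems by (subst foldr_mult_append[symmetric]) auto
  with Cons show ?case by (auto simp: inv_mult_group foldr_mult_closed)
qed simp

lemma generating_word_exists: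
  assumes S: "S \<subseteq> carrier G" and x: "x \<in> generate G S"
  shows "\<exists>ws. set ws \<subseteq> S \<union> m_inv G ` S \<and> x = foldr (\<otimes>) ws \<one>"
  using x
proof (induction rule: generate.induct)
  case one
  show ?case by (rule exI[of _ "[]"]) auto
next
  case (incl h)
  then show ?case using S by (intro exI[of _ "[h]"]) auto
next
  case (inv h)
  then show ?case using S by (intro exI[of _ "[inv h]"]) auto
next
  case (eng h1 h2)
  then obtain ws vs where w: "set ws \<subseteq> S \<union> m_inv G ` S" "h1 = foldr (\<otimes>) ws \<one>"
    "set vs \<subseteq> S \<union> m_inv G ` S" "h2 = foldr (\<otimes>) vs \<one>" by blast
  have "S \<union> m_inv G ` S \<subseteq> carrier G" using S by auto
  with w show ?case
    by (intro exI[of _ "ws @ vs"]) (metis (no_types) Un_least foldr_mult_append order_trans set_append)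
qed

lemma word_length_le:
  assumes "set ws \<subseteq> S \<union> m_inv G ` S"
  shows "word_length G S (foldr (\<otimes>) ws \<one>) \<le> length ws"
  unfolding word_length_def by (rule Least_le) (use assms in auto)

lemma word_length_word:
  assumes "finite_generating_set G S" "x \<in> carrier G"
  obtains ws where "set ws \<subseteq> S \<union> m_inv G ` S" "length ws = word_length G S x"
    "x = foldr (\<otimes>) ws \<one>"
proof -
  have "\<exists>n. \<exists>ws. set ws \<subseteq> S \<union> m_inv G ` S \<and> length ws = n \<and> x = foldr (\<otimes>) ws \<one>"
    using generating_word_exists[of S x] assms unfolding finite_generating_set_def by auto
  from LeastI_ex[OF this] show thesis using that unfolding word_length_def by auto
qed

lemma letters_carrier:
  assumes "finite_generating_set G S"
  shows "S \<union> m_inv G ` S \<subseteq> carrier G" "finite (S \<union> m_inv G ` S)"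
  using assms unfolding finite_generating_set_def by auto

lemma length_function_word_length:
  assumes S: "finite_generating_set G S"
  shows "length_function G (\<lambda>x. real (word_length G S x))"
proof -
  note [simp] = letters_carrier[OF S]
  have inv_le: "word_length G S (inv x) \<le> word_length G S x" if x: "x \<in> carrier G" for x
  proof -
    obtain ws where ws: "set ws \<subseteq> S \<union> m_inv G ` S" "length ws = word_length G S x"
      "x = foldr (\<otimes>) ws \<one>" using word_length_word[OF S x] .
    have c: "set ws \<subseteq> carrier G" using ws letters_carrier[OF S] by blast
    have "inv h \<in> S \<union> m_inv G ` S" if h: "h \<in> S \<union> m_inv G ` S" for h
    proof -
      have "S \<subseteq> carrier G" using letters_carrier[OF S] by auto
      with h show ?thesis by auto
    qed
    hence "set (rev (map (m_inv G) ws)) \<subseteq> S \<union> m_inv G ` S"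
      using ws(1) unfolding set_rev set_map by (blast dest: subsetD)
    from word_length_le[OF this] show ?thesis
      using ws by (simp add: foldr_mult_inv[OF c] del: set_rev)
  qed
  have "word_length G S \<one> = 0" using word_length_le[of "[]" S] by simp
  moreover have "word_length G S (inv x) = word_length G S x" if x: "x \<in> carrier G" for x
    using inv_le[OF x] inv_le[of "inv x"] x by simp
  moreover have "word_length G S (x \<otimes> y) \<le> word_length G S x + word_length G S y"
    if x: "x \<in> carrier G" and y: "y \<in> carrier G" for x y
  proof -
    obtain ws where ws: "set ws \<subseteq> S \<union> m_inv G ` S" "length ws = word_length G S x"
      "x = foldr (\<otimes>) ws \<one>" using word_length_word[OF S x] .
    obtain vs where vs: "set vs \<subseteq> S \<union> m_inv G ` S" "length vs = word_length G S y"
      "y = foldr (\<otimes>) vs \<one>" using word_length_word[OF S y] .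
    have c: "set ws \<subseteq> carrier G" "set vs \<subseteq> carrier G"
      using ws vs letters_carrier[OF S] by blast+
    show ?thesis using word_length_le[of "ws @ vs" S] ws vs
      by (simp add: foldr_mult_append[OF c] del: foldr_append)
  qed
  ultimately show ?thesis unfolding length_function_def
    by (auto simp flip: of_nat_add)
qed

text \<open>Local finiteness of the word metric. It turns bounds on distances into finite sets of
  group elements, both for the increments of a Lipschitz path and for the final comparison on G and
  H.\<close>

lemma finite_word_ball:
  assumes S: "finite_generating_set G S"
  shows "finite {x \<in> carrier G. real (word_length G S x) \<le> R}"
proof -
  let ?W = "{ws. set ws \<subseteq> S \<union> m_inv G ` S \<and> length ws \<le> nat \<lfloor>R\<rfloor>}"
  have "finite ?W" by (rule finite_lists_length_le) (rule letters_carrier[OF S])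
  moreover have "{x \<in> carrier G. real (word_length G S x) \<le> R} \<subseteq> (\<lambda>ws. foldr (\<otimes>) ws \<one>) ` ?W"
  proof
    fix x assume x: "x \<in> {x \<in> carrier G. real (word_length G S x) \<le> R}"
    obtain ws where ws: "set ws \<subseteq> S \<union> m_inv G ` S" "length ws = word_length G S x"
      "x = foldr (\<otimes>) ws \<one>" by (rule word_length_word[OF S, of x]) (use x in auto)
    have "length ws \<le> nat \<lfloor>R\<rfloor>" using ws x by (simp add: le_nat_floor)
    with ws show "x \<in> (\<lambda>ws. foldr (\<otimes>) ws \<one>) ` ?W" by auto
  qed
  ultimately show ?thesis by (rule finite_surj)
qed

lemma length_function_foldr:
  assumes L: "length_function G L" and "set ws \<subseteq> carrier G" "\<And>w. w \<in> set ws \<Longrightarrow> L w \<le> c"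
  shows "L (foldr (\<otimes>) ws \<one>) \<le> c * length ws"
  using assms(2,3)
proof (induction ws)
  case Nil
  then show ?case using length_functionD[OF L] by simp
next
  case (Cons w ws)
  have "L (w \<otimes> foldr (\<otimes>) ws \<one>) \<le> L w + L (foldr (\<otimes>) ws \<one>)"
    using Cons.prems by (intro length_functionD[OF L]) (auto simp: foldr_mult_closed)
  also have "\<dots> \<le> c + c * length ws" using Cons by (intro add_mono) auto
  finally show ?case by (simp add: algebra_simps)
qed

text \<open>A length function is bounded on the finitely many letters, so subadditivity bounds it
  linearly in the word length. Applied to norms of abelianized elements and to absolute values of
  homomorphisms, this supplies their Lipschitz bounds.\<close>

lemma length_function_le_word_length:
  assumes L: "length_function G L" and S: "finite_generating_set G S"
  obtains C where "C > 0" "\<And>x. x \<in> carrier G \<Longrightarrow> L x \<le> C * real (word_length G S x)"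
proof -
  let ?A = "S \<union> m_inv G ` S"
  \<comment> \<open>The summand 1 makes C positive even if L vanishes on every letter.\<close>
  define C where "C = 1 + (\<Sum>s\<in>?A. \<bar>L s\<bar>)"
  have C: "L s \<le> C" if "s \<in> ?A" for s
  proof -
    have "\<bar>L s\<bar> \<le> (\<Sum>s\<in>?A. \<bar>L s\<bar>)" by (rule member_le_sum) (use that letters_carrier[OF S] in auto)
    then show ?thesis unfolding C_def by linarith
  qed
  have "L x \<le> C * real (word_length G S x)" if x: "x \<in> carrier G" for x
  proof -
    obtain ws where ws: "set ws \<subseteq> ?A" "length ws = word_length G S x"
      "x = foldr (\<otimes>) ws \<one>" using word_length_word[OF S x] .
    show ?thesis unfolding ws(3) ws(2)[symmetric, unfolded ws(3)]
      by (rule length_function_foldr[OF L]) (use ws C letters_carrier[OF S] in auto)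
  qed
  moreover have "C > 0" unfolding C_def by (smt (verit) sum_nonneg)
  ultimately show thesis using that by blast
qed

lemma length_function_pow:
  assumes L: "length_function G L" and x: "x \<in> carrier G"
  shows "L (x [^] (n::nat)) \<le> n * L x"
proof (induction n)
  case 0
  then show ?case using length_functionD[OF L] by simp
next
  case (Suc n)
  have "L (x [^] Suc n) \<le> L (x [^] n) + L x" using x by (auto intro: length_functionD[OF L])
  with Suc show ?case by (simp add: algebra_simps)
qed

end

lemma (in group) length_function_left_quotient:
  assumes "length_function G L" "x \<in> carrier G" "y \<in> carrier G"
  shows "L (inv x \<otimes> y) \<le> L x + L y"
  using length_functionD(4)[OF assms(1), of "inv x" y] length_functionD(3)[OF assms(1), of x] assms(2,3) by simp

section \<open>The syntactic congruence of a function on a group\<close>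

text \<open>
  Passing to the quotient by the largest normal subgroup under which \<open>F\<close> is invariant is replaced by
  calculating modulo the congruence \<open>fcong G F\<close>; this avoids a change of the element type in
  inductions along the lower central series.
\<close>

definition fcong :: "('a, 'm) monoid_scheme \<Rightarrow> ('a \<Rightarrow> 'b) \<Rightarrow> 'a \<Rightarrow> 'a \<Rightarrow> bool" where
  "fcong G F x y \<longleftrightarrow>
    (\<forall>u\<in>carrier G. \<forall>w\<in>carrier G. F (u \<otimes>\<^bsub>G\<^esub> x \<otimes>\<^bsub>G\<^esub> w) = F (u \<otimes>\<^bsub>G\<^esub> y \<otimes>\<^bsub>G\<^esub> w))"

definition fcentral :: "('a, 'm) monoid_scheme \<Rightarrow> ('a \<Rightarrow> 'b) \<Rightarrow> 'a \<Rightarrow> bool" where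
  "fcentral G F c \<longleftrightarrow> c \<in> carrier G \<and> (\<forall>u\<in>carrier G. fcong G F (c \<otimes>\<^bsub>G\<^esub> u) (u \<otimes>\<^bsub>G\<^esub> c))"

lemma fcong_refl: "fcong G F x x"
  by (simp add: fcong_def)

lemma fcong_sym: "fcong G F x y \<Longrightarrow> fcong G F y x"
  by (simp add: fcong_def)

lemma fcong_trans [trans]: "fcong G F x y \<Longrightarrow> fcong G F y z \<Longrightarrow> fcong G F x z"
  by (simp add: fcong_def)

context group
begin

lemma fcong_mult:
  assumes "fcong G F x x'" "fcong G F y y'"
    and [simp]: "x \<in> carrier G" "y \<in> carrier G" "x' \<in> carrier G" "y' \<in> carrier G"
  shows "fcong G F (x \<otimes> y) (x' \<otimes> y')"
  unfolding fcong_def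
proof (intro ballI)
  fix u w assume [simp]: "u \<in> carrier G" "w \<in> carrier G"
  have "F (u \<otimes> (x \<otimes> y) \<otimes> w) = F (u \<otimes> x \<otimes> (y \<otimes> w))" by (simp add: m_assoc)
  also have "\<dots> = F (u \<otimes> x' \<otimes> (y \<otimes> w))" using assms(1) unfolding fcong_def by simp
  also have "\<dots> = F ((u \<otimes> x') \<otimes> y \<otimes> w)" by (simp add: m_assoc)
  also have "\<dots> = F ((u \<otimes> x') \<otimes> y' \<otimes> w)" using assms(2) unfolding fcong_def by simp
  finally show "F (u \<otimes> (x \<otimes> y) \<otimes> w) = F (u \<otimes> (x' \<otimes> y') \<otimes> w)" by (simp add: m_assoc)
qed

lemma fcong_mult_left:
  assumes "fcong G F y y'" "x \<in> carrier G" "y \<in> carrier G" "y' \<in> carrier G"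
  shows "fcong G F (x \<otimes> y) (x \<otimes> y')"
  using assms by (intro fcong_mult fcong_refl) auto

lemma fcong_mult_right:
  assumes "fcong G F x x'" "x \<in> carrier G" "x' \<in> carrier G" "y \<in> carrier G"
  shows "fcong G F (x \<otimes> y) (x' \<otimes> y)"
  using assms by (intro fcong_mult fcong_refl) auto

lemma fcentralD: "fcentral G F c \<Longrightarrow> u \<in> carrier G \<Longrightarrow> fcong G F (c \<otimes> u) (u \<otimes> c)"
  by (simp add: fcentral_def)

lemma fcentralD': "fcentral G F c \<Longrightarrow> u \<in> carrier G \<Longrightarrow> fcong G F (u \<otimes> c) (c \<otimes> u)"
  by (simp add: fcentral_def fcong_sym)

lemma fcong_eq:
  assumes "fcong G F x y" and "x \<in> carrier G" "y \<in> carrier G"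
  shows "F x = F y"
  using assms unfolding fcong_def by (metis l_one one_closed r_one)

lemma fcentral_one: "fcentral G F \<one>"
  by (simp add: fcentral_def fcong_refl)

lemma fcentral_mult:
  assumes "fcentral G F c" "fcentral G F d"
  shows "fcentral G F (c \<otimes> d)"
  unfolding fcentral_def
proof (intro conjI ballI)
  have [simp]: "c \<in> carrier G" "d \<in> carrier G" using assms unfolding fcentral_def by auto
  show "c \<otimes> d \<in> carrier G" by simp
  fix u assume [simp]: "u \<in> carrier G"
  have "fcong G F (c \<otimes> (d \<otimes> u)) (c \<otimes> (u \<otimes> d))"
    by (intro fcong_mult_left fcentralD assms) auto
  also have "c \<otimes> (u \<otimes> d) = (c \<otimes> u) \<otimes> d" by (simp add: m_assoc)
  also have "fcong G F ((c \<otimes> u) \<otimes> d) ((u \<otimes> c) \<otimes> d)"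
    by (intro fcong_mult_right fcentralD assms) auto
  finally show "fcong G F (c \<otimes> d \<otimes> u) (u \<otimes> (c \<otimes> d))" by (simp add: m_assoc)
qed

lemma fcentral_pow:
  assumes "fcentral G F c"
  shows "fcentral G F (c [^] (n::nat))"
  by (induction n) (use assms in \<open>auto simp: fcentral_one fcentral_mult\<close>)

text \<open>Multiplying the commutator by uc on the right gives cu. So if one term of the lower
  central series is trivial modulo the congruence, the preceding term is central modulo it; both
  arguments along the series rest on this.\<close>

lemma fcentral_if_commutators_trivial:
  assumes c: "c \<in> carrier G"
    and comm: "\<And>u. u \<in> carrier G \<Longrightarrow> fcong G F (c \<otimes> u \<otimes> inv c \<otimes> inv u) \<one>"
  shows "fcentral G F c"
  unfolding fcentral_def
proof (intro conjI ballI c)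
  fix u assume u: "u \<in> carrier G"
  have "fcong G F ((c \<otimes> u \<otimes> inv c \<otimes> inv u) \<otimes> (u \<otimes> c)) (\<one> \<otimes> (u \<otimes> c))"
    using c u by (intro fcong_mult fcong_refl comm) auto
  moreover have "(c \<otimes> u \<otimes> inv c \<otimes> inv u) \<otimes> (u \<otimes> c) = c \<otimes> u"
    using c u by (simp add: m_assoc inv_solve_left')
  ultimately show "fcong G F (c \<otimes> u) (u \<otimes> c)" using c u by simp
qed

lemma fcong_pow_mult:
  assumes "fcentral G F c" and [simp]: "u \<in> carrier G"
  shows "fcong G F ((u \<otimes> c) [^] (n::nat)) (u [^] n \<otimes> c [^] n)"
proof (induction n)
  case 0
  show ?case by (simp add: fcong_refl)
next
  case (Suc n)
  have [simp]: "c \<in> carrier G" using assms unfolding fcentral_def by auto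
  have "fcong G F ((u \<otimes> c) [^] n \<otimes> (u \<otimes> c)) ((u [^] n \<otimes> c [^] n) \<otimes> (u \<otimes> c))"
    by (intro fcong_mult Suc fcong_refl) auto
  also have "(u [^] n \<otimes> c [^] n) \<otimes> (u \<otimes> c) = u [^] n \<otimes> ((c [^] n \<otimes> u) \<otimes> c)" by (simp add: m_assoc)
  also have "fcong G F \<dots> (u [^] n \<otimes> ((u \<otimes> c [^] n) \<otimes> c))"
    by (intro fcong_mult_left[OF fcong_mult_right] fcentralD fcentral_pow assms) auto
  finally show ?case by (simp add: m_assoc)
qed

text \<open>The commutator relation is kept in the form xy ~ c(yx), which iterates without inverses:
  each further x crosses y at the price of one more c, and centrality moves that c to the
  front.\<close>

lemma fcong_pow_commute_left:
  assumes "fcentral G F c" and xy: "fcong G F (x \<otimes> y) (c \<otimes> (y \<otimes> x))"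
    and [simp]: "x \<in> carrier G" "y \<in> carrier G"
  shows "fcong G F (x [^] (n::nat) \<otimes> y) (c [^] n \<otimes> (y \<otimes> x [^] n))"
proof (induction n)
  case 0
  show ?case by (simp add: fcong_refl)
next
  case (Suc n)
  have [simp]: "c \<in> carrier G" using assms unfolding fcentral_def by auto
  have "x [^] Suc n \<otimes> y = x [^] n \<otimes> (x \<otimes> y)" by (simp add: m_assoc)
  also have "fcong G F \<dots> (x [^] n \<otimes> (c \<otimes> (y \<otimes> x)))"
    by (intro fcong_mult xy fcong_refl) auto
  also have "x [^] n \<otimes> (c \<otimes> (y \<otimes> x)) = (x [^] n \<otimes> c) \<otimes> (y \<otimes> x)" by (simp add: m_assoc)
  also have "fcong G F \<dots> ((c \<otimes> x [^] n) \<otimes> (y \<otimes> x))"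
    by (intro fcong_mult_right fcentralD' assms(1)) auto
  also have "(c \<otimes> x [^] n) \<otimes> (y \<otimes> x) = c \<otimes> ((x [^] n \<otimes> y) \<otimes> x)" by (simp add: m_assoc)
  also have "fcong G F \<dots> (c \<otimes> ((c [^] n \<otimes> (y \<otimes> x [^] n)) \<otimes> x))"
    by (intro fcong_mult Suc fcong_refl) auto
  also have "c \<otimes> ((c [^] n \<otimes> (y \<otimes> x [^] n)) \<otimes> x) = (c \<otimes> c [^] n) \<otimes> (y \<otimes> (x [^] n \<otimes> x))"
    by (simp add: m_assoc)
  also have "c \<otimes> c [^] n = c [^] Suc n" by (rule nat_pow_Suc2[symmetric]) simp
  finally show ?case by simp
qed

lemma fcong_pow_commute_right:
  assumes "fcentral G F c" and xy: "fcong G F (x \<otimes> y) (c \<otimes> (y \<otimes> x))"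
    and [simp]: "x \<in> carrier G" "y \<in> carrier G"
  shows "fcong G F (x \<otimes> y [^] (n::nat)) (c [^] n \<otimes> (y [^] n \<otimes> x))"
proof (induction n)
  case 0
  show ?case by (simp add: fcong_refl)
next
  case (Suc n)
  have [simp]: "c \<in> carrier G" using assms unfolding fcentral_def by auto
  have "x \<otimes> y [^] Suc n = (x \<otimes> y [^] n) \<otimes> y" by (simp add: m_assoc)
  also have "fcong G F \<dots> ((c [^] n \<otimes> (y [^] n \<otimes> x)) \<otimes> y)"
    by (intro fcong_mult Suc fcong_refl) auto
  also have "(c [^] n \<otimes> (y [^] n \<otimes> x)) \<otimes> y = c [^] n \<otimes> (y [^] n \<otimes> (x \<otimes> y))" by (simp add: m_assoc)
  also have "fcong G F \<dots> (c [^] n \<otimes> (y [^] n \<otimes> (c \<otimes> (y \<otimes> x))))"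
    by (intro fcong_mult xy fcong_refl) auto
  also have "c [^] n \<otimes> (y [^] n \<otimes> (c \<otimes> (y \<otimes> x))) = c [^] n \<otimes> ((y [^] n \<otimes> c) \<otimes> (y \<otimes> x))"
    by (simp add: m_assoc)
  also have "fcong G F \<dots> (c [^] n \<otimes> ((c \<otimes> y [^] n) \<otimes> (y \<otimes> x)))"
    by (intro fcong_mult_left[OF fcong_mult_right] fcentralD' assms(1)) auto
  finally show ?case by (simp add: m_assoc)
qed

text \<open>Bilinearity of a central commutator. Moving the power of x across y replaces c by
  \<open>c [^] m\<close>, which is again central and serves as the commutator when the power of y is
  moved.\<close>

lemma fcong_pow_commute:
  assumes c: "fcentral G F c" and xy: "fcong G F (x \<otimes> y) (c \<otimes> (y \<otimes> x))"
    and [simp]: "x \<in> carrier G" "y \<in> carrier G"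
  shows "fcong G F (x [^] (m::nat) \<otimes> y [^] (n::nat)) (c [^] (m * n) \<otimes> (y [^] n \<otimes> x [^] m))"
proof -
  have "c \<in> carrier G" using c unfolding fcentral_def by auto
  then show ?thesis
    using fcong_pow_commute_right[OF fcentral_pow[OF c] fcong_pow_commute_left[OF c xy], of m n]
    by (simp add: nat_pow_pow)
qed

section \<open>Normality and commutators in the lower central series\<close>

lemma lower_central_series_in_carrier: "lower_central_series G n \<subseteq> carrier G"
proof (induction n)
  case (Suc n)
  then show ?case unfolding lower_central_series.simps by (intro generate_incl) auto
qed simp

lemma lower_central_series_subgroup: "subgroup (lower_central_series G n) G"
proof (cases n)
  case (Suc k)
  then show ?thesis using lower_central_series_in_carrier[of k]
    by (auto intro!: generate_is_subgroup)
qed (simp add: subgroup_self)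

lemma commutator_in_lower_central_series:
  assumes "x \<in> lower_central_series G n" "y \<in> carrier G"
  shows "x \<otimes> y \<otimes> inv x \<otimes> inv y \<in> lower_central_series G (Suc n)"
  using assms by (auto intro!: generate.incl)

text \<open>A conjugate of a commutator is the commutator of the conjugates, and the first of these
  stays in term n by the induction hypothesis. Hence the generating set itself is invariant under
  conjugation.\<close>

lemma lower_central_series_normal: "lower_central_series G n \<lhd> G"
proof (induction n)
  case 0
  show ?case by (simp add: normal_self)
next
  case (Suc n)
  have c: "x \<in> carrier G" if "x \<in> lower_central_series G n" for x
    using that lower_central_series_in_carrier by blast
  show ?case unfolding lower_central_series.simps
  proof (rule normal_generateI)
    show "(\<Union>x\<in>lower_central_series G n. \<Union>y\<in>carrier G. {x \<otimes> y \<otimes> inv x \<otimes> inv y}) \<subseteq> carrier G"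
      using c by auto
    fix h g assume "h \<in> (\<Union>x\<in>lower_central_series G n. \<Union>y\<in>carrier G. {x \<otimes> y \<otimes> inv x \<otimes> inv y})"
      and g: "g \<in> carrier G"
    then obtain x y where xy: "x \<in> lower_central_series G n" "y \<in> carrier G"
      "h = x \<otimes> y \<otimes> inv x \<otimes> inv y" by auto
    note cx = c[OF xy(1)]
    define c where "c z = g \<otimes> z \<otimes> inv g" for z
    have c_mult: "c (a \<otimes> b) = c a \<otimes> c b" if "a \<in> carrier G" "b \<in> carrier G" for a b
    proof -
      have "c a \<otimes> c b = g \<otimes> a \<otimes> (inv g \<otimes> (g \<otimes> (b \<otimes> inv g)))"
        using g that unfolding c_def by (simp add: m_assoc)
      also have "inv g \<otimes> (g \<otimes> (b \<otimes> inv g)) = b \<otimes> inv g"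
        using g that by (simp add: m_assoc[symmetric])
      finally show ?thesis using g that unfolding c_def by (simp add: m_assoc)
    qed
    have c_inv: "c (inv a) = inv (c a)" if "a \<in> carrier G" for a
      using g that unfolding c_def by (simp add: m_assoc inv_mult_group)
    have "c h = c x \<otimes> c y \<otimes> inv (c x) \<otimes> inv (c y)"
      unfolding xy(3) using cx xy(2) by (simp add: c_mult c_inv[symmetric])
    hence "g \<otimes> h \<otimes> inv g = (g \<otimes> x \<otimes> inv g) \<otimes> (g \<otimes> y \<otimes> inv g) \<otimes> inv (g \<otimes> x \<otimes> inv g) \<otimes> inv (g \<otimes> y \<otimes> inv g)"
      unfolding c_def .
    moreover have "g \<otimes> x \<otimes> inv g \<in> lower_central_series G n"
      using Suc g xy(1) by (simp add: normal.inv_op_closed2)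
    ultimately show "g \<otimes> h \<otimes> inv g
        \<in> (\<Union>x\<in>lower_central_series G n. \<Union>y\<in>carrier G. {x \<otimes> y \<otimes> inv x \<otimes> inv y})"
      using g xy(2) by blast
  qed
qed

text \<open>The indexing starts with the whole group at 0, so the term with index
  \<open>Suc i\<close> is the one usually called \<gamma>_(i+2).\<close>

lemma lower_central_series_1: "lower_central_series G (Suc 0) = derived G (carrier G)"
  by (simp add: derived_def)

end

section \<open>Quasimorphisms on nilpotent groups\<close>

lemma mult_abs_diff: "real n * \<bar>a - b\<bar> = \<bar>real n * a - real n * b\<bar>"
  by (simp add: abs_mult flip: right_diff_distrib)

text \<open>The Archimedean principle behind the rigidity arguments below: a homogeneous quantity
  that stays bounded along powers, or along multiples of a block length, must vanish. It takes the
  place of limits.\<close>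

lemma eq_0_if_multiples_bounded:
  fixes a C :: real
  assumes "\<And>n::nat. n * \<bar>a\<bar> \<le> C"
  shows "a = 0"
proof (rule ccontr)
  assume "a \<noteq> 0"
  then obtain n :: nat where "n * \<bar>a\<bar> > C" using reals_Archimedean3[of "\<bar>a\<bar>"] by auto
  with assms[of n] show False by simp
qed

context group
begin

text \<open>
  The value \<open>f x\<close> is the infimum of \<open>(q (x ^ n) + D) / n\<close>; since \<open>q (x ^ n) + D\<close> is subadditive and
  \<open>q (x ^ n) - D\<close> superadditive in \<open>n\<close>, no limit is needed.
\<close>

lemma quasimorphism_homogenization:
  fixes q :: "'a \<Rightarrow> real"
  assumes D: "\<And>x y. x \<in> carrier G \<Longrightarrow> y \<in> carrier G \<Longrightarrow> \<bar>q (x \<otimes> y) - q x - q y\<bar> \<le> D"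
  obtains f where "\<And>x. x \<in> carrier G \<Longrightarrow> \<bar>q x - f x\<bar> \<le> D"
    "\<And>x n. x \<in> carrier G \<Longrightarrow> f (x [^] (n::nat)) = n * f x"
proof -
  define f where "f x = Inf ((\<lambda>n. (q (x [^] (n::nat)) + D) / real n) ` {1..})" for x
  have "\<bar>q (\<one> \<otimes> \<one>) - q \<one> - q \<one>\<bar> \<le> D" by (rule D) auto
  hence D0: "D \<ge> 0" by linarith
  have mult: "\<bar>q (x [^] (n * m)) - n * q (x [^] m)\<bar> \<le> (n - 1) * D"
    if x: "x \<in> carrier G" and "n \<ge> 1" for x and n m :: nat
    using \<open>n \<ge> 1\<close>
  proof (induction n rule: dec_induct)
    case base
    show ?case by simp
  next
    case (step n)
    have "x [^] (Suc n * m) = x [^] (n * m) \<otimes> x [^] m" using x by (simp add: nat_pow_mult add.commute)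
    with D[of "x [^] (n * m)" "x [^] m"] x
    have "\<bar>q (x [^] (Suc n * m)) - q (x [^] (n * m)) - q (x [^] m)\<bar> \<le> D" by auto
    with step.IH have "\<bar>q (x [^] (Suc n * m)) - (n * q (x [^] m) + q (x [^] m))\<bar> \<le> (n - 1) * D + D" by linarith
    with step.hyps show ?case by (simp add: algebra_simps of_nat_diff)
  qed
  \<comment> \<open>Both \<open>q (x [^] m)\<close> and \<open>q (x [^] n)\<close> are compared with
    q at the common power. Thus every quotient with -D lies below every quotient with +D, and f x,
    the infimum of the latter, separates the two families.\<close>
  have cross: "(q (x [^] m) - D) / m \<le> (q (x [^] n) + D) / n"
    if x: "x \<in> carrier G" and n: "n \<ge> 1" and m: "m \<ge> 1" for x and n m :: nat
  proof -
    have "\<bar>q (x [^] (n * m)) - n * q (x [^] m)\<bar> \<le> n * D" "\<bar>q (x [^] (n * m)) - m * q (x [^] n)\<bar> \<le> m * D"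
      using mult[OF x n, of m] mult[OF x m, of n] D0 n m
      by (auto simp: mult.commute algebra_simps of_nat_diff)
    hence "n * (q (x [^] m) - D) \<le> m * (q (x [^] n) + D)" by (simp add: algebra_simps)
    then show ?thesis using n m by (simp add: field_simps)
  qed
  have near: "\<bar>q (x [^] m) - m * f x\<bar> \<le> D" if x: "x \<in> carrier G" and m: "m \<ge> 1" for x and m :: nat
  proof -
    have "f x \<le> (q (x [^] m) + D) / m" unfolding f_def
    proof (rule cInf_lower)
      show "bdd_below ((\<lambda>n. (q (x [^] (n::nat)) + D) / real n) ` {1..})"
        by (rule bdd_belowI2[of _ "(q (x [^] (1::nat)) - D) / real 1"]) (use cross[OF x, of _ 1] in auto)
    qed (use m in auto)
    moreover have "(q (x [^] m) - D) / m \<le> f x" unfolding f_def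
      by (rule cInf_greatest) (use m cross[OF x] in auto)
    ultimately show ?thesis using m by (simp add: field_simps abs_le_iff)
  qed
  show thesis
  proof (rule that[of f])
    fix x assume x: "x \<in> carrier G"
    show "\<bar>q x - f x\<bar> \<le> D" using near[OF x, of 1] x by simp
  next
    fix x and k :: nat assume x: "x \<in> carrier G"
    have "f (x [^] k) - k * f x = 0"
    proof (rule eq_0_if_multiples_bounded)
      fix m :: nat
      show "m * \<bar>f (x [^] k) - k * f x\<bar> \<le> 2 * D + \<bar>f \<one>\<bar>"
      proof (cases "m = 0")
        case False
        note 1 = near[of "x [^] k" m]
        show ?thesis
        \<comment> \<open>The exponent in \<open>near\<close> must be positive, so k = 0 cannot be
          compared at exponent k * m. There the power is the identity, and comparing q with m times
          f and with f itself at that point explains the last summand of the bound.\<close>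
        proof (cases "k = 0")
          case True
          have "\<bar>q \<one> - m * f \<one>\<bar> \<le> D" "\<bar>q \<one> - f \<one>\<bar> \<le> D"
            using near[of \<one> m] near[of \<one> 1] False by auto
          with True show ?thesis by (auto simp: abs_if algebra_simps split: if_splits)
        next
          case k: False
          have "\<bar>q (x [^] (k * m)) - m * f (x [^] k)\<bar> \<le> D" "\<bar>q (x [^] (k * m)) - (k * m) * f x\<bar> \<le> D"
            using near[of "x [^] k" m] near[of x "k * m"] x False k by (auto simp: nat_pow_pow)
          hence "\<bar>m * f (x [^] k) - (k * m) * f x\<bar> \<le> 2 * D" by (simp add: abs_le_iff)
          moreover have "m * \<bar>f (x [^] k) - k * f x\<bar> = \<bar>m * f (x [^] k) - (k * m) * f x\<bar>"
            by (simp add: mult_abs_diff mult.commute mult.left_commute)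
          ultimately show ?thesis by linarith
        qed
      qed (use D0 in auto)
    qed
    then show "f (x [^] k) = k * f x" by simp
  qed
qed

text \<open>The induction runs downwards from a trivial term. Once a term is trivial for
  \<open>fcong G f\<close>, the term before it is central; on central elements f is additive, it
  vanishes on central commutators, and a central zero of f is congruent to the identity. When the
  derived subgroup is reached, every element of G is central, and additivity on central elements is
  the claim.\<close>

lemma homogeneous_quasimorphism_nilpotent:
  fixes f :: "'a \<Rightarrow> real"
  assumes nil: "nilpotent_group G"
    and D: "\<And>x y. x \<in> carrier G \<Longrightarrow> y \<in> carrier G \<Longrightarrow> \<bar>f (x \<otimes> y) - f x - f y\<bar> \<le> D"
    and hom: "\<And>x n. x \<in> carrier G \<Longrightarrow> f (x [^] (n::nat)) = n * f x"
    and xy: "x \<in> carrier G" "y \<in> carrier G"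
  shows "f (x \<otimes> y) = f x + f y"
proof -
  \<comment> \<open>Conjugating a power changes f by at most 2 * D plus the absolute values at y and
    its inverse, whatever the exponent; homogeneity then removes the error.\<close>
  have conj: "f (y \<otimes> x \<otimes> inv y) = f x" if [simp]: "x \<in> carrier G" "y \<in> carrier G" for x y
  proof -
    have pow: "(y \<otimes> x \<otimes> inv y) [^] n = y \<otimes> x [^] n \<otimes> inv y" for n :: nat
    proof (induction n)
      case (Suc n)
      have "y \<otimes> x [^] n \<otimes> inv y \<otimes> (y \<otimes> x \<otimes> inv y) = y \<otimes> x [^] n \<otimes> (inv y \<otimes> y) \<otimes> x \<otimes> inv y"
        by (simp only: m_assoc m_closed nat_pow_closed inv_closed that)
      with Suc show ?case by (simp add: m_assoc)
    qed simp
    have "f (y \<otimes> x \<otimes> inv y) - f x = 0"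
    proof (rule eq_0_if_multiples_bounded)
      fix n :: nat
      have "\<bar>f (y \<otimes> x [^] n \<otimes> inv y) - f (y \<otimes> x [^] n) - f (inv y)\<bar> \<le> D"
        "\<bar>f (y \<otimes> x [^] n) - f y - f (x [^] n)\<bar> \<le> D" by (rule D; simp)+
      hence "\<bar>f (y \<otimes> x [^] n \<otimes> inv y) - f (x [^] n)\<bar> \<le> 2 * D + \<bar>f y\<bar> + \<bar>f (inv y)\<bar>" by linarith
      also have "f (y \<otimes> x [^] n \<otimes> inv y) = n * f (y \<otimes> x \<otimes> inv y)"
        unfolding pow[symmetric] by (rule hom) simp
      also have "f (x [^] n) = n * f x" by (rule hom) simp
      finally show "n * \<bar>f (y \<otimes> x \<otimes> inv y) - f x\<bar> \<le> 2 * D + \<bar>f y\<bar> + \<bar>f (inv y)\<bar>"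
        by (simp add: mult_abs_diff)
    qed
    then show ?thesis by simp
  qed
  \<comment> \<open>Conjugating yx by x gives xy. So f is invariant under cyclic rotation of a
    product, which allows a factor to be moved to the end of a word.\<close>
  have cyc: "f (x \<otimes> y) = f (y \<otimes> x)" if [simp]: "x \<in> carrier G" "y \<in> carrier G" for x y
    using conj[of "y \<otimes> x" x] by (simp add: m_assoc)
  have central_add: "f (u \<otimes> c) = f u + f c" if c: "fcentral G f c" and u: "u \<in> carrier G" for u c
  proof -
    have [simp]: "c \<in> carrier G" using c unfolding fcentral_def by auto
    have "f (u \<otimes> c) - f u - f c = 0"
    proof (rule eq_0_if_multiples_bounded)
      fix n :: nat
      have "f ((u \<otimes> c) [^] n) = f (u [^] n \<otimes> c [^] n)"
        by (rule fcong_eq[OF fcong_pow_mult[OF c u]]) (use u in auto)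
      moreover have "\<bar>f (u [^] n \<otimes> c [^] n) - f (u [^] n) - f (c [^] n)\<bar> \<le> D"
        by (rule D) (use u in auto)
      ultimately have "\<bar>n * f (u \<otimes> c) - n * f u - n * f c\<bar> \<le> D"
        using u by (simp add: hom)
      then show "n * \<bar>f (u \<otimes> c) - f u - f c\<bar> \<le> D"
        by (simp add: mult_abs_diff right_diff_distrib)
    qed
    then show ?thesis by simp
  qed
  have trivial: "fcong G f c \<one>" if c: "fcentral G f c" and "f c = 0" for c
    unfolding fcong_def
  proof (intro ballI)
    fix u w assume [simp]: "u \<in> carrier G" "w \<in> carrier G"
    have [simp]: "c \<in> carrier G" using c unfolding fcentral_def by auto
    have "f (u \<otimes> c \<otimes> w) = f (w \<otimes> (u \<otimes> c))" by (rule cyc) auto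
    also have "\<dots> = f (w \<otimes> u \<otimes> c)" by (simp add: m_assoc)
    also have "\<dots> = f (w \<otimes> u)" using central_add[OF c, of "w \<otimes> u"] that by simp
    also have "\<dots> = f (u \<otimes> w)" by (rule cyc) auto
    finally show "f (u \<otimes> c \<otimes> w) = f (u \<otimes> \<one> \<otimes> w)" by simp
  qed
  have step: "\<forall>z\<in>lower_central_series G (Suc i). fcong G f z \<one>"
    if IH: "\<forall>z\<in>lower_central_series G (Suc (Suc i)). fcong G f z \<one>" for i
  proof
    have cen: "fcentral G f c" if c: "c \<in> lower_central_series G (Suc i)" for c
    proof (rule fcentral_if_commutators_trivial)
      show "c \<in> carrier G" using c lower_central_series_in_carrier by blast
      show "fcong G f (c \<otimes> u \<otimes> inv c \<otimes> inv u) \<one>" if "u \<in> carrier G" for u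
        using IH commutator_in_lower_central_series[OF c that] by blast
    qed
    fix z assume z: "z \<in> lower_central_series G (Suc i)"
    have inc: "(\<Union>x\<in>lower_central_series G i. \<Union>y\<in>carrier G. {x \<otimes> y \<otimes> inv x \<otimes> inv y}) \<subseteq> carrier G"
      using lower_central_series_in_carrier[of i] by auto
    \<comment> \<open>Moving x^n across y produces c^n. Since f takes the same value on x^n y and y
      x^n by \<open>cyc\<close>, the value at \<open>c [^] n\<close> is only an error of size D, for
      every n.\<close>
    have gen: "f (x \<otimes> y \<otimes> inv x \<otimes> inv y) = 0" if xi: "x \<in> lower_central_series G i" and [simp]: "y \<in> carrier G" for x y
    proof -
      define c where "c = x \<otimes> y \<otimes> inv x \<otimes> inv y"
      have [simp]: "x \<in> carrier G" using xi lower_central_series_in_carrier by blast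
      have cc: "fcentral G f c" unfolding c_def
        by (rule cen, rule commutator_in_lower_central_series) (use xi in auto)
      have [simp]: "c \<in> carrier G" unfolding c_def by simp
      have "x \<otimes> y = c \<otimes> (y \<otimes> x)" unfolding c_def by (simp add: m_assoc inv_solve_left')
      hence cong: "fcong G f (x [^] n \<otimes> y) (c [^] n \<otimes> (y \<otimes> x [^] n))" for n :: nat
        by (intro fcong_pow_commute_left[OF cc]) (auto simp: fcong_refl)
      have "f c = 0"
      proof (rule eq_0_if_multiples_bounded)
        fix n :: nat
        have "f (x [^] n \<otimes> y) = f (c [^] n \<otimes> (y \<otimes> x [^] n))" by (rule fcong_eq[OF cong]) auto
        moreover have "f (x [^] n \<otimes> y) = f (y \<otimes> x [^] n)" by (rule cyc) auto
        moreover have "\<bar>f (c [^] n \<otimes> (y \<otimes> x [^] n)) - f (c [^] n) - f (y \<otimes> x [^] n)\<bar> \<le> D" by (rule D) auto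
        ultimately have "\<bar>f (c [^] n)\<bar> \<le> D" by linarith
        then show "n * \<bar>f c\<bar> \<le> D" by (simp add: hom abs_mult)
      qed
      then show ?thesis unfolding c_def .
    qed
    have inv0: "f (inv c) = - f c" if "fcentral G f c" for c
    proof -
      have "c \<in> carrier G" using that unfolding fcentral_def by auto
      moreover have "f \<one> = 0" using hom[of \<one> 0] by simp
      ultimately show ?thesis using central_add[OF that, of "inv c"] by simp
    qed
    have "f z = 0" using z unfolding lower_central_series.simps
    proof (induction rule: generate.induct)
      case one
      show ?case using hom[of \<one> 0] by simp
    next
      case (incl h)
      then show ?case using gen by auto
    next
      case (inv h)
      have "fcentral G f h" by (rule cen) (use inv in \<open>auto intro: generate.incl\<close>)
      with inv gen show ?case by (auto simp: inv0)
    next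
      case (eng h1 h2)
      have "fcentral G f h2" "h1 \<in> carrier G"
        using eng cen lower_central_series_in_carrier[of "Suc i"] by auto
      with eng show ?case by (simp add: central_add)
    qed
    then show "fcong G f z \<one>" by (intro trivial cen z)
  qed
  obtain n where n: "lower_central_series G n = {\<one>}" using nil unfolding nilpotent_group_def by auto
  \<comment> \<open>The descent runs over indices of the form \<open>Suc i\<close>, so it starts one
    term after a trivial one; this also covers n = 0, the trivial group.\<close>
  have "\<forall>z\<in>lower_central_series G (Suc n). fcong G f z \<one>"
  proof -
    have "lower_central_series G (Suc n) \<subseteq> {\<one>}"
      unfolding lower_central_series.simps n
      by (rule generate_subgroup_incl) (auto intro: triv_subgroup)
    then show ?thesis by (metis fcong_refl singletonD subsetD)
  qed
  hence "\<forall>z\<in>lower_central_series G (Suc 0). fcong G f z \<one>"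
  proof (induction n)
    case (Suc n)
    show ?case by (rule Suc.IH, rule step, rule Suc.prems)
  qed
  hence "fcentral G f y"
    by (intro fcentral_if_commutators_trivial xy) (use commutator_in_lower_central_series[of y 0] xy in auto)
  from central_add[OF this xy(1)] show ?thesis .
qed

theorem quasimorphism_nilpotent:
  fixes q :: "'a \<Rightarrow> real"
  assumes nil: "nilpotent_group G"
    and D: "\<And>x y. x \<in> carrier G \<Longrightarrow> y \<in> carrier G \<Longrightarrow> \<bar>q (x \<otimes> y) - q x - q y\<bar> \<le> D"
  obtains f where "\<And>x. x \<in> carrier G \<Longrightarrow> \<bar>q x - f x\<bar> \<le> D"
    "\<And>x y. x \<in> carrier G \<Longrightarrow> y \<in> carrier G \<Longrightarrow> f (x \<otimes> y) = f x + f y"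
proof -
  obtain f where f: "\<And>x. x \<in> carrier G \<Longrightarrow> \<bar>q x - f x\<bar> \<le> D"
    "\<And>x n. x \<in> carrier G \<Longrightarrow> f (x [^] (n::nat)) = n * f x"
    using quasimorphism_homogenization[OF D] by blast
  \<comment> \<open>The defect D of q, and D for each of the three values at which f replaces
    q.\<close>
  have "\<bar>f (x \<otimes> y) - f x - f y\<bar> \<le> 4 * D" if "x \<in> carrier G" "y \<in> carrier G" for x y
    using D[OF that] f(1)[OF that(1)] f(1)[OF that(2)] f(1)[OF m_closed[OF that]] by linarith
  from homogeneous_quasimorphism_nilpotent[OF nil this f(2)] f(1) show thesis
    by (intro that[of f]) auto
qed

end

section \<open>Sublinearity of paths with sublinear abelianization\<close>

declare lower_central_series.simps(2) [simp del]

text \<open>The length of the image of x in G / P, that is, the infimum of L over the coset xP, as a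
  function on G itself. Elements of a normal P become trivial for its \<open>fcong\<close>, so all
  terms of the lower central series can be treated inside the one group G.\<close>

definition quotient_length :: "('a, 'm) monoid_scheme \<Rightarrow> ('a \<Rightarrow> real) \<Rightarrow> 'a set \<Rightarrow> 'a \<Rightarrow> real" where
  "quotient_length G L P x = Inf ((\<lambda>p. L (x \<otimes>\<^bsub>G\<^esub> p)) ` P)"

context group
begin

context
  fixes L :: "'a \<Rightarrow> real" and P :: "'a set"
  assumes L: "length_function G L" and P: "P \<lhd> G"
begin

private lemma P_carrier: "p \<in> P \<Longrightarrow> p \<in> carrier G"
  using P by (meson normal_imp_subgroup subgroup.mem_carrier)

private lemma P_one: "\<one> \<in> P"
  using P by (meson normal_imp_subgroup subgroup.one_closed)

private lemma P_inv: "p \<in> P \<Longrightarrow> inv p \<in> P"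
  using P by (meson normal_imp_subgroup subgroup.m_inv_closed)

private lemma P_mult: "p \<in> P \<Longrightarrow> q \<in> P \<Longrightarrow> p \<otimes> q \<in> P"
  using P by (meson normal_imp_subgroup subgroup.m_closed)

private lemma P_conj: "p \<in> P \<Longrightarrow> x \<in> carrier G \<Longrightarrow> inv x \<otimes> p \<otimes> x \<in> P"
  using P by (simp add: normal.inv_op_closed1)

lemma quotient_length_le:
  assumes "x \<in> carrier G" "p \<in> P"
  shows "quotient_length G L P x \<le> L (x \<otimes> p)"
  unfolding quotient_length_def
proof (rule cInf_lower)
  show "bdd_below ((\<lambda>p. L (x \<otimes> p)) ` P)"
    by (rule bdd_belowI2[of _ 0]) (use assms P_carrier in \<open>auto intro: length_functionD[OF L]\<close>)
qed (use assms in auto)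

lemma quotient_length_less:
  assumes "quotient_length G L P x < r"
  obtains p where "p \<in> P" "L (x \<otimes> p) < r"
proof -
  have "\<exists>z\<in>(\<lambda>p. L (x \<otimes> p)) ` P. z < r"
    using assms P_one unfolding quotient_length_def by (intro cInf_lessD) auto
  then show thesis using that by auto
qed

lemma quotient_length_le_length: "x \<in> carrier G \<Longrightarrow> quotient_length G L P x \<le> L x"
  using quotient_length_le[OF _ P_one, of x] by simp

lemma quotient_length_nonneg: "x \<in> carrier G \<Longrightarrow> 0 \<le> quotient_length G L P x"
  unfolding quotient_length_def
  by (rule cInf_greatest) (use P_one P_carrier in \<open>auto intro: length_functionD[OF L]\<close>)

text \<open>Near-minimisers xp and yq have their product in the coset xyP because P is normal, and
  inverting a near-minimiser likewise lands in the coset of the inverse. The infimum over a coset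
  need not be attained for a general L, hence the slack e.\<close>

lemma length_function_quotient: "length_function G (quotient_length G L P)"
proof -
  have inv_le: "quotient_length G L P x \<le> quotient_length G L P (inv x)" if x: "x \<in> carrier G" for x
  proof (rule field_le_epsilon)
    fix e :: real assume "e > 0"
    then obtain p where p: "p \<in> P" "L (inv x \<otimes> p) < quotient_length G L P (inv x) + e"
      using quotient_length_less[of "inv x" "quotient_length G L P (inv x) + e"] by auto
    have "x \<otimes> (inv x \<otimes> inv p \<otimes> x) = inv (inv x \<otimes> p)"
      using x P_carrier[OF p(1)] by (simp add: inv_mult_group m_assoc[symmetric])
    moreover have "L (inv (inv x \<otimes> p)) = L (inv x \<otimes> p)"
      by (rule length_functionD[OF L]) (use x P_carrier[OF p(1)] in auto)
    ultimately have "quotient_length G L P x \<le> L (inv x \<otimes> p)"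
      using quotient_length_le[OF x P_conj[OF P_inv[OF p(1)] x]] by simp
    with p show "quotient_length G L P x \<le> quotient_length G L P (inv x) + e" by simp
  qed
  have "quotient_length G L P (x \<otimes> y) \<le> quotient_length G L P x + quotient_length G L P y"
    if x: "x \<in> carrier G" and y: "y \<in> carrier G" for x y
  proof (rule field_le_epsilon)
    fix e :: real assume e: "e > 0"
    obtain p where p: "p \<in> P" "L (x \<otimes> p) < quotient_length G L P x + e / 2"
      using quotient_length_less[of x "quotient_length G L P x + e / 2"] e by auto
    obtain q where q: "q \<in> P" "L (y \<otimes> q) < quotient_length G L P y + e / 2"
      using quotient_length_less[of y "quotient_length G L P y + e / 2"] e by auto
    note c = P_carrier[OF p(1)] P_carrier[OF q(1)]
    have "y \<otimes> (inv y \<otimes> (p \<otimes> (y \<otimes> q))) = p \<otimes> (y \<otimes> q)"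
      using x y c by (simp add: m_assoc[symmetric])
    hence "x \<otimes> y \<otimes> ((inv y \<otimes> p \<otimes> y) \<otimes> q) = (x \<otimes> p) \<otimes> (y \<otimes> q)"
      using x y c by (simp add: m_assoc)
    hence "quotient_length G L P (x \<otimes> y) \<le> L ((x \<otimes> p) \<otimes> (y \<otimes> q))"
      using quotient_length_le[of "x \<otimes> y", OF _ P_mult[OF P_conj[OF p(1) y] q(1)]] x y by simp
    also have "\<dots> \<le> L (x \<otimes> p) + L (y \<otimes> q)"
      by (rule length_functionD[OF L]) (use x y c in auto)
    finally show "quotient_length G L P (x \<otimes> y)
        \<le> quotient_length G L P x + quotient_length G L P y + e" using p q by simp
  qed
  moreover have "quotient_length G L P \<one> = 0"
    using quotient_length_le_length[of \<one>] quotient_length_nonneg[of \<one>] length_functionD(1)[OF L] by simp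
  moreover have "quotient_length G L P (inv x) = quotient_length G L P x" if "x \<in> carrier G" for x
    using inv_le[OF that] inv_le[of "inv x"] that by simp
  ultimately show ?thesis
    unfolding length_function_def using quotient_length_nonneg by blast
qed

text \<open>By normality a factor p inside a word can be moved to its right end, where it costs
  nothing because its quotient length is 0. The same for the inverse of the moved factor gives
  equality.\<close>

lemma fcong_quotient_length:
  assumes p: "p \<in> P"
  shows "fcong G (quotient_length G L P) p \<one>"
  unfolding fcong_def
proof (intro ballI)
  note Q = length_function_quotient
  have zero: "quotient_length G L P p = 0" if "p \<in> P" for p
    using quotient_length_le[OF P_carrier[OF that] P_inv[OF that]] P_carrier[OF that]
      quotient_length_nonneg[of p] length_functionD(1)[OF L] by simp
  have le: "quotient_length G L P (x \<otimes> p) \<le> quotient_length G L P x"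
    if "x \<in> carrier G" "p \<in> P" for x p
    using length_functionD(4)[OF Q that(1) P_carrier[OF that(2)]] zero[OF that(2)] by simp
  fix u w assume uw: "u \<in> carrier G" "w \<in> carrier G"
  note c = P_carrier[OF p]
  let ?p = "inv w \<otimes> p \<otimes> w"
  have "w \<otimes> (inv w \<otimes> (p \<otimes> w)) = p \<otimes> w" using uw c by (simp add: m_assoc[symmetric])
  hence eq: "u \<otimes> p \<otimes> w = (u \<otimes> w) \<otimes> ?p" using uw c by (simp add: m_assoc)
  have p': "?p \<in> P" by (rule P_conj[OF p uw(2)])
  have "quotient_length G L P ((u \<otimes> w) \<otimes> ?p) = quotient_length G L P (u \<otimes> w)"
  proof (rule antisym)
    show "quotient_length G L P ((u \<otimes> w) \<otimes> ?p) \<le> quotient_length G L P (u \<otimes> w)"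
      by (rule le[OF _ p']) (use uw in auto)
    have "quotient_length G L P ((u \<otimes> w) \<otimes> ?p \<otimes> inv ?p) \<le> quotient_length G L P ((u \<otimes> w) \<otimes> ?p)"
      by (rule le[OF _ P_inv[OF p']]) (use uw c in auto)
    also have "(u \<otimes> w) \<otimes> ?p \<otimes> inv ?p = u \<otimes> w"
      using uw P_carrier[OF p'] by (simp add: m_assoc)
    finally show "quotient_length G L P (u \<otimes> w) \<le> quotient_length G L P ((u \<otimes> w) \<otimes> ?p)" .
  qed
  then show "quotient_length G L P (u \<otimes> p \<otimes> w) = quotient_length G L P (u \<otimes> \<one> \<otimes> w)"
    unfolding eq using uw by simp
qed

end

text \<open>This separates the increments of a path into short parts and central corrections: the
  corrections can be collected at the right end without disturbing the order of the short
  parts.\<close>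

lemma fcong_foldr_split:
  assumes "\<And>d. d \<in> set ds \<Longrightarrow> u d \<in> carrier G \<and> fcentral G F (z d) \<and> d = u d \<otimes> z d"
  shows "fcong G F (foldr (\<otimes>) ds \<one>) (foldr (\<otimes>) (map u ds) \<one> \<otimes> foldr (\<otimes>) (map z ds) \<one>)"
  using assms
proof (induction ds)
  case Nil
  show ?case by (simp add: fcong_refl)
next
  case (Cons d ds)
  let ?u = "foldr (\<otimes>) (map u ds) \<one>" and ?z = "foldr (\<otimes>) (map z ds) \<one>"
  have zc: "z d \<in> carrier G" if "d \<in> set ds" for d
    using Cons.prems that unfolding fcentral_def by auto
  have d: "u d \<in> carrier G" "fcentral G F (z d)" "d = u d \<otimes> z d" "z d \<in> carrier G"
    using Cons.prems unfolding fcentral_def by auto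
  have dc: "set ds \<subseteq> carrier G"
    using Cons.prems unfolding fcentral_def by (metis list.set_intros(2) m_closed subsetI)
  have c: "?u \<in> carrier G" "?z \<in> carrier G" "foldr (\<otimes>) ds \<one> \<in> carrier G" "d \<in> carrier G"
    by ((rule foldr_mult_closed; use Cons.prems dc zc in auto)+) (metis d m_closed)
  have "fcong G F (d \<otimes> foldr (\<otimes>) ds \<one>) (d \<otimes> (?u \<otimes> ?z))"
    by (rule fcong_mult_left) (use Cons c in auto)
  also have "d \<otimes> (?u \<otimes> ?z) = u d \<otimes> ((z d \<otimes> ?u) \<otimes> ?z)"
    using d(1,4) c by (subst d(3)) (simp add: m_assoc)
  also have "fcong G F \<dots> (u d \<otimes> ((?u \<otimes> z d) \<otimes> ?z))"
    by (intro fcong_mult_left[OF fcong_mult_right] fcentralD) (use d c in auto)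
  also have "u d \<otimes> ((?u \<otimes> z d) \<otimes> ?z) = (u d \<otimes> ?u) \<otimes> (z d \<otimes> ?z)"
    using d(1,4) c by (simp add: m_assoc)
  finally show ?case by simp
qed

text \<open>Central factors may be sorted, so a word over E becomes a product of one power for each
  element of E, whose exponents add up to the length of the word. Finiteness of E matters: the
  additive constants of its elements sum to one C that serves words of every length.\<close>

lemma slow_central_products:
  fixes F :: "'a \<Rightarrow> real" and \<epsilon> :: real
  assumes F: "length_function G F" and "finite E"
    and "\<And>e. e \<in> E \<Longrightarrow> fcentral G F e"
    and "\<And>e \<epsilon>. e \<in> E \<Longrightarrow> \<epsilon> > 0 \<Longrightarrow> \<exists>C. \<forall>n. F (e [^] (n::nat)) \<le> \<epsilon> * real n + C"
    and "\<epsilon> > 0"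
  shows "\<exists>C. \<forall>zs. set zs \<subseteq> E \<longrightarrow> F (foldr (\<otimes>) zs \<one>) \<le> \<epsilon> * length zs + C"
  using assms(2-4)
proof (induction E rule: finite_induct)
  case empty
  show ?case using length_functionD[OF F] by (auto intro: exI[of _ 0])
next
  case (insert e E)
  from insert obtain C1 where C1: "\<And>zs. set zs \<subseteq> E \<Longrightarrow> F (foldr (\<otimes>) zs \<one>) \<le> \<epsilon> * length zs + C1" by blast
  from insert.prems(2)[of e \<epsilon>] \<open>\<epsilon> > 0\<close> obtain C2 where C2: "\<And>n. F (e [^] (n::nat)) \<le> \<epsilon> * real n + C2" by blast
  have e: "fcentral G F e" "e \<in> carrier G" using insert.prems(1)[of e] unfolding fcentral_def by auto
  have Ec: "insert e E \<subseteq> carrier G" using insert.prems(1) unfolding fcentral_def by auto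
  have split: "fcong G F (foldr (\<otimes>) zs \<one>)
      (e [^] length (filter (\<lambda>z. z = e) zs) \<otimes> foldr (\<otimes>) (filter (\<lambda>z. z \<noteq> e) zs) \<one>)"
    if "set zs \<subseteq> insert e E" for zs
    using that
  proof (induction zs)
    case Nil
    show ?case by (simp add: fcong_refl)
  next
    case (Cons z zs)
    let ?n = "length (filter (\<lambda>z. z = e) zs)" and ?p = "foldr (\<otimes>) (filter (\<lambda>z. z \<noteq> e) zs) \<one>"
    have c: "z \<in> carrier G" "foldr (\<otimes>) zs \<one> \<in> carrier G" "?p \<in> carrier G"
      using Cons.prems Ec by (auto intro!: foldr_mult_closed)
    have "fcong G F (z \<otimes> foldr (\<otimes>) zs \<one>) (z \<otimes> (e [^] ?n \<otimes> ?p))"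
      by (rule fcong_mult_left) (use Cons c e in auto)
    also have "z \<otimes> (e [^] ?n \<otimes> ?p) = (z \<otimes> e [^] ?n) \<otimes> ?p" using c e by (simp add: m_assoc)
    also have "fcong G F \<dots> ((e [^] ?n \<otimes> z) \<otimes> ?p)"
      by (intro fcong_mult_right fcentralD' fcentral_pow) (use e c in auto)
    also have "(e [^] ?n \<otimes> z) \<otimes> ?p
        = e [^] length (filter (\<lambda>z. z = e) (z # zs)) \<otimes> foldr (\<otimes>) (filter (\<lambda>z. z \<noteq> e) (z # zs)) \<one>"
      using c e by (auto simp: m_assoc)
    finally show ?case by simp
  qed
  show ?case
  proof (intro exI allI impI)
    fix zs assume zs: "set zs \<subseteq> insert e E"
    let ?n = "length (filter (\<lambda>z. z = e) zs)" and ?zs = "filter (\<lambda>z. z \<noteq> e) zs"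
    have c: "foldr (\<otimes>) zs \<one> \<in> carrier G" "foldr (\<otimes>) ?zs \<one> \<in> carrier G"
      using zs Ec by (auto intro!: foldr_mult_closed)
    have "F (foldr (\<otimes>) zs \<one>) = F (e [^] ?n \<otimes> foldr (\<otimes>) ?zs \<one>)"
      by (rule fcong_eq[OF split[OF zs]]) (use c e in auto)
    also have "\<dots> \<le> F (e [^] ?n) + F (foldr (\<otimes>) ?zs \<one>)"
      by (rule length_functionD[OF F]) (use c e in auto)
    also have "\<dots> \<le> (\<epsilon> * ?n + C2) + (\<epsilon> * length ?zs + C1)"
      by (intro add_mono C1 C2) (use zs in auto)
    also have "\<dots> = \<epsilon> * length zs + (C1 + C2)"
      using sum_length_filter_compl[of "\<lambda>z. z = e" zs] by (simp flip: distrib_left add: algebra_simps flip: of_nat_add)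
    finally show "F (foldr (\<otimes>) zs \<one>) \<le> \<epsilon> * length zs + (C1 + C2)" .
  qed
qed

text \<open>
  The power \<open>c ^ (k * q)\<close> of a central commutator \<open>c\<close> of \<open>x\<close> and \<open>y\<close> is the commutator of \<open>x ^ k\<close>
  and \<open>y ^ q\<close>, whose length grows like \<open>k + q\<close>.
\<close>

lemma slow_central_commutator:
  assumes F: "length_function G F" and c: "fcentral G F c"
    and xy: "x \<in> carrier G" "y \<in> carrier G" "c = x \<otimes> y \<otimes> inv x \<otimes> inv y" and "\<epsilon> > 0"
  shows "\<exists>C. \<forall>n. F (c [^] (n::nat)) \<le> \<epsilon> * real n + C"
proof -
  have [simp]: "c \<in> carrier G" using xy by simp
  have comm: "x \<otimes> y = c \<otimes> (y \<otimes> x)" using xy by (simp add: m_assoc inv_solve_left')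
  \<comment> \<open>The commutator of x^k and y^q has length at most 2kF(x) + 2qF(y) and represents
    kq factors c. This k makes the part growing with q at most \<epsilon> per factor c, while the
    part with F x does not grow and goes into the constant.\<close>
  obtain k :: nat where k: "2 * F y / \<epsilon> < k" using reals_Archimedean2 by blast
  have Fy: "F y \<ge> 0" "F c \<ge> 0" "F x \<ge> 0" using length_functionD(2)[OF F] xy by auto
  hence k0: "k > 0" using k \<open>\<epsilon> > 0\<close> by (cases k) (auto simp: field_simps)
  have mid: "F (c [^] (k * q)) \<le> 2 * k * F x + 2 * q * F y" for q :: nat
  proof -
    have "fcong G F (x [^] k \<otimes> y [^] q) (c [^] (k * q) \<otimes> (y [^] q \<otimes> x [^] k))"
      by (rule fcong_pow_commute[OF c]) (use xy comm in \<open>auto simp: fcong_refl\<close>)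
    hence "fcong G F ((x [^] k \<otimes> y [^] q) \<otimes> inv (y [^] q \<otimes> x [^] k))
       ((c [^] (k * q) \<otimes> (y [^] q \<otimes> x [^] k)) \<otimes> inv (y [^] q \<otimes> x [^] k))"
      by (rule fcong_mult_right) (use xy in auto)
    also have "(c [^] (k * q) \<otimes> (y [^] q \<otimes> x [^] k)) \<otimes> inv (y [^] q \<otimes> x [^] k) = c [^] (k * q)"
      using xy(1,2) by (simp add: m_assoc del: inv_mult_group)
    finally have "F (c [^] (k * q)) = F ((x [^] k \<otimes> y [^] q) \<otimes> inv (y [^] q \<otimes> x [^] k))"
      by (intro fcong_eq[symmetric]) (use xy(1,2) in auto)
    also have "\<dots> \<le> F (x [^] k \<otimes> y [^] q) + F (inv (y [^] q \<otimes> x [^] k))"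
      by (rule length_functionD[OF F]) (use xy(1,2) in auto)
    also have "F (inv (y [^] q \<otimes> x [^] k)) = F (y [^] q \<otimes> x [^] k)"
      by (rule length_functionD[OF F]) (use xy(1,2) in auto)
    also have "F (x [^] k \<otimes> y [^] q) + F (y [^] q \<otimes> x [^] k)
        \<le> (F (x [^] k) + F (y [^] q)) + (F (y [^] q) + F (x [^] k))"
      by (intro add_mono length_functionD(4)[OF F]) (use xy(1,2) in auto)
    also have "\<dots> \<le> (k * F x + q * F y) + (q * F y + k * F x)"
      by (intro add_mono length_function_pow[OF F]) (use xy(1,2) in auto)
    finally show ?thesis by (simp add: algebra_simps)
  qed
  have "F (c [^] n) \<le> \<epsilon> * real n + (2 * k * F x + k * F c)" for n :: nat
  proof -
    \<comment> \<open>The bound \<open>mid\<close> covers multiples of k; the fewer than k remaining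
      factors c cost at most k * F c.\<close>
    have "c [^] n = c [^] (k * (n div k)) \<otimes> c [^] (n mod k)" by (simp add: nat_pow_mult)
    hence "F (c [^] n) \<le> F (c [^] (k * (n div k))) + F (c [^] (n mod k))"
      by (metis \<open>c \<in> carrier G\<close> length_functionD(4)[OF F] nat_pow_closed)
    also have "\<dots> \<le> (2 * k * F x + 2 * (n div k) * F y) + (n mod k) * F c"
      by (intro add_mono mid length_function_pow[OF F]) simp
    also have "(n mod k) * F c \<le> k * F c"
      using k0 Fy by (intro mult_right_mono) (auto intro: less_imp_le)
    also have "2 * (n div k) * F y \<le> \<epsilon> * n"
    proof -
      have "2 * F y \<le> \<epsilon> * k" using k \<open>\<epsilon> > 0\<close> by (simp add: field_simps)
      hence "2 * F y * (n div k) \<le> \<epsilon> * k * (n div k)" by (rule mult_right_mono) simp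
      also have "\<dots> = \<epsilon> * real (k * (n div k))" by simp
      also have "\<dots> \<le> \<epsilon> * n" using \<open>\<epsilon> > 0\<close> by (intro mult_left_mono) (auto simp del: of_nat_mult)
      finally show ?thesis by (simp add: mult_ac)
    qed
    finally show ?thesis by (simp add: algebra_simps)
  qed
  then show ?thesis by blast
qed

lemma fcentral_quotient_lower_central_series:
  assumes L: "length_function G L" and e: "e \<in> lower_central_series G i"
  shows "fcentral G (quotient_length G L (lower_central_series G (Suc i))) e"
proof (rule fcentral_if_commutators_trivial)
  show "e \<in> carrier G" using e lower_central_series_in_carrier by blast
  fix u assume "u \<in> carrier G"
  then show "fcong G (quotient_length G L (lower_central_series G (Suc i))) (e \<otimes> u \<otimes> inv e \<otimes> inv u) \<one>"
    by (intro fcong_quotient_length L lower_central_series_normal commutator_in_lower_central_series e)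
qed

text \<open>The commutators generating the term have slow powers, but a general element is a product
  of them and their inverses. Modulo the next term everything is central, so powers of a product
  split. Giving each of two factors \<epsilon> / 2 is the reason to prove the claim for all
  \<epsilon> at once.\<close>

lemma slow_lower_central_series:
  fixes i :: nat
  assumes L: "length_function G L" and e: "e \<in> lower_central_series G (Suc i)" and "\<epsilon> > 0"
  defines "F \<equiv> quotient_length G L (lower_central_series G (Suc (Suc i)))"
  shows "\<exists>C. \<forall>n. F (e [^] (n::nat)) \<le> \<epsilon> * real n + C"
proof -
  have F: "length_function G F"
    unfolding F_def by (rule length_function_quotient[OF L lower_central_series_normal])
  have cen: "fcentral G F c" if "c \<in> lower_central_series G (Suc i)" for c
    unfolding F_def by (rule fcentral_quotient_lower_central_series[OF L that])
  have c: "c \<in> carrier G" if "c \<in> lower_central_series G j" for c j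
    using that lower_central_series_in_carrier by blast
  show ?thesis using e \<open>\<epsilon> > 0\<close> unfolding lower_central_series.simps(2)
  proof (induction arbitrary: \<epsilon> rule: generate.induct)
    case one
    then show ?case using length_functionD[OF F] by (auto intro!: exI[of _ 0])
  next
    case (incl h)
    have "fcentral G F h" by (rule cen) (use incl in \<open>auto simp: lower_central_series.simps(2) intro: generate.incl\<close>)
    with incl c show ?case using slow_central_commutator[OF F] by blast
  next
    case (inv h)
    have "fcentral G F h" by (rule cen) (use inv in \<open>auto simp: lower_central_series.simps(2) intro: generate.incl\<close>)
    with inv c have "\<exists>C. \<forall>n. F (h [^] (n::nat)) \<le> \<epsilon> * real n + C" "h \<in> carrier G"
      using slow_central_commutator[OF F, of h] unfolding fcentral_def by blast+
    moreover from this have "F (inv h [^] n) = F (h [^] n)" for n :: nat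
      using length_functionD(3)[OF F, of "h [^] n"] by (simp add: nat_pow_inv)
    ultimately show ?case by simp
  next
    case (eng h1 h2)
    have h: "fcentral G F h2" "h1 \<in> carrier G" "h2 \<in> carrier G"
      using cen[of h2] c[of h1 "Suc i"] c[of h2 "Suc i"] eng.hyps
      unfolding lower_central_series.simps(2) by auto
    obtain C1 where C1: "\<And>n. F (h1 [^] (n::nat)) \<le> \<epsilon> / 2 * real n + C1"
      using eng.IH(1)[of "\<epsilon> / 2"] eng.prems by auto
    obtain C2 where C2: "\<And>n. F (h2 [^] (n::nat)) \<le> \<epsilon> / 2 * real n + C2"
      using eng.IH(2)[of "\<epsilon> / 2"] eng.prems by auto
    have "F ((h1 \<otimes> h2) [^] n) \<le> \<epsilon> * real n + (C1 + C2)" for n :: nat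
    proof -
      have "F ((h1 \<otimes> h2) [^] n) = F (h1 [^] n \<otimes> h2 [^] n)"
        by (rule fcong_eq[OF fcong_pow_mult]) (use h in auto)
      also have "\<dots> \<le> F (h1 [^] n) + F (h2 [^] n)" by (rule length_functionD[OF F]) (use h in auto)
      finally show ?thesis using C1[of n] C2[of n] by (simp add: algebra_simps)
    qed
    then show ?case by blast
  qed
qed

section \<open>Telescoping of paths and descent along the lower central series\<close>

lemma foldr_telescope:
  assumes y: "\<And>a. y a \<in> carrier G"
  shows "foldr (\<otimes>) (map (\<lambda>j. inv (y (a + j * m)) \<otimes> y (a + Suc j * m)) [0..<k]) \<one>
    = inv (y a) \<otimes> y (a + k * (m::nat))"
proof (induction k)
  case 0
  show ?case using y by simp
next
  case (Suc k)
  let ?f = "\<lambda>j. inv (y (a + j * m)) \<otimes> y (a + Suc j * m)"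
  have "foldr (\<otimes>) (map ?f [0..<Suc k]) \<one> = foldr (\<otimes>) (map ?f [0..<k] @ [?f k]) \<one>" by simp
  also have "\<dots> = foldr (\<otimes>) (map ?f [0..<k]) \<one> \<otimes> foldr (\<otimes>) [?f k] \<one>"
    by (rule foldr_mult_append) (use y in auto)
  also have "\<dots> = inv (y a) \<otimes> y (a + k * m) \<otimes> (inv (y (a + k * m)) \<otimes> y (a + Suc k * m))"
    using Suc y by simp
  also have "y (a + k * m) \<otimes> (inv (y (a + k * m)) \<otimes> y (a + Suc k * m)) = y (a + Suc k * m)"
    using y by (simp only: m_assoc[symmetric] inv_closed r_inv l_one)
  hence "inv (y a) \<otimes> y (a + k * m) \<otimes> (inv (y (a + k * m)) \<otimes> y (a + Suc k * m)) = inv (y a) \<otimes> y (a + Suc k * m)"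
    using y by (simp only: m_assoc inv_closed m_closed)
  finally show ?case .
qed

text \<open>
  Descending one step of the lower central series: the increments of length \<open>m\<close> split as \<open>u \<otimes> z\<close>
  with \<open>u\<close> short and \<open>z\<close> from a finite set of elements that are central modulo the next term and
  whose products grow sublinearly there.
\<close>

lemma sublinear_path_step:
  assumes S: "finite_generating_set G S" and y: "\<And>a. y a \<in> carrier G"
    and incr: "\<And>a. real (word_length G S (inv (y a) \<otimes> y (Suc a))) \<le> B"
    and IH: "\<And>\<epsilon>. \<epsilon> > 0 \<Longrightarrow> \<exists>m>0. \<forall>a. quotient_length G (\<lambda>x. real (word_length G S x))
        (lower_central_series G (Suc i)) (inv (y a) \<otimes> y (a + m)) < \<epsilon> * real m"
    and "\<epsilon> > 0"
  shows "\<exists>m>0. \<forall>a. quotient_length G (\<lambda>x. real (word_length G S x))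
        (lower_central_series G (Suc (Suc i))) (inv (y a) \<otimes> y (a + m)) < \<epsilon> * real m"
proof -
  define W where "W = (\<lambda>x. real (word_length G S x))"
  have W: "length_function G W" unfolding W_def by (rule length_function_word_length[OF S])
  define F where "F = quotient_length G W (lower_central_series G (Suc (Suc i)))"
  have F: "length_function G F"
    unfolding F_def by (rule length_function_quotient[OF W lower_central_series_normal])
  obtain m where m: "m > 0" "\<And>a. quotient_length G W (lower_central_series G (Suc i)) (inv (y a) \<otimes> y (a + m)) < \<epsilon> / 2 * m"
    using IH[of "\<epsilon> / 2"] \<open>\<epsilon> > 0\<close> unfolding W_def by auto
  \<comment> \<open>All increments over m steps. Their word length is at most B * m, so the set is
    finite. The elements p d and z d are chosen for members of D, and the constant C is taken for
    the finite set of all z d, so none of them depends on the starting point a.\<close>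
  define D where "D = range (\<lambda>a. inv (y a) \<otimes> y (a + m))"
  have Dc: "D \<subseteq> carrier G" unfolding D_def using y by auto
  have "W (inv (y a) \<otimes> y (a + m)) \<le> B * m" for a
    unfolding foldr_telescope[of y a 1 m, OF y, unfolded mult_1_right, symmetric]
    using length_function_foldr[OF W, of "map (\<lambda>j. inv (y (a + j * 1)) \<otimes> y (a + Suc j * 1)) [0..<m]" B]
      incr y by (auto simp: W_def)
  hence "D \<subseteq> {x \<in> carrier G. real (word_length G S x) \<le> B * m}"
    unfolding D_def W_def using y by auto
  hence finD: "finite D" using finite_word_ball[OF S] finite_subset by blast
  have "\<forall>d\<in>D. \<exists>p. p \<in> lower_central_series G (Suc i) \<and> W (d \<otimes> p) < \<epsilon> / 2 * m"
    using m(2) quotient_length_less[OF W lower_central_series_normal] unfolding D_def by blast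
  then obtain p where p: "\<And>d. d \<in> D \<Longrightarrow> p d \<in> lower_central_series G (Suc i)"
    "\<And>d. d \<in> D \<Longrightarrow> W (d \<otimes> p d) < \<epsilon> / 2 * m" by metis
  have pc: "p d \<in> carrier G" if "d \<in> D" for d using p(1)[OF that] lower_central_series_in_carrier by blast
  define z where "z d = inv (p d)" for d
  define u where "u d = d \<otimes> p d" for d
  have z: "z d \<in> lower_central_series G (Suc i)" if "d \<in> D" for d
    using p(1)[OF that] unfolding z_def by (rule subgroup.m_inv_closed[OF lower_central_series_subgroup])
  have uz: "u d \<in> carrier G \<and> fcentral G F (z d) \<and> d = u d \<otimes> z d" if "d \<in> D" for d
    using that pc[OF that] Dc fcentral_quotient_lower_central_series[OF W z[OF that]]
    unfolding u_def z_def F_def by (auto simp: m_assoc)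
  have zc: "z d \<in> carrier G" if "d \<in> D" for d using pc[OF that] unfolding z_def by simp
  \<comment> \<open>Budget for k blocks of length m: the short parts cost \<epsilon> / 2 * m * k,
    the central parts \<epsilon> / 4 * m * k + C, and k is chosen so large that C stays below the
    last quarter.\<close>
  have "\<exists>C. \<forall>zs. set zs \<subseteq> z ` D \<longrightarrow> F (foldr (\<otimes>) zs \<one>) \<le> \<epsilon> / 4 * m * length zs + C"
  proof (rule slow_central_products[OF F])
    show "fcentral G F e" if "e \<in> z ` D" for e using that uz by blast
    show "\<exists>C. \<forall>n. F (e [^] (n::nat)) \<le> \<epsilon>' * real n + C" if "e \<in> z ` D" "\<epsilon>' > 0" for e \<epsilon>'
      unfolding F_def by (rule slow_lower_central_series[OF W _ that(2)]) (use that z in auto)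
  qed (use finD \<open>\<epsilon> > 0\<close> m(1) in auto)
  then obtain C where C: "\<And>zs. set zs \<subseteq> z ` D \<Longrightarrow> F (foldr (\<otimes>) zs \<one>) \<le> \<epsilon> / 4 * m * length zs + C"
    by blast
  obtain k :: nat where k: "C / (\<epsilon> / 4 * m) < k" using reals_Archimedean2 by blast
  hence kC: "C < \<epsilon> / 4 * m * k" using m \<open>\<epsilon> > 0\<close> by (simp add: field_simps)
  have "C \<ge> 0" using C[of "[]"] length_functionD[OF F] by simp
  hence k0: "k > 0" using kC by (cases k) auto
  have main: "F (inv (y a) \<otimes> y (a + k * m)) < \<epsilon> * real (k * m)" for a
  proof -
    define ds where "ds = map (\<lambda>j. inv (y (a + j * m)) \<otimes> y (a + Suc j * m)) [0..<k]"
    have dsD: "set ds \<subseteq> D"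
    proof
      fix d assume "d \<in> set ds"
      then obtain j where "d = inv (y (a + j * m)) \<otimes> y (a + Suc j * m)" unfolding ds_def by auto
      also have "\<dots> = inv (y (a + j * m)) \<otimes> y ((a + j * m) + m)" by (simp add: add_ac)
      finally show "d \<in> D" unfolding D_def by blast
    qed
    let ?u = "foldr (\<otimes>) (map u ds) \<one>" and ?z = "foldr (\<otimes>) (map z ds) \<one>"
    have c: "foldr (\<otimes>) ds \<one> \<in> carrier G" "?u \<in> carrier G" "?z \<in> carrier G"
      by (rule foldr_mult_closed; use dsD Dc uz zc in \<open>auto dest: subsetD\<close>)+
    have "inv (y a) \<otimes> y (a + k * m) = foldr (\<otimes>) ds \<one>"
      unfolding ds_def by (rule foldr_telescope[OF y, symmetric])
    also have "F \<dots> = F (?u \<otimes> ?z)"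
    proof (rule fcong_eq[OF fcong_foldr_split])
      show "u d \<in> carrier G \<and> fcentral G F (z d) \<and> d = u d \<otimes> z d" if "d \<in> set ds" for d
        by (rule uz) (use that dsD in blast)
    qed (use c in auto)
    also have "\<dots> \<le> F ?u + F ?z" by (rule length_functionD[OF F]) (use c in auto)
    also have "F ?u \<le> W ?u" unfolding F_def
      by (rule quotient_length_le_length[OF W lower_central_series_normal]) (rule c)
    also have "W ?u \<le> \<epsilon> / 2 * m * length (map u ds)"
    proof (rule length_function_foldr[OF W])
      show "set (map u ds) \<subseteq> carrier G" using uz dsD by (auto dest: subsetD)
      show "W w \<le> \<epsilon> / 2 * m" if "w \<in> set (map u ds)" for w
      proof -
        from that obtain d where "d \<in> set ds" "w = u d" by auto
        with dsD p(2)[of d] show ?thesis unfolding u_def by auto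
      qed
    qed
    also have "F ?z \<le> \<epsilon> / 4 * m * length (map z ds) + C" by (rule C) (use dsD in auto)
    finally have "F (inv (y a) \<otimes> y (a + k * m)) \<le> \<epsilon> / 2 * m * k + (\<epsilon> / 4 * m * k + C)"
      unfolding ds_def by simp
    with kC show ?thesis by (simp add: algebra_simps)
  qed
  show ?thesis
    by (rule exI[of _ "k * m"]) (use main k0 m in \<open>auto simp: F_def W_def\<close>)
qed

text \<open>Repeated descent reaches a trivial term, where the quotient length is the word length
  itself, and telescoping over blocks of length m gives the bound at all multiples of m. The block
  length is quantified before k: it depends on \<epsilon> and may grow with each descent, but the
  resulting speed bound holds at all these times.\<close>

theorem sublinear_path:
  assumes nil: "nilpotent_group G"
    and S: "finite_generating_set G S" and y: "\<And>a. y a \<in> carrier G"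
    and incr: "\<And>a. real (word_length G S (inv (y a) \<otimes> y (Suc a))) \<le> B"
    and base: "\<And>\<epsilon>. \<epsilon> > 0 \<Longrightarrow> \<exists>m>0. \<forall>a. quotient_length G (\<lambda>x. real (word_length G S x))
        (derived G (carrier G)) (inv (y a) \<otimes> y (a + m)) < \<epsilon> * real m"
    and "\<epsilon> > 0"
  shows "\<exists>m>0. \<forall>k. real (word_length G S (inv (y 0) \<otimes> y (k * m))) \<le> \<epsilon> * real (k * m)"
proof -
  let ?W = "\<lambda>x. real (word_length G S x)"
  have W: "length_function G ?W" by (rule length_function_word_length[OF S])
  have all: "\<exists>m>0. \<forall>a. quotient_length G ?W (lower_central_series G (Suc i)) (inv (y a) \<otimes> y (a + m)) < \<epsilon> * real m"
    if "\<epsilon> > 0" for i \<epsilon>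
    using that
  proof (induction i arbitrary: \<epsilon>)
    case 0
    then show ?case unfolding lower_central_series_1 by (rule base)
  next
    case (Suc i)
    show ?case by (rule sublinear_path_step[OF S y incr Suc.IH Suc.prems])
  qed
  obtain n where n: "lower_central_series G n = {\<one>}" using nil unfolding nilpotent_group_def by auto
  \<comment> \<open>The descent concerns indices \<open>Suc i\<close>, so the term after a trivial
    one is used; it is trivial too.\<close>
  have n': "lower_central_series G (Suc n) = {\<one>}"
  proof -
    have "lower_central_series G (Suc n) \<subseteq> {\<one>}"
      unfolding lower_central_series.simps n
      by (rule generate_subgroup_incl) (auto intro: triv_subgroup)
    then show ?thesis using subgroup.one_closed[OF lower_central_series_subgroup] by blast
  qed
  obtain m where m: "m > 0" "\<And>a. quotient_length G ?W {\<one>} (inv (y a) \<otimes> y (a + m)) < \<epsilon> * real m"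
    using all[OF \<open>\<epsilon> > 0\<close>, of n] unfolding n' by auto
  have step: "?W (inv (y a) \<otimes> y (a + m)) \<le> \<epsilon> * m" for a
    using m(2)[of a] y by (simp add: quotient_length_def)
  have "?W (inv (y 0) \<otimes> y (k * m)) \<le> \<epsilon> * real (k * m)" for k
  proof -
    have "?W (foldr (\<otimes>) (map (\<lambda>j. inv (y (0 + j * m)) \<otimes> y (0 + Suc j * m)) [0..<k]) \<one>)
        \<le> \<epsilon> * m * length (map (\<lambda>j. inv (y (0 + j * m)) \<otimes> y (0 + Suc j * m)) [0..<k])"
    proof (rule length_function_foldr[OF W])
      fix w assume "w \<in> set (map (\<lambda>j. inv (y (0 + j * m)) \<otimes> y (0 + Suc j * m)) [0..<k])"
      then obtain j where "w = inv (y (j * m)) \<otimes> y (j * m + m)" by (auto simp: add_ac)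
      with step show "?W w \<le> \<epsilon> * m" by simp
    qed (use y in auto)
    then show ?thesis unfolding foldr_telescope[of y 0 m k, OF y] by (simp add: mult_ac)
  qed
  with m show ?thesis by blast
qed

end

section \<open>Real vector spaces as module records\<close>

text \<open>The vector space axioms for a module record whose scalars are the type of real numbers
  rather than a ring record; \<open>linear_between\<close> and \<open>is_norm\<close> are phrased in
  the same operations.\<close>

locale real_space = abelian_group V for V :: "(real, 'v) module" (structure) +
  assumes smult_closed [simp, intro]: "x \<in> carrier V \<Longrightarrow> r \<odot> x \<in> carrier V"
    and smult_add_left: "x \<in> carrier V \<Longrightarrow> (r + s) \<odot> x = r \<odot> x \<oplus> s \<odot> x"
    and smult_add_right: "x \<in> carrier V \<Longrightarrow> y \<in> carrier V \<Longrightarrow> r \<odot> (x \<oplus> y) = r \<odot> x \<oplus> r \<odot> y"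
    and smult_smult: "x \<in> carrier V \<Longrightarrow> r \<odot> (s \<odot> x) = (r * s) \<odot> x"
    and smult_one [simp]: "x \<in> carrier V \<Longrightarrow> 1 \<odot> x = x"
begin

lemma smult_zero_left [simp]:
  assumes "x \<in> carrier V" shows "0 \<odot> x = \<zero>"
proof -
  have "0 \<odot> x \<oplus> 0 \<odot> x = 0 \<odot> x" using smult_add_left[OF assms, of 0 0] by simp
  then show ?thesis using assms by (metis add.l_cancel_one' smult_closed)
qed

lemma smult_zero_right [simp]: "r \<odot> \<zero> = \<zero>"
proof -
  have "r \<odot> \<zero> = r \<odot> (0 \<odot> \<zero>)" by simp
  also have "\<dots> = \<zero>" by (subst smult_smult) auto
  finally show ?thesis .
qed

lemma smult_minus_one:
  assumes x: "x \<in> carrier V" shows "(-1) \<odot> x = \<ominus> x"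
proof -
  have "(-1) \<odot> x \<oplus> x = (-1 + 1) \<odot> x" using smult_add_left[OF x, of "-1" 1] x by simp
  also have "\<dots> = \<zero>" using x by simp
  finally show ?thesis using x by (metis minus_equality smult_closed)
qed

end

definition linear_functional :: "(real, 'v) module \<Rightarrow> ('v \<Rightarrow> real) \<Rightarrow> bool" where
  "linear_functional V \<theta> \<longleftrightarrow>
    (\<forall>x\<in>carrier V. \<forall>y\<in>carrier V. \<theta> (x \<oplus>\<^bsub>V\<^esub> y) = \<theta> x + \<theta> y) \<and>
    (\<forall>r. \<forall>x\<in>carrier V. \<theta> (r \<odot>\<^bsub>V\<^esub> x) = r * \<theta> x)"

lemma linear_functionalD:
  assumes "linear_functional V \<theta>"
  shows "x \<in> carrier V \<Longrightarrow> y \<in> carrier V \<Longrightarrow> \<theta> (x \<oplus>\<^bsub>V\<^esub> y) = \<theta> x + \<theta> y"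
    "x \<in> carrier V \<Longrightarrow> \<theta> (r \<odot>\<^bsub>V\<^esub> x) = r * \<theta> x"
  using assms unfolding linear_functional_def by auto

lemma linear_betweenD:
  assumes "linear_between V W L"
  shows "x \<in> carrier V \<Longrightarrow> L x \<in> carrier W"
    "x \<in> carrier V \<Longrightarrow> y \<in> carrier V \<Longrightarrow> L (x \<oplus>\<^bsub>V\<^esub> y) = L x \<oplus>\<^bsub>W\<^esub> L y"
    "x \<in> carrier V \<Longrightarrow> L (r \<odot>\<^bsub>V\<^esub> x) = r \<odot>\<^bsub>W\<^esub> L x"
  using assms unfolding linear_between_def by auto

lemma is_normD:
  assumes "is_norm V \<nu>"
  shows "x \<in> carrier V \<Longrightarrow> 0 \<le> \<nu> x" "x \<in> carrier V \<Longrightarrow> \<nu> x = 0 \<longleftrightarrow> x = \<zero>\<^bsub>V\<^esub>"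
    "x \<in> carrier V \<Longrightarrow> \<nu> (r \<odot>\<^bsub>V\<^esub> x) = \<bar>r\<bar> * \<nu> x"
    "x \<in> carrier V \<Longrightarrow> y \<in> carrier V \<Longrightarrow> \<nu> (x \<oplus>\<^bsub>V\<^esub> y) \<le> \<nu> x + \<nu> y"
  using assms unfolding is_norm_def by auto

context real_space
begin

lemma linear_functional_zero:
  assumes "linear_functional V \<theta>" shows "\<theta> \<zero> = 0"
  using linear_functionalD(2)[OF assms zero_closed, of 0] by simp

lemma linear_functional_minus:
  assumes "linear_functional V \<theta>" "x \<in> carrier V" shows "\<theta> (\<ominus> x) = - \<theta> x"
  using linear_functionalD(2)[OF assms, of "-1"] assms smult_minus_one by simp

lemma linear_functional_diff:
  assumes "linear_functional V \<theta>" "x \<in> carrier V" "y \<in> carrier V" shows "\<theta> (x \<ominus> y) = \<theta> x - \<theta> y"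
  using assms by (simp add: minus_eq linear_functionalD linear_functional_minus)

lemma linear_functional_finsum:
  assumes \<theta>: "linear_functional V \<theta>" and "finite J" "f \<in> J \<rightarrow> carrier V"
  shows "\<theta> (finsum V f J) = (\<Sum>j\<in>J. \<theta> (f j))"
  using assms(2,3)
  by (induction J rule: finite_induct)
    (auto simp: linear_functional_zero[OF \<theta>] linear_functionalD(1)[OF \<theta>] Pi_def)

lemma norm_minus:
  assumes \<nu>: "is_norm V \<nu>" and x: "x \<in> carrier V" shows "\<nu> (\<ominus> x) = \<nu> x"
  using is_normD(3)[OF \<nu> x, of "-1"] smult_minus_one[OF x] by simp

lemma norm_diff_le:
  assumes \<nu>: "is_norm V \<nu>" and "x \<in> carrier V" "y \<in> carrier V" shows "\<nu> (x \<ominus> y) \<le> \<nu> x + \<nu> y"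
  using assms is_normD(4)[OF \<nu>, of x "\<ominus> y"] by (simp add: minus_eq norm_minus[OF \<nu>])

lemma norm_triangle_sub:
  assumes \<nu>: "is_norm V \<nu>" and x: "x \<in> carrier V" and y: "y \<in> carrier V" shows "\<nu> x \<le> \<nu> (x \<ominus> y) + \<nu> y"
proof -
  have "x = (x \<ominus> y) \<oplus> y" using x y by (simp add: minus_eq a_assoc l_neg)
  then show ?thesis using is_normD(4)[OF \<nu>, of "x \<ominus> y" y] x y by simp
qed

lemma norm_finsum_le:
  assumes \<nu>: "is_norm V \<nu>" and "finite J" "f \<in> J \<rightarrow> carrier V"
  shows "\<nu> (finsum V f J) \<le> (\<Sum>j\<in>J. \<nu> (f j))"
  using assms(2,3)
proof (induction J rule: finite_induct)
  case empty
  show ?case using is_normD(2)[OF \<nu>, of \<zero>] by simp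
next
  case (insert j J)
  have "\<nu> (f j \<oplus> finsum V f J) \<le> \<nu> (f j) + \<nu> (finsum V f J)"
    by (rule is_normD(4)[OF \<nu>]) (use insert.prems in auto)
  then show ?case using insert by (auto simp: Pi_def)
qed

lemma finsum_smult_distrib:
  assumes "x \<in> J \<rightarrow> carrier V"
  shows "finsum V (\<lambda>j. (c j + d j) \<odot> x j) J = finsum V (\<lambda>j. c j \<odot> x j) J \<oplus> finsum V (\<lambda>j. d j \<odot> x j) J"
proof -
  have "finsum V (\<lambda>j. (c j + d j) \<odot> x j) J = finsum V (\<lambda>j. c j \<odot> x j \<oplus> d j \<odot> x j) J"
    by (rule finsum_cong') (use assms in \<open>auto simp: smult_add_left Pi_def\<close>)
  also have "\<dots> = finsum V (\<lambda>j. c j \<odot> x j) J \<oplus> finsum V (\<lambda>j. d j \<odot> x j) J"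
    by (rule finsum_addf) (use assms in \<open>auto simp: Pi_def\<close>)
  finally show ?thesis .
qed

lemma smult_finsum:
  assumes "finite J" "x \<in> J \<rightarrow> carrier V"
  shows "r \<odot> finsum V x J = finsum V (\<lambda>j. r \<odot> x j) J"
  using assms
proof (induction J rule: finite_induct)
  case empty
  show ?case by simp
next
  case (insert j J)
  then show ?case by (auto simp: Pi_def smult_add_right)
qed

lemma finsum_smult_scale:
  assumes "finite J" "x \<in> J \<rightarrow> carrier V"
  shows "finsum V (\<lambda>j. (r * c j) \<odot> x j) J = r \<odot> finsum V (\<lambda>j. c j \<odot> x j) J"
proof -
  have "r \<odot> finsum V (\<lambda>j. c j \<odot> x j) J = finsum V (\<lambda>j. r \<odot> (c j \<odot> x j)) J"
    by (rule smult_finsum) (use assms in \<open>auto simp: Pi_def\<close>)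
  also have "\<dots> = finsum V (\<lambda>j. (r * c j) \<odot> x j) J"
    by (rule finsum_cong') (use assms in \<open>auto simp: Pi_def smult_smult\<close>)
  finally show ?thesis by simp
qed

lemma diff_eq_zeroD:
  assumes "x \<ominus> y = \<zero>" "x \<in> carrier V" "y \<in> carrier V"
  shows "x = y"
proof -
  have "x = (x \<ominus> y) \<oplus> y" using assms(2,3) by (simp add: minus_eq a_assoc l_neg)
  then show ?thesis using assms by simp
qed

lemma diff_diff_eq:
  assumes "x \<in> carrier V" "y \<in> carrier V" "z \<in> carrier V"
  shows "x \<ominus> y \<ominus> z = x \<ominus> (y \<oplus> z)"
  using assms by (simp add: minus_eq minus_add a_ac)

lemma norm_diff_triangle:
  assumes \<nu>: "is_norm V \<nu>" and c: "x \<in> carrier V" "y \<in> carrier V" "z \<in> carrier V"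
  shows "\<nu> (x \<ominus> z) \<le> \<nu> (x \<ominus> y) + \<nu> (y \<ominus> z)"
proof -
  have "x \<ominus> z = (x \<ominus> y) \<oplus> (y \<ominus> z)"
    using c by (simp add: minus_eq a_assoc r_neg1)
  then show ?thesis using is_normD(4)[OF \<nu>, of "x \<ominus> y" "y \<ominus> z"] c by simp
qed

lemma norm_diff_commute:
  assumes \<nu>: "is_norm V \<nu>" and c: "x \<in> carrier V" "y \<in> carrier V"
  shows "\<nu> (x \<ominus> y) = \<nu> (y \<ominus> x)"
proof -
  have "x \<ominus> y = \<ominus> (y \<ominus> x)" using c by (simp add: minus_eq minus_add a_comm)
  then show ?thesis using norm_minus[OF \<nu>, of "y \<ominus> x"] c by simp
qed

lemma norm_add_diff_le:
  assumes \<nu>: "is_norm V \<nu>" and c: "x \<in> carrier V" "y \<in> carrier V" "x' \<in> carrier V" "y' \<in> carrier V"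
  shows "\<nu> ((x \<oplus> y) \<ominus> (x' \<oplus> y')) \<le> \<nu> (x \<ominus> x') + \<nu> (y \<ominus> y')"
proof -
  have "(x \<oplus> y) \<ominus> (x' \<oplus> y') = (x \<ominus> x') \<oplus> (y \<ominus> y')"
    using c by (simp add: minus_eq minus_add a_ac)
  then show ?thesis using is_normD(4)[OF \<nu>, of "x \<ominus> x'" "y \<ominus> y'"] c by simp
qed

end

section \<open>The real tensor product\<close>

context comm_group
begin

abbreviation tensor_class :: "(('a \<times> real) \<Rightarrow>\<^sub>0 int) \<Rightarrow> (('a \<times> real) \<Rightarrow>\<^sub>0 int) set" where
  "tensor_class c \<equiv> tensor_kernel G #>\<^bsub>tensor_free G\<^esub> c"

abbreviation tensor_scale :: "real \<Rightarrow> (('a \<times> real) \<Rightarrow>\<^sub>0 int) \<Rightarrow> (('a \<times> real) \<Rightarrow>\<^sub>0 int)" where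
  "tensor_scale r \<equiv> frag_extend (\<lambda>(a, s). frag_of (a, r * s))"

lemma carrier_tensor_free: "c \<in> carrier (tensor_free G) \<longleftrightarrow> Poly_Mapping.keys c \<subseteq> carrier G \<times> UNIV"
  by (simp add: tensor_free_def)

lemma tensor_free_simps [simp]:
  "\<one>\<^bsub>tensor_free G\<^esub> = 0" "c \<otimes>\<^bsub>tensor_free G\<^esub> d = c + d"
  "c \<in> carrier (tensor_free G) \<Longrightarrow> inv\<^bsub>tensor_free G\<^esub> c = - c"
  by (auto simp: tensor_free_def)

lemma frag_of_tensor_free [simp]: "frag_of (a, r) \<in> carrier (tensor_free G) \<longleftrightarrow> a \<in> carrier G"
  by (simp add: tensor_free_def)

lemma comm_group_tensor_free: "comm_group (tensor_free G)"
  unfolding tensor_free_def by (rule abelian_free_Abelian_group)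

lemma group_tensor_free [simp]: "group (tensor_free G)"
  by (simp add: tensor_free_def)

lemma diff_tensor_free:
  assumes "c \<in> carrier (tensor_free G)" "d \<in> carrier (tensor_free G)"
  shows "c - d \<in> carrier (tensor_free G)"
  using assms keys_diff[of c d] unfolding carrier_tensor_free by blast

lemma add_tensor_free:
  assumes "c \<in> carrier (tensor_free G)" "d \<in> carrier (tensor_free G)"
  shows "c + d \<in> carrier (tensor_free G)"
  using assms keys_add[of c d] unfolding carrier_tensor_free by blast

lemma tensor_relations_cases:
  assumes "h \<in> tensor_relations G"
  obtains (left) a b r where "a \<in> carrier G" "b \<in> carrier G"
      "h = frag_of (a \<otimes> b, r) - frag_of (a, r) - frag_of (b, r)"
    | (right) a r s where "a \<in> carrier G" "h = frag_of (a, r + s) - frag_of (a, r) - frag_of (a, s)"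
  using assms unfolding tensor_relations_def by blast

lemma tensor_relations_left:
  "a \<in> carrier G \<Longrightarrow> b \<in> carrier G
    \<Longrightarrow> frag_of (a \<otimes> b, r) - frag_of (a, r) - frag_of (b, r) \<in> tensor_relations G"
  unfolding tensor_relations_def by blast

lemma tensor_relations_right:
  "a \<in> carrier G \<Longrightarrow> frag_of (a, r + s) - frag_of (a, r) - frag_of (a, s) \<in> tensor_relations G"
  unfolding tensor_relations_def by blast

lemma tensor_relations_carrier: "tensor_relations G \<subseteq> carrier (tensor_free G)"
  unfolding tensor_relations_def by (auto intro!: diff_tensor_free)

lemma tensor_kernel_subgroup: "subgroup (tensor_kernel G) (tensor_free G)"
  unfolding tensor_kernel_def
  by (rule group.generate_is_subgroup[OF group_tensor_free tensor_relations_carrier])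

lemma tensor_kernel_normal: "tensor_kernel G \<lhd> tensor_free G"
  by (rule comm_group.normal_iff_subgroup[OF comm_group_tensor_free, THEN iffD2]) (rule tensor_kernel_subgroup)

lemma tensor_kernel_carrier: "k \<in> tensor_kernel G \<Longrightarrow> k \<in> carrier (tensor_free G)"
  by (rule subgroup.mem_carrier[OF tensor_kernel_subgroup])

lemma carrier_real_tensor: "carrier (real_tensor G) = tensor_class ` carrier (tensor_free G)"
  by (simp add: real_tensor_def carrier_FactGroup)

lemma tensor_class_carrier: "c \<in> carrier (tensor_free G) \<Longrightarrow> tensor_class c \<in> carrier (real_tensor G)"
  by (simp add: carrier_real_tensor)

lemma tensor_class_add:
  assumes "c \<in> carrier (tensor_free G)" "d \<in> carrier (tensor_free G)"
  shows "tensor_class c \<oplus>\<^bsub>real_tensor G\<^esub> tensor_class d = tensor_class (c + d)"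
  using normal.rcos_sum[OF tensor_kernel_normal assms] by (simp add: real_tensor_def)

lemma abelian_group_real_tensor: "abelian_group (real_tensor G)"
proof -
  interpret Q: comm_group "tensor_free G Mod tensor_kernel G"
    by (rule comm_group.abelian_FactGroup[OF comm_group_tensor_free tensor_kernel_subgroup])
  note Q = Q.m_closed Q.one_closed Q.m_assoc Q.m_comm Q.l_one Q.l_inv_ex
  have [simp]: "carrier (real_tensor G) = carrier (tensor_free G Mod tensor_kernel G)"
    "add (real_tensor G) = mult (tensor_free G Mod tensor_kernel G)"
    "zero (real_tensor G) = one (tensor_free G Mod tensor_kernel G)"
    by (simp_all add: real_tensor_def)
  show ?thesis
    by (rule abelian_groupI) (simp_all add: Q Q.m_lcomm del: mult_FactGroup one_FactGroup)
qed

lemma tensor_class_eqI: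
  assumes "c \<in> carrier (tensor_free G)" "d \<in> carrier (tensor_free G)" "c - d \<in> tensor_kernel G"
  shows "tensor_class c = tensor_class d"
proof -
  have "c \<in> tensor_class d" unfolding r_coset_def using assms(3) by force
  then show ?thesis
    using group.repr_independence[OF group_tensor_free _ assms(2) tensor_kernel_subgroup] by simp
qed

lemma tensor_class_zero: "\<zero>\<^bsub>real_tensor G\<^esub> = tensor_class 0"
  using group.coset_mult_one[OF group_tensor_free subgroup.subset[OF tensor_kernel_subgroup]]
  by (simp add: real_tensor_def)

lemma tensor_scale_closed:
  assumes "c \<in> carrier (tensor_free G)"
  shows "tensor_scale r c \<in> carrier (tensor_free G)"
  using assms keys_frag_extend[of "\<lambda>(a, s). frag_of (a, r * s)" c]
  unfolding carrier_tensor_free by (fastforce split: prod.splits)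

text \<open>Scaling the real entry maps each bilinearity relation to a relation of the same kind.
  This is why the scalar multiplication on cosets does not depend on the representative.\<close>

lemma tensor_scale_kernel:
  assumes "k \<in> tensor_kernel G"
  shows "tensor_scale r k \<in> tensor_kernel G"
  using assms unfolding tensor_kernel_def
proof (induction rule: generate.induct)
  case one
  have "0 \<in> generate (tensor_free G) (tensor_relations G)"
    using generate.one[of "tensor_free G"] by simp
  then show ?case by simp
next
  have rel: "tensor_scale r h \<in> generate (tensor_free G) (tensor_relations G)" if "h \<in> tensor_relations G" for h
  proof -
    have "tensor_scale r h \<in> tensor_relations G"
      using that
    proof (cases rule: tensor_relations_cases)
      case (left a b s)
      then show ?thesis using tensor_relations_left[of a b "r * s"] by (simp only: frag_extend_diff frag_extend_of prod.case)
    next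
      case (right a s t)
      then show ?thesis using tensor_relations_right[of a "r * s" "r * t"]
        by (simp only: frag_extend_diff frag_extend_of prod.case distrib_left)
    qed
    then show ?thesis by (rule generate.incl)
  qed
  case (incl h)
  then show ?case by (rule rel)
  case (inv h)
  have "tensor_scale r h \<in> tensor_kernel G" using rel[OF inv] unfolding tensor_kernel_def .
  moreover have "inv\<^bsub>tensor_free G\<^esub> h = - h" using inv tensor_relations_carrier by auto
  ultimately show ?case
    using subgroup.m_inv_closed[OF tensor_kernel_subgroup, of "tensor_scale r h"] tensor_kernel_carrier[of "tensor_scale r h"]
    unfolding tensor_kernel_def by (simp add: frag_extend_minus)
next
  case (eng h1 h2)
  then show ?case using generate.eng[of _ "tensor_free G"] by (simp add: frag_extend_add)
qed

lemma tensor_class_scale: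
  assumes c: "c \<in> carrier (tensor_free G)"
  shows "r \<odot>\<^bsub>real_tensor G\<^esub> tensor_class c = tensor_class (tensor_scale r c)"
proof -
  have "tensor_class (tensor_scale r d) = tensor_class (tensor_scale r c)" if "d \<in> tensor_class c" for d
  proof -
    from that obtain k where k: "k \<in> tensor_kernel G" "d = k + c" unfolding r_coset_def by auto
    have "tensor_scale r d - tensor_scale r c = tensor_scale r k" unfolding k(2) by (simp add: frag_extend_add)
    moreover have "d \<in> carrier (tensor_free G)"
      unfolding k(2) by (intro add_tensor_free tensor_kernel_carrier k c)
    ultimately show ?thesis
      by (intro tensor_class_eqI tensor_scale_closed c) (use tensor_scale_kernel[OF k(1)] in auto)
  qed
  moreover have "c \<in> tensor_class c"
    by (rule group.rcos_self[OF group_tensor_free c tensor_kernel_subgroup])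
  ultimately have "(\<Union>d\<in>tensor_class c. tensor_class (tensor_scale r d)) = tensor_class (tensor_scale r c)"
    by (intro UN_constant_eq) blast+
  then show ?thesis by (simp add: real_tensor_def)
qed

lemma pure_tensor_carrier [simp, intro]: "a \<in> carrier G \<Longrightarrow> pure_tensor G a r \<in> carrier (real_tensor G)"
  unfolding pure_tensor_def by (simp add: tensor_class_carrier)

lemma pure_tensor_add_right:
  assumes "a \<in> carrier G"
  shows "pure_tensor G a (r + s) = pure_tensor G a r \<oplus>\<^bsub>real_tensor G\<^esub> pure_tensor G a s"
proof -
  have "frag_of (a, r + s) - frag_of (a, r) - frag_of (a, s) \<in> tensor_kernel G"
    unfolding tensor_kernel_def tensor_relations_def using assms by (blast intro: generate.incl)
  hence "tensor_class (frag_of (a, r + s)) = tensor_class (frag_of (a, r) + frag_of (a, s))"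
    by (intro tensor_class_eqI) (use assms in \<open>auto intro: add_tensor_free simp: algebra_simps\<close>)
  then show ?thesis unfolding pure_tensor_def using assms by (simp add: tensor_class_add)
qed

lemma pure_tensor_add_left:
  assumes "a \<in> carrier G" "b \<in> carrier G"
  shows "pure_tensor G (a \<otimes> b) r = pure_tensor G a r \<oplus>\<^bsub>real_tensor G\<^esub> pure_tensor G b r"
proof -
  have "frag_of (a \<otimes> b, r) - frag_of (a, r) - frag_of (b, r) \<in> tensor_kernel G"
    unfolding tensor_kernel_def tensor_relations_def using assms by (blast intro: generate.incl)
  hence "tensor_class (frag_of (a \<otimes> b, r)) = tensor_class (frag_of (a, r) + frag_of (b, r))"
    by (intro tensor_class_eqI) (use assms in \<open>auto intro: add_tensor_free simp: algebra_simps\<close>)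
  then show ?thesis unfolding pure_tensor_def using assms by (simp add: tensor_class_add)
qed

lemma smult_pure_tensor:
  "a \<in> carrier G \<Longrightarrow> s \<odot>\<^bsub>real_tensor G\<^esub> pure_tensor G a r = pure_tensor G a (s * r)"
  unfolding pure_tensor_def by (simp add: tensor_class_scale)

text \<open>The free abelian group is built from its generators by differences alone, since these
  yield negatives and sums. The rule inherits this shape, and a proof by it has a single closure
  case.\<close>

lemma real_tensor_induct [consumes 1, case_names zero pure diff]:
  assumes "U \<in> carrier (real_tensor G)" and "P \<zero>\<^bsub>real_tensor G\<^esub>"
    and "\<And>a r. a \<in> carrier G \<Longrightarrow> P (pure_tensor G a r)"
    and diff: "\<And>x y. x \<in> carrier (real_tensor G) \<Longrightarrow> y \<in> carrier (real_tensor G) \<Longrightarrow> P x \<Longrightarrow> P y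
      \<Longrightarrow> P (x \<ominus>\<^bsub>real_tensor G\<^esub> y)"
  shows "P U"
proof -
  obtain c where c: "c \<in> carrier (tensor_free G)" "U = tensor_class c"
    using assms(1) unfolding carrier_real_tensor by auto
  interpret T: abelian_group "real_tensor G" by (rule abelian_group_real_tensor)
  have "Poly_Mapping.keys c \<subseteq> carrier G \<times> UNIV" using c carrier_tensor_free by simp
  then have "P (tensor_class c)"
  proof (rule free_Abelian_group_induct[where P = "\<lambda>c. P (tensor_class c)"])
    show "P (tensor_class 0)" using assms(2) by (simp add: tensor_class_zero)
  next
    fix x y :: "('a \<times> real) \<Rightarrow>\<^sub>0 int"
    assume "Poly_Mapping.keys x \<subseteq> carrier G \<times> UNIV" "Poly_Mapping.keys y \<subseteq> carrier G \<times> UNIV"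
      and P: "P (tensor_class x)" "P (tensor_class y)"
    then have xy: "x \<in> carrier (tensor_free G)" "y \<in> carrier (tensor_free G)"
      using carrier_tensor_free by auto
    have "tensor_class (x - y) \<oplus>\<^bsub>real_tensor G\<^esub> tensor_class y = tensor_class x"
      using xy by (simp add: tensor_class_add diff_tensor_free)
    hence "tensor_class (x - y) = tensor_class x \<ominus>\<^bsub>real_tensor G\<^esub> tensor_class y"
      using tensor_class_carrier[OF xy(1)] tensor_class_carrier[OF xy(2)] tensor_class_carrier[OF diff_tensor_free[OF xy]]
      by (metis T.add.inv_solve_right T.minus_eq)
    then show "P (tensor_class (x - y))"
      using P diff[of "tensor_class x" "tensor_class y"] tensor_class_carrier xy by simp
  next
    fix x :: "'a \<times> real" assume "x \<in> carrier G \<times> UNIV"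
    then show "P (tensor_class (frag_of x))" using assms(3) unfolding pure_tensor_def by (cases x) auto
  qed
  then show ?thesis using c by simp
qed

lemma real_space_real_tensor: "real_space (real_tensor G)"
proof -
  interpret T: abelian_group "real_tensor G" by (rule abelian_group_real_tensor)
  have closed: "r \<odot>\<^bsub>real_tensor G\<^esub> x \<in> carrier (real_tensor G)" if "x \<in> carrier (real_tensor G)" for r x
    using that unfolding carrier_real_tensor by (auto simp: tensor_class_scale tensor_scale_closed)
  have add: "r \<odot>\<^bsub>real_tensor G\<^esub> (x \<oplus>\<^bsub>real_tensor G\<^esub> y)
      = r \<odot>\<^bsub>real_tensor G\<^esub> x \<oplus>\<^bsub>real_tensor G\<^esub> r \<odot>\<^bsub>real_tensor G\<^esub> y"
    if "x \<in> carrier (real_tensor G)" "y \<in> carrier (real_tensor G)" for r x y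
    using that unfolding carrier_real_tensor
    by (auto simp: tensor_class_scale tensor_scale_closed tensor_class_add add_tensor_free frag_extend_add)
  have zero: "r \<odot>\<^bsub>real_tensor G\<^esub> \<zero>\<^bsub>real_tensor G\<^esub> = \<zero>\<^bsub>real_tensor G\<^esub>" for r
    by (simp add: tensor_class_zero tensor_class_scale carrier_tensor_free)
  \<comment> \<open>The difference case of \<open>real_tensor_induct\<close> involves negation, so
    its compatibility with scalars has to precede the vector space axioms proved by that
    induction.\<close>
  have neg: "r \<odot>\<^bsub>real_tensor G\<^esub> (\<ominus>\<^bsub>real_tensor G\<^esub> x) = \<ominus>\<^bsub>real_tensor G\<^esub> (r \<odot>\<^bsub>real_tensor G\<^esub> x)"
    if "x \<in> carrier (real_tensor G)" for r x
    using add[OF that T.a_inv_closed[OF that], of r] that closed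
    by (metis T.a_comm T.a_inv_closed T.minus_equality T.r_neg zero)
  have smult_diff: "r \<odot>\<^bsub>real_tensor G\<^esub> (x \<ominus>\<^bsub>real_tensor G\<^esub> y)
      = r \<odot>\<^bsub>real_tensor G\<^esub> x \<ominus>\<^bsub>real_tensor G\<^esub> r \<odot>\<^bsub>real_tensor G\<^esub> y"
    if "x \<in> carrier (real_tensor G)" "y \<in> carrier (real_tensor G)" for r x y
    using that by (simp add: T.minus_eq add neg)
  show ?thesis
  proof unfold_locales
    fix r s and x assume x: "x \<in> carrier (real_tensor G)"
    show "r \<odot>\<^bsub>real_tensor G\<^esub> x \<in> carrier (real_tensor G)" by (rule closed[OF x])
    show "(r + s) \<odot>\<^bsub>real_tensor G\<^esub> x = r \<odot>\<^bsub>real_tensor G\<^esub> x \<oplus>\<^bsub>real_tensor G\<^esub> s \<odot>\<^bsub>real_tensor G\<^esub> x"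
      using x
    proof (induction x rule: real_tensor_induct)
      case (diff x y)
      then show ?case using closed
        by (simp add: T.minus_eq T.minus_add T.a_ac neg add)
    qed (auto simp: zero smult_pure_tensor pure_tensor_add_right distrib_right)
    show "r \<odot>\<^bsub>real_tensor G\<^esub> (s \<odot>\<^bsub>real_tensor G\<^esub> x) = (r * s) \<odot>\<^bsub>real_tensor G\<^esub> x"
      using x
      by (induction x rule: real_tensor_induct) (auto simp: zero smult_pure_tensor smult_diff closed mult.assoc)
    show "1 \<odot>\<^bsub>real_tensor G\<^esub> x = x"
      using x
      by (induction x rule: real_tensor_induct) (auto simp: zero smult_pure_tensor smult_diff)
  next
    fix r and x y assume "x \<in> carrier (real_tensor G)" "y \<in> carrier (real_tensor G)"
    then show "r \<odot>\<^bsub>real_tensor G\<^esub> (x \<oplus>\<^bsub>real_tensor G\<^esub> y)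
      = r \<odot>\<^bsub>real_tensor G\<^esub> x \<oplus>\<^bsub>real_tensor G\<^esub> r \<odot>\<^bsub>real_tensor G\<^esub> y" by (rule add)
  qed
qed

text \<open>The additive extension of the assignment of r * \<phi> a to the generator (a, r): this
  is the expression whose image \<open>functional_of\<close> takes over a coset, isolated so that it
  can be studied on representatives.\<close>

definition tensor_eval :: "('a \<Rightarrow> real) \<Rightarrow> (('a \<times> real) \<Rightarrow>\<^sub>0 int) \<Rightarrow> real" where
  "tensor_eval \<phi> c =
    (\<Sum>(a, r)\<in>Poly_Mapping.keys c. of_int (Poly_Mapping.lookup c (a, r)) * (r * \<phi> a))"

lemma tensor_eval_superset:
  assumes "finite S" "Poly_Mapping.keys c \<subseteq> S"
  shows "tensor_eval \<phi> c = (\<Sum>(a, r)\<in>S. of_int (Poly_Mapping.lookup c (a, r)) * (r * \<phi> a))"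
  unfolding tensor_eval_def
  by (rule sum.mono_neutral_left) (use assms in \<open>auto simp: in_keys_iff\<close>)

lemma tensor_eval_add: "tensor_eval \<phi> (c + d) = tensor_eval \<phi> c + tensor_eval \<phi> d"
proof -
  let ?S = "Poly_Mapping.keys c \<union> Poly_Mapping.keys d"
  have S: "finite ?S" "Poly_Mapping.keys (c + d) \<subseteq> ?S" "Poly_Mapping.keys c \<subseteq> ?S" "Poly_Mapping.keys d \<subseteq> ?S"
    using keys_add[of c d] by auto
  show ?thesis
    unfolding tensor_eval_superset[OF S(1,2)] tensor_eval_superset[OF S(1,3)] tensor_eval_superset[OF S(1,4)]
    by (simp add: sum.distrib[symmetric] lookup_add split_def distrib_right)
qed

lemma tensor_eval_zero: "tensor_eval \<phi> 0 = 0"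
  by (simp add: tensor_eval_def)

lemma tensor_eval_minus: "tensor_eval \<phi> (- c) = - tensor_eval \<phi> c"
  using tensor_eval_add[of \<phi> c "- c"] by (simp add: tensor_eval_zero)

lemma tensor_eval_diff: "tensor_eval \<phi> (c - d) = tensor_eval \<phi> c - tensor_eval \<phi> d"
  using tensor_eval_add[of \<phi> c "- d"] by (simp add: tensor_eval_minus)

lemma tensor_eval_frag_of: "tensor_eval \<phi> (frag_of (a, r)) = r * \<phi> a"
  by (simp add: tensor_eval_def keys_frag_of)

text \<open>Additivity of \<phi> handles the relations in the group entry, distributivity those in
  the real entry. This makes \<open>functional_of\<close> independent of the representative.\<close>

lemma tensor_eval_kernel:
  assumes \<phi>: "\<phi> \<in> real_hom G" and "k \<in> tensor_kernel G"
  shows "tensor_eval \<phi> k = 0"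
  using assms(2) unfolding tensor_kernel_def
proof (induction rule: generate.induct)
  case one
  show ?case by (simp add: tensor_eval_zero)
next
  have rel: "tensor_eval \<phi> h = 0" if "h \<in> tensor_relations G" for h
    using that
  proof (cases rule: tensor_relations_cases)
    case (left a b r)
    then have "\<phi> (a \<otimes> b) = \<phi> a + \<phi> b" using \<phi> unfolding real_hom_def by blast
    then show ?thesis unfolding left(3) by (simp add: tensor_eval_diff tensor_eval_frag_of distrib_left)
  next
    case (right a r s)
    then show ?thesis by (simp add: tensor_eval_diff tensor_eval_frag_of distrib_right)
  qed
  case (incl h)
  then show ?case by (rule rel)
  case (inv h)
  then have "inv\<^bsub>tensor_free G\<^esub> h = - h" using tensor_relations_carrier by auto
  then show ?case using rel[OF inv] by (simp add: tensor_eval_minus)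
next
  case (eng h1 h2)
  then show ?case by (simp add: tensor_eval_add)
qed

lemma functional_of_class:
  assumes \<phi>: "\<phi> \<in> real_hom G" and c: "c \<in> carrier (tensor_free G)"
  shows "functional_of \<phi> (tensor_class c) = tensor_eval \<phi> c"
proof -
  have "tensor_eval \<phi> d = tensor_eval \<phi> c" if "d \<in> tensor_class c" for d
    using that tensor_eval_kernel[OF \<phi>] unfolding r_coset_def by (auto simp: tensor_eval_add)
  moreover have "c \<in> tensor_class c"
    by (rule group.rcos_self[OF group_tensor_free c tensor_kernel_subgroup])
  ultimately have "the_elem (tensor_eval \<phi> ` tensor_class c) = tensor_eval \<phi> c"
    by (intro the_elem_image_unique) blast+
  then show ?thesis unfolding functional_of_def tensor_eval_def .
qed

lemma functional_of_pure:
  assumes "\<phi> \<in> real_hom G" "a \<in> carrier G"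
  shows "functional_of \<phi> (pure_tensor G a r) = r * \<phi> a"
  unfolding pure_tensor_def using assms by (simp add: functional_of_class tensor_eval_frag_of)

lemma linear_functional_of:
  assumes \<phi>: "\<phi> \<in> real_hom G"
  shows "linear_functional (real_tensor G) (functional_of \<phi>)"
proof -
  have add: "functional_of \<phi> (x \<oplus>\<^bsub>real_tensor G\<^esub> y) = functional_of \<phi> x + functional_of \<phi> y"
    if "x \<in> carrier (real_tensor G)" "y \<in> carrier (real_tensor G)" for x y
    using that unfolding carrier_real_tensor
    by (auto simp: tensor_class_add functional_of_class[OF \<phi>] add_tensor_free tensor_eval_add)
  interpret T: real_space "real_tensor G" by (rule real_space_real_tensor)
  have fun_diff: "functional_of \<phi> (x \<ominus>\<^bsub>real_tensor G\<^esub> y) = functional_of \<phi> x - functional_of \<phi> y"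
    if "x \<in> carrier (real_tensor G)" "y \<in> carrier (real_tensor G)" for x y
  proof -
    have "x = (x \<ominus>\<^bsub>real_tensor G\<^esub> y) \<oplus>\<^bsub>real_tensor G\<^esub> y"
      using that by (simp add: T.minus_eq T.a_assoc T.l_neg)
    then have "functional_of \<phi> x = functional_of \<phi> (x \<ominus>\<^bsub>real_tensor G\<^esub> y) + functional_of \<phi> y"
      using add[of "x \<ominus>\<^bsub>real_tensor G\<^esub> y" y] that by simp
    then show ?thesis by simp
  qed
  have fun_zero: "functional_of \<phi> \<zero>\<^bsub>real_tensor G\<^esub> = 0"
    by (simp add: tensor_class_zero functional_of_class[OF \<phi>] carrier_tensor_free tensor_eval_zero)
  have smult_diff: "r \<odot>\<^bsub>real_tensor G\<^esub> (x \<ominus>\<^bsub>real_tensor G\<^esub> y)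
      = r \<odot>\<^bsub>real_tensor G\<^esub> x \<ominus>\<^bsub>real_tensor G\<^esub> r \<odot>\<^bsub>real_tensor G\<^esub> y"
    if "x \<in> carrier (real_tensor G)" "y \<in> carrier (real_tensor G)" for r x y
    using that by (simp add: T.minus_eq T.smult_add_right T.smult_smult flip: T.smult_minus_one)
  have "functional_of \<phi> (r \<odot>\<^bsub>real_tensor G\<^esub> x) = r * functional_of \<phi> x"
    if "x \<in> carrier (real_tensor G)" for r x
    using that
  proof (induction x rule: real_tensor_induct)
    case zero
    show ?case by (simp add: fun_zero)
  next
    case (diff x y)
    then show ?case by (simp add: smult_diff fun_diff right_diff_distrib)
  qed (simp add: smult_pure_tensor functional_of_pure[OF \<phi>])
  then show ?thesis using add unfolding linear_functional_def by blast
qed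

end

section \<open>Coordinates on finitely generated abelian groups\<close>

context comm_group
begin

definition int_comb :: "'a set \<Rightarrow> ('a \<Rightarrow> int) \<Rightarrow> 'a" where
  "int_comb J n = finprod G (\<lambda>j. j [^] n j) J"

definition int_independent :: "'a set \<Rightarrow> bool" where
  "int_independent J \<longleftrightarrow> (\<forall>n. int_comb J n = \<one> \<longrightarrow> (\<forall>j\<in>J. n j = 0))"

lemma int_comb_closed [simp, intro]: "J \<subseteq> carrier G \<Longrightarrow> int_comb J n \<in> carrier G"
  unfolding int_comb_def by (rule finprod_closed) auto

lemma int_comb_add:
  assumes "J \<subseteq> carrier G"
  shows "int_comb J (\<lambda>j. m j + n j) = int_comb J m \<otimes> int_comb J n"
proof -
  have "int_comb J (\<lambda>j. m j + n j) = finprod G (\<lambda>j. j [^] m j \<otimes> j [^] n j) J"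
    unfolding int_comb_def by (rule finprod_cong') (use assms in \<open>auto simp: int_pow_mult\<close>)
  also have "\<dots> = int_comb J m \<otimes> int_comb J n"
    unfolding int_comb_def by (rule finprod_multf) (use assms in auto)
  finally show ?thesis .
qed

lemma int_comb_insert:
  assumes "finite J" "J \<subseteq> carrier G" "t \<in> carrier G" "t \<notin> J"
  shows "int_comb (insert t J) n = t [^] n t \<otimes> int_comb J n"
  unfolding int_comb_def by (rule finprod_insert) (use assms in auto)

lemma int_comb_cong:
  assumes "J \<subseteq> carrier G" "\<And>j. j \<in> J \<Longrightarrow> m j = n j"
  shows "int_comb J m = int_comb J n"
  unfolding int_comb_def by (rule finprod_cong') (use assms in auto)

lemma int_comb_pow:
  assumes "finite J" "J \<subseteq> carrier G"
  shows "int_comb J n [^] (k::int) = int_comb J (\<lambda>j. k * n j)"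
  using assms
proof (induction J rule: finite_induct)
  case empty
  show ?case by (simp add: int_comb_def)
next
  case (insert t J)
  then show ?case by (simp add: int_comb_insert int_pow_distrib int_pow_pow mult.commute)
qed

lemma int_comb_single:
  assumes "finite J" "J \<subseteq> carrier G" "t \<in> J"
  shows "int_comb J (\<lambda>j. if j = t then k else 0) = t [^] k"
proof -
  have "J = insert t (J - {t})" using assms by auto
  hence "int_comb J (\<lambda>j. if j = t then k else 0) = int_comb (insert t (J - {t})) (\<lambda>j. if j = t then k else 0)"
    by simp
  also have "\<dots> = t [^] k \<otimes> int_comb (J - {t}) (\<lambda>j. if j = t then k else 0)"
    by (subst int_comb_insert) (use assms in auto)
  also have "int_comb (J - {t}) (\<lambda>j. if j = t then k else 0) = \<one>"
    unfolding int_comb_def by (rule finprod_one_eqI) auto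
  finally show ?thesis using assms by (simp add: subset_iff)
qed

lemma real_hom_mult:
  "\<phi> \<in> real_hom G \<Longrightarrow> a \<in> carrier G \<Longrightarrow> b \<in> carrier G \<Longrightarrow> \<phi> (a \<otimes> b) = \<phi> a + \<phi> b"
  unfolding real_hom_def by blast

lemma real_hom_one: "\<phi> \<in> real_hom G \<Longrightarrow> \<phi> \<one> = 0"
  using real_hom_mult[of \<phi> \<one> \<one>] by simp

lemma real_hom_inv: "\<phi> \<in> real_hom G \<Longrightarrow> a \<in> carrier G \<Longrightarrow> \<phi> (inv a) = - \<phi> a"
  using real_hom_mult[of \<phi> a "inv a"] real_hom_one[of \<phi>] by simp

lemma real_hom_nat_pow: "\<phi> \<in> real_hom G \<Longrightarrow> a \<in> carrier G \<Longrightarrow> \<phi> (a [^] (n::nat)) = n * \<phi> a"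
  by (induction n) (auto simp: real_hom_one real_hom_mult algebra_simps)

lemma real_hom_int_pow:
  assumes "\<phi> \<in> real_hom G" "a \<in> carrier G" shows "\<phi> (a [^] (n::int)) = n * \<phi> a"
proof (cases n)
  case (nonneg m)
  then show ?thesis using assms by (simp add: int_pow_int real_hom_nat_pow)
next
  case (neg m)
  have "a [^] n = inv (a [^] Suc m)" unfolding neg using assms(2) by (rule int_pow_neg_int)
  then have "\<phi> (a [^] n) = - (real (Suc m) * \<phi> a)"
    using assms real_hom_nat_pow[OF assms, of "Suc m"] by (simp add: real_hom_inv del: nat_pow_Suc)
  also have "real (Suc m) = - real_of_int n" using neg by simp
  finally show ?thesis by simp
qed

lemma real_hom_int_comb:
  assumes \<phi>: "\<phi> \<in> real_hom G" and "finite J" "J \<subseteq> carrier G"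
  shows "\<phi> (int_comb J n) = (\<Sum>j\<in>J. n j * \<phi> j)"
  using assms(2,3)
proof (induction J rule: finite_induct)
  case empty
  show ?case by (simp add: int_comb_def real_hom_one[OF \<phi>])
next
  case (insert t J)
  then show ?case by (simp add: int_comb_insert real_hom_mult[OF \<phi>] real_hom_int_pow[OF \<phi>])
qed

lemma generate_subset_int_comb:
  assumes T: "finite T" "T \<subseteq> carrier G" and a: "a \<in> generate G T"
  shows "\<exists>m. a = int_comb T m"
  using a
proof (induction rule: generate.induct)
  case one
  show ?case using int_comb_pow[OF T, of _ 0] by (metis int_pow_0)
next
  case (incl h)
  then show ?case using int_comb_single[OF T incl, of 1] T by (metis int_pow_1 subsetD)
next
  case (inv h)
  then show ?case using int_comb_single[OF T inv, of "-1"] T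
    by (metis int_pow_1 int_pow_neg subsetD)
next
  case (eng h1 h2)
  then show ?case using int_comb_add[OF T(2)] by metis
qed

text \<open>A maximal independent part of T need not generate, because of torsion and divisibility.
  What survives is that a positive power of each element of T lies in its span, and the finitely
  many exponents multiply to a common d. This takes the place of splitting off the torsion
  subgroup.\<close>

lemma maximal_int_independent:
  assumes "finite T" "T \<subseteq> carrier G"
  shows "\<exists>J\<subseteq>T. int_independent J \<and> (\<exists>d::int>0. \<forall>t\<in>T. \<exists>n. t [^] d = int_comb J n)"
  using assms
proof (induction T rule: finite_induct)
  case empty
  show ?case by (auto simp: int_independent_def intro!: exI[of _ 1])
next
  case (insert t T)
  then obtain J d where J: "J \<subseteq> T" "int_independent J" "d > 0" "\<And>t. t \<in> T \<Longrightarrow> \<exists>n. t [^] (d::int) = int_comb J n"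
    by auto
  have Jc: "finite J" "J \<subseteq> carrier G" "t \<in> carrier G" "t \<notin> J" "T \<subseteq> carrier G"
    using J insert by (auto intro: finite_subset)
  show ?case
  proof (cases "\<exists>e::int>0. \<exists>n. t [^] e = int_comb J n")
    case True
    then obtain e n where e: "(e::int) > 0" "t [^] e = int_comb J n" by auto
    have "\<exists>n. s [^] (d * e) = int_comb J n" if s: "s \<in> insert t T" for s
    proof (cases "s = t")
      case True
      have "s [^] (d * e) = (t [^] e) [^] d" using True Jc by (simp add: int_pow_pow mult.commute)
      then show ?thesis using e int_comb_pow[OF Jc(1,2)] by metis
    next
      case False
      then obtain m where "s [^] d = int_comb J m" using s J(4) by auto
      moreover have "s [^] (d * e) = (s [^] d) [^] e" using s Jc by (auto simp: int_pow_pow)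
      ultimately show ?thesis using int_comb_pow[OF Jc(1,2)] by metis
    qed
    moreover have "d * e > 0" using e J by simp
    ultimately show ?thesis using J by blast
  next
    case False
    have "int_independent (insert t J)" unfolding int_independent_def
    proof (intro allI impI)
      fix n assume "int_comb (insert t J) n = \<one>"
      hence n: "t [^] n t \<otimes> int_comb J n = \<one>" using int_comb_insert Jc by simp
      have "n t = 0"
      proof (rule ccontr)
        assume "n t \<noteq> 0"
        have eq: "t [^] n t = inv (int_comb J n)" using n Jc by (simp add: inv_equality[symmetric] inv_solve_right')
        show False
        \<comment> \<open>The assumption excludes only positive powers of t from the span of J, so
          the sign of the exponent decides whether the relation has to be inverted.\<close>
        proof (cases "n t > 0")
          case True
          have "inv (int_comb J n) = int_comb J n [^] (-1 :: int)" using Jc by (simp add: int_pow_neg)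
          hence "t [^] n t = int_comb J (\<lambda>j. -1 * n j)"
            unfolding eq int_comb_pow[OF Jc(1,2)] .
          with True False show False by blast
        next
          case False
          have "t [^] (- n t) = int_comb J n" using eq Jc by (simp add: int_pow_neg)
          moreover have "- n t > 0" using False \<open>n t \<noteq> 0\<close> by simp
          ultimately show False using \<open>\<not> (\<exists>e>0. \<exists>n. t [^] e = int_comb J n)\<close> by blast
        qed
      qed
      with n have "int_comb J n = \<one>" using Jc by simp
      with J(2) \<open>n t = 0\<close> show "\<forall>j\<in>insert t J. n j = 0" unfolding int_independent_def by auto
    qed
    moreover have "\<exists>n. s [^] d = int_comb (insert t J) n" if s: "s \<in> insert t T" for s
    proof (cases "s = t")
      case True
      then show ?thesis using int_comb_single[of "insert t J" t d] Jc by (metis finite.insertI insertI1 insert_subset)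
    next
      case False
      then obtain m where m: "s [^] d = int_comb J m" using s J(4) by auto
      have "int_comb (insert t J) (m(t := 0)) = int_comb J (m(t := 0))"
        using Jc by (simp add: int_comb_insert)
      also have "\<dots> = int_comb J m" by (rule int_comb_cong) (use Jc in auto)
      finally show ?thesis using m by metis
    qed
    ultimately show ?thesis using J by (intro exI[of _ "insert t J"]) auto
  qed
qed

lemma length_function_int_comb:
  assumes L: "length_function G L" and "finite J" "J \<subseteq> carrier G"
  shows "L (int_comb J n) \<le> (\<Sum>j\<in>J. \<bar>n j\<bar> * L j)"
  using assms(2,3)
proof (induction J rule: finite_induct)
  case empty
  show ?case using length_functionD[OF L] by (simp add: int_comb_def)
next
  case (insert t J)
  have pow: "L (t [^] (k::int)) \<le> \<bar>k\<bar> * L t" for k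
  proof (cases k)
    case (nonneg m)
    then show ?thesis using length_function_pow[OF L, of t m] insert by (simp add: int_pow_int)
  next
    case (neg m)
    have "t [^] k = inv (t [^] Suc m)" unfolding neg by (rule int_pow_neg_int) (use insert in auto)
    then have "L (t [^] k) = L (t [^] Suc m)"
      using length_functionD(3)[OF L, of "t [^] Suc m"] insert by (simp del: nat_pow_Suc)
    also have "\<dots> \<le> Suc m * L t" by (rule length_function_pow[OF L]) (use insert in auto)
    also have "real (Suc m) = \<bar>k\<bar>" using neg by simp
    finally show ?thesis by simp
  qed
  have "L (t [^] n t \<otimes> int_comb J n) \<le> L (t [^] n t) + L (int_comb J n)"
    by (rule length_functionD[OF L]) (use insert in auto)
  with pow[of "n t"] insert show ?case by (simp add: int_comb_insert)
qed

text \<open>The coordinate \<psi> j a is the exponent of j in a^d divided by d; independence of J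
  makes it well defined and additive, and torsion elements get coordinate 0. The last clause says
  that the coordinates bound every length function linearly, with a constant for the part that they
  do not see.\<close>

theorem real_coordinates:
  assumes T: "finite T" "T \<subseteq> carrier G" "generate G T = carrier G"
  obtains J \<psi> d where "finite J" "J \<subseteq> carrier G"
    "\<And>j. j \<in> J \<Longrightarrow> \<psi> j \<in> real_hom G"
    "\<And>i j. i \<in> J \<Longrightarrow> j \<in> J \<Longrightarrow> \<psi> j i = of_bool (i = j)"
    "(d::int) > 0" "\<And>a. a \<in> carrier G \<Longrightarrow> \<exists>n. a [^] d = int_comb J n \<and> (\<forall>j\<in>J. of_int (n j) = d * \<psi> j a)"
    "\<And>L. length_function G L \<Longrightarrow> \<exists>C. \<forall>a\<in>carrier G. L a \<le> C * (1 + (\<Sum>j\<in>J. \<bar>\<psi> j a\<bar>))"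
proof -
  obtain J d where J: "J \<subseteq> T" "int_independent J" "(d::int) > 0" "\<And>t. t \<in> T \<Longrightarrow> \<exists>n. t [^] d = int_comb J n"
    using maximal_int_independent[OF T(1,2)] by auto
  have Jc: "finite J" "J \<subseteq> carrier G" using J T finite_subset by auto
  have ex: "\<exists>n. a [^] d = int_comb J n" if "a \<in> carrier G" for a
  proof -
    from that have "a \<in> generate G T" using T by simp
    then show ?thesis
    proof (induction rule: generate.induct)
      case one
      show ?case using int_comb_pow[OF Jc, of _ 0] by (metis int_pow_0 int_pow_one)
    next
      case (incl h)
      then show ?case by (rule J)
    next
      case (inv h)
      then obtain n where "h [^] d = int_comb J n" using J by blast
      then have "inv h [^] d = int_comb J n [^] (-1 :: int)"
        using inv T Jc by (auto simp: int_pow_inv int_pow_neg subset_iff)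
      then show ?case using int_comb_pow[OF Jc] by metis
    next
      case (eng h1 h2)
      then obtain m n where "h1 [^] d = int_comb J m" "h2 [^] d = int_comb J n" by auto
      then have "(h1 \<otimes> h2) [^] d = int_comb J (\<lambda>j. m j + n j)"
        using eng T by (simp add: int_pow_distrib int_comb_add[OF Jc(2)])
      then show ?case by blast
    qed
  qed
  define n where "n a = (SOME n. a [^] d = int_comb J n)" for a
  have n: "a [^] d = int_comb J (n a)" if "a \<in> carrier G" for a
    unfolding n_def by (rule someI_ex[OF ex[OF that]])
  have unique: "m j = m' j" if "int_comb J m = int_comb J m'" "j \<in> J" for m m' j
  proof -
    have "int_comb J (\<lambda>j. m j + (-1) * m' j) = int_comb J m \<otimes> int_comb J m' [^] (-1 :: int)"
      unfolding int_comb_add[OF Jc(2)] int_comb_pow[OF Jc] ..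
    also have "\<dots> = \<one>" using that(1) Jc by (simp add: int_pow_neg)
    finally show ?thesis using J(2) that(2) unfolding int_independent_def by fastforce
  qed
  define \<psi> where "\<psi> j a = of_int (n a j) / (of_int d :: real)" for j a
  have hom: "\<psi> j \<in> real_hom G" if j: "j \<in> J" for j
    unfolding real_hom_def
  proof (intro CollectI ballI)
    fix a b assume ab: "a \<in> carrier G" "b \<in> carrier G"
    have "int_comb J (n (a \<otimes> b)) = int_comb J (\<lambda>j. n a j + n b j)"
      using ab n[of a] n[of b] n[of "a \<otimes> b"] by (simp add: int_pow_distrib int_comb_add[OF Jc(2)])
    from unique[OF this j] show "\<psi> j (a \<otimes> b) = \<psi> j a + \<psi> j b"
      unfolding \<psi>_def by (simp add: add_divide_distrib)
  qed
  have dual: "\<psi> j i = of_bool (i = j)" if ij: "i \<in> J" "j \<in> J" for i j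
  proof -
    have "int_comb J (n i) = int_comb J (\<lambda>j. if j = i then d else 0)"
      using n[of i] int_comb_single[OF Jc ij(1), of d] ij Jc by auto
    from unique[OF this ij(2)] show ?thesis unfolding \<psi>_def using J(3) by auto
  qed
  have len: "\<exists>C. \<forall>a\<in>carrier G. L a \<le> C * (1 + (\<Sum>j\<in>J. \<bar>\<psi> j a\<bar>))" if L: "length_function G L" for L
  proof -
    have L0: "L t \<ge> 0" if "t \<in> carrier G" for t using length_functionD(2)[OF L that] .
    \<comment> \<open>K collects the cost of the remainder r below: its own length, and the shift of
      the coefficients along J by the coordinates of r.\<close>
    define K where "K = (\<Sum>t\<in>T. d * L t) + (\<Sum>j\<in>J. (\<Sum>t\<in>T. d * \<bar>\<psi> j t\<bar>) * L j)"
    define C where "C = K + (\<Sum>j\<in>J. L j)"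
    have K0: "K \<ge> 0" unfolding K_def
      using J(3) L0 T(2) Jc(2) by (intro add_nonneg_nonneg sum_nonneg mult_nonneg_nonneg) auto
    have sumL0: "(\<Sum>j\<in>J. L j) \<ge> 0" using L0 Jc(2) by (intro sum_nonneg) auto
    have "L a \<le> C * (1 + (\<Sum>j\<in>J. \<bar>\<psi> j a\<bar>))" if a: "a \<in> carrier G" for a
    proof -
      obtain m where m: "a = int_comb T m" using generate_subset_int_comb[OF T(1,2)] T(3) a by auto
      \<comment> \<open>The exponents of a are divided by d. The quotient part b^d is an integer
        combination of J, and the remainder r has exponents between 0 and d, so its length and its
        coordinates are bounded independently of a.\<close>
      define r where "r = int_comb T (\<lambda>t. m t mod d)"
      define b where "b = int_comb T (\<lambda>t. m t div d)"
      have rc: "r \<in> carrier G" "b \<in> carrier G" unfolding r_def b_def using T by auto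
      have "a = int_comb T (\<lambda>t. d * (m t div d) + m t mod d)" unfolding m by simp
      also have "\<dots> = b [^] d \<otimes> r" unfolding int_comb_add[OF T(2)] r_def b_def int_comb_pow[OF T(1,2)] ..
      also have "b [^] d = int_comb J (n b)" by (rule n) (rule rc)
      finally have a_eq: "a = int_comb J (n b) \<otimes> r" .
      have mod: "\<bar>real_of_int (m t mod d)\<bar> \<le> d" for t using J(3) by (simp add: less_imp_le)
      have nb: "\<bar>real_of_int (n b j)\<bar> \<le> \<bar>\<psi> j a\<bar> + (\<Sum>t\<in>T. d * \<bar>\<psi> j t\<bar>)" if j: "j \<in> J" for j
      proof -
        have "\<psi> j (int_comb J (n b)) = (\<Sum>i\<in>J. n b i * \<psi> j i)"
          by (rule real_hom_int_comb[OF hom[OF j] Jc])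
        also have "\<dots> = (\<Sum>i\<in>J. if i = j then real_of_int (n b j) else 0)"
          by (rule sum.cong) (use dual j in auto)
        also have "\<dots> = n b j" using Jc j by simp
        finally have "\<psi> j a = n b j + \<psi> j r"
          unfolding a_eq using real_hom_mult[OF hom[OF j], of "int_comb J (n b)" r] Jc rc by auto
        moreover have "\<psi> j r = (\<Sum>t\<in>T. (m t mod d) * \<psi> j t)"
          unfolding r_def by (rule real_hom_int_comb[OF hom[OF j] T(1,2)])
        moreover have "\<bar>\<Sum>t\<in>T. real_of_int (m t mod d) * \<psi> j t\<bar> \<le> (\<Sum>t\<in>T. d * \<bar>\<psi> j t\<bar>)"
          by (rule order_trans[OF sum_abs], rule sum_mono, unfold abs_mult, rule mult_right_mono[OF mod]) simp
        ultimately show ?thesis by linarith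
      qed
      have "L r \<le> (\<Sum>t\<in>T. \<bar>m t mod d\<bar> * L t)" unfolding r_def by (rule length_function_int_comb[OF L T(1,2)])
      also have "\<dots> \<le> (\<Sum>t\<in>T. d * L t)"
        using L0 T(2) mod by (intro sum_mono mult_right_mono) auto
      finally have Lr: "L r \<le> (\<Sum>t\<in>T. d * L t)" .
      have "L (int_comb J (n b)) \<le> (\<Sum>j\<in>J. \<bar>n b j\<bar> * L j)" by (rule length_function_int_comb[OF L Jc])
      also have "\<dots> \<le> (\<Sum>j\<in>J. (\<bar>\<psi> j a\<bar> + (\<Sum>t\<in>T. d * \<bar>\<psi> j t\<bar>)) * L j)"
        using L0 Jc(2) nb by (intro sum_mono mult_right_mono) auto
      also have "\<dots> = (\<Sum>j\<in>J. \<bar>\<psi> j a\<bar> * L j) + (\<Sum>j\<in>J. (\<Sum>t\<in>T. d * \<bar>\<psi> j t\<bar>) * L j)"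
        by (simp add: distrib_right sum.distrib)
      also have "(\<Sum>j\<in>J. \<bar>\<psi> j a\<bar> * L j) \<le> (\<Sum>j\<in>J. \<bar>\<psi> j a\<bar> * (\<Sum>j\<in>J. L j))"
        using L0 Jc by (intro sum_mono mult_left_mono member_le_sum) auto
      also have "\<dots> = (\<Sum>j\<in>J. L j) * (\<Sum>j\<in>J. \<bar>\<psi> j a\<bar>)" unfolding sum_distrib_right[symmetric] by (rule mult.commute)
      finally have "L (int_comb J (n b)) + L r \<le> (\<Sum>j\<in>J. L j) * (\<Sum>j\<in>J. \<bar>\<psi> j a\<bar>) + K"
        using Lr unfolding K_def by simp
      moreover have "L a \<le> L (int_comb J (n b)) + L r"
        unfolding a_eq by (rule length_functionD[OF L]) (use rc Jc in auto)
      moreover have "K * (\<Sum>j\<in>J. \<bar>\<psi> j a\<bar>) \<ge> 0" using K0 by (simp add: sum_nonneg)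
      ultimately show ?thesis using sumL0 unfolding C_def by (simp add: algebra_simps)
    qed
    then show ?thesis by blast
  qed
  show thesis
  proof (rule that[OF Jc hom dual J(3) _ len])
    fix a assume "a \<in> carrier G"
    then show "\<exists>n. a [^] d = int_comb J n \<and> (\<forall>j\<in>J. of_int (n j) = d * \<psi> j a)"
      using n[of a] J(3) unfolding \<psi>_def by (intro exI[of _ "n a"]) auto
  qed
qed

end

section \<open>Finite-dimensional normed spaces\<close>

text \<open>A finite basis b together with its dual basis \<kappa>.\<close>

definition finite_coordinates ::
    "(real, 'v) module \<Rightarrow> 'j set \<Rightarrow> ('j \<Rightarrow> 'v) \<Rightarrow> ('j \<Rightarrow> 'v \<Rightarrow> real) \<Rightarrow> bool" where
  "finite_coordinates V J b \<kappa> \<longleftrightarrow>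
    finite J \<and> b \<in> J \<rightarrow> carrier V \<and> (\<forall>j\<in>J. linear_functional V (\<kappa> j)) \<and>
    (\<forall>i\<in>J. \<forall>j\<in>J. \<kappa> j (b i) = of_bool (i = j)) \<and>
    (\<forall>U\<in>carrier V. U = finsum V (\<lambda>j. \<kappa> j U \<odot>\<^bsub>V\<^esub> b j) J)"

context comm_group
begin

lemma pure_tensor_int_pow:
  assumes a: "a \<in> carrier G"
  shows "pure_tensor G (a [^] (n::int)) r = of_int n \<odot>\<^bsub>real_tensor G\<^esub> pure_tensor G a r"
proof -
  interpret T: real_space "real_tensor G" by (rule real_space_real_tensor)
  have one: "pure_tensor G \<one> r = \<zero>\<^bsub>real_tensor G\<^esub>"
    using pure_tensor_add_left[of \<one> \<one> r] by (metis T.add.l_cancel_one' l_one one_closed pure_tensor_carrier)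
  have nat: "pure_tensor G (a [^] (m::nat)) r = of_nat m \<odot>\<^bsub>real_tensor G\<^esub> pure_tensor G a r" for m
  proof (induction m)
    case 0
    show ?case using a one by simp
  next
    case (Suc m)
    then show ?case using a by (simp add: pure_tensor_add_left T.smult_add_left T.a_comm)
  qed
  show ?thesis
  proof (cases n)
    case (nonneg m)
    then show ?thesis using nat[of m] by (simp add: int_pow_int)
  next
    case (neg m)
    let ?p = "a [^] Suc m"
    have "a [^] n = inv ?p" unfolding neg using a by (rule int_pow_neg_int)
    moreover have "pure_tensor G (inv ?p) r \<oplus>\<^bsub>real_tensor G\<^esub> pure_tensor G ?p r = \<zero>\<^bsub>real_tensor G\<^esub>"
      using a by (simp add: pure_tensor_add_left[symmetric] one del: nat_pow_Suc)
    ultimately have "pure_tensor G (a [^] n) r = \<ominus>\<^bsub>real_tensor G\<^esub> pure_tensor G ?p r"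
      using a by (metis T.minus_equality inv_closed nat_pow_closed pure_tensor_carrier)
    also have "\<dots> = (-1) \<odot>\<^bsub>real_tensor G\<^esub> (of_nat (Suc m) \<odot>\<^bsub>real_tensor G\<^esub> pure_tensor G a r)"
      using a nat[of "Suc m"] by (simp add: T.smult_minus_one del: nat_pow_Suc)
    also have "\<dots> = of_int n \<odot>\<^bsub>real_tensor G\<^esub> pure_tensor G a r"
      using a neg by (subst T.smult_smult) auto
    finally show ?thesis .
  qed
qed

lemma pure_tensor_one_left: "pure_tensor G \<one> r = \<zero>\<^bsub>real_tensor G\<^esub>"
proof -
  interpret T: real_space "real_tensor G" by (rule real_space_real_tensor)
  show ?thesis using pure_tensor_int_pow[of \<one> 0 r] by simp
qed

lemma pure_tensor_int_comb:
  assumes "finite J" "J \<subseteq> carrier G"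
  shows "pure_tensor G (int_comb J n) r
    = finsum (real_tensor G) (\<lambda>j. of_int (n j) \<odot>\<^bsub>real_tensor G\<^esub> pure_tensor G j r) J"
proof -
  interpret T: real_space "real_tensor G" by (rule real_space_real_tensor)
  show ?thesis using assms
  proof (induction J rule: finite_induct)
    case empty
    show ?case by (simp add: int_comb_def pure_tensor_one_left)
  next
    case (insert t J)
    have "(\<lambda>j. of_int (n j) \<odot>\<^bsub>real_tensor G\<^esub> pure_tensor G j r) \<in> insert t J \<rightarrow> carrier (real_tensor G)"
      using insert.prems by auto
    then show ?case using insert by (simp add: int_comb_insert pure_tensor_add_left pure_tensor_int_pow Pi_def)
  qed
qed

text \<open>The pure tensor of a and r is r / d times the pure tensor of a^d and 1, and a^d is an
  integer combination of J. Division by d becomes possible after tensoring, which is why dependence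
  up to powers suffices for a basis.\<close>

theorem finite_coordinates_real_tensor:
  assumes "finite J" "J \<subseteq> carrier G"
    and \<psi>: "\<And>j. j \<in> J \<Longrightarrow> \<psi> j \<in> real_hom G"
    and dual: "\<And>i j. i \<in> J \<Longrightarrow> j \<in> J \<Longrightarrow> \<psi> j i = of_bool (i = j)"
    and d: "(d::int) > 0"
    and pow: "\<And>a. a \<in> carrier G \<Longrightarrow> \<exists>n. a [^] d = int_comb J n \<and> (\<forall>j\<in>J. of_int (n j) = d * \<psi> j a)"
  shows "finite_coordinates (real_tensor G) J (\<lambda>j. pure_tensor G j 1) (\<lambda>j. functional_of (\<psi> j))"
proof -
  interpret T: real_space "real_tensor G" by (rule real_space_real_tensor)
  let ?b = "\<lambda>j. pure_tensor G j 1"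
  note lin = linear_functional_of[OF \<psi>]
  have b: "?b \<in> J \<rightarrow> carrier (real_tensor G)" using assms(2) by auto
  have "U = finsum (real_tensor G) (\<lambda>j. functional_of (\<psi> j) U \<odot>\<^bsub>real_tensor G\<^esub> ?b j) J"
    if "U \<in> carrier (real_tensor G)" for U
    using that
  proof (induction U rule: real_tensor_induct)
    case zero
    \<comment> \<open>The vanishing coefficients are written as 0 * 0 so that one factor can be
      taken out of the sum.\<close>
    have "finsum (real_tensor G) (\<lambda>j. functional_of (\<psi> j) \<zero>\<^bsub>real_tensor G\<^esub> \<odot>\<^bsub>real_tensor G\<^esub> ?b j) J
        = finsum (real_tensor G) (\<lambda>j. (0 * 0) \<odot>\<^bsub>real_tensor G\<^esub> ?b j) J"
      by (rule T.finsum_cong') (use b in \<open>auto simp: T.linear_functional_zero[OF lin] Pi_def\<close>)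
    also have "\<dots> = 0 \<odot>\<^bsub>real_tensor G\<^esub> finsum (real_tensor G) (\<lambda>j. 0 \<odot>\<^bsub>real_tensor G\<^esub> ?b j) J"
      by (rule T.finsum_smult_scale) (use assms b in auto)
    also have "\<dots> = \<zero>\<^bsub>real_tensor G\<^esub>"
      by (rule T.smult_zero_left, rule T.finsum_closed) (use b in \<open>auto simp: Pi_def\<close>)
    finally show ?case by simp
  next
    case (pure a r)
    obtain n where n: "a [^] d = int_comb J n" "\<And>j. j \<in> J \<Longrightarrow> of_int (n j) = d * \<psi> j a"
      using pow[OF pure] by blast
    have "pure_tensor G a r = (r / d) \<odot>\<^bsub>real_tensor G\<^esub> (of_int d \<odot>\<^bsub>real_tensor G\<^esub> pure_tensor G a 1)"
      using pure d by (simp add: T.smult_smult smult_pure_tensor)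
    also have "of_int d \<odot>\<^bsub>real_tensor G\<^esub> pure_tensor G a 1 = pure_tensor G (int_comb J n) 1"
      unfolding n(1)[symmetric] using pure by (simp add: pure_tensor_int_pow)
    also have "\<dots> = finsum (real_tensor G) (\<lambda>j. of_int (n j) \<odot>\<^bsub>real_tensor G\<^esub> ?b j) J"
      by (rule pure_tensor_int_comb[OF assms(1,2)])
    also have "(r / d) \<odot>\<^bsub>real_tensor G\<^esub> \<dots> = finsum (real_tensor G) (\<lambda>j. (r / d * of_int (n j)) \<odot>\<^bsub>real_tensor G\<^esub> ?b j) J"
      by (rule T.finsum_smult_scale[symmetric]) (use assms b in auto)
    also have "\<dots> = finsum (real_tensor G) (\<lambda>j. functional_of (\<psi> j) (pure_tensor G a r) \<odot>\<^bsub>real_tensor G\<^esub> ?b j) J"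
      by (rule T.finsum_cong') (use b pure d n(2) in \<open>auto simp: functional_of_pure[OF \<psi>] Pi_def\<close>)
    finally show ?case .
  next
    case (diff x y)
    let ?f = "\<lambda>U. finsum (real_tensor G) (\<lambda>j. functional_of (\<psi> j) U \<odot>\<^bsub>real_tensor G\<^esub> ?b j) J"
    have "?f (x \<ominus>\<^bsub>real_tensor G\<^esub> y)
      = finsum (real_tensor G) (\<lambda>j. (functional_of (\<psi> j) x + (-1) * functional_of (\<psi> j) y) \<odot>\<^bsub>real_tensor G\<^esub> ?b j) J"
      by (rule T.finsum_cong') (use b diff in \<open>auto simp: T.linear_functional_diff[OF lin] Pi_def\<close>)
    also have "\<dots> = ?f x \<oplus>\<^bsub>real_tensor G\<^esub> finsum (real_tensor G) (\<lambda>j. ((-1) * functional_of (\<psi> j) y) \<odot>\<^bsub>real_tensor G\<^esub> ?b j) J"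
      by (rule T.finsum_smult_distrib[OF b])
    also have "finsum (real_tensor G) (\<lambda>j. ((-1) * functional_of (\<psi> j) y) \<odot>\<^bsub>real_tensor G\<^esub> ?b j) J
      = (-1) \<odot>\<^bsub>real_tensor G\<^esub> ?f y"
      by (rule T.finsum_smult_scale) (use assms b in auto)
    also have "?f x \<oplus>\<^bsub>real_tensor G\<^esub> (-1) \<odot>\<^bsub>real_tensor G\<^esub> ?f y = x \<ominus>\<^bsub>real_tensor G\<^esub> y"
      using diff by (metis T.minus_eq T.smult_minus_one)
    finally show ?case by simp
  qed
  moreover have "functional_of (\<psi> j) (?b i) = of_bool (i = j)" if "i \<in> J" "j \<in> J" for i j
    using that assms(2) dual by (auto simp: functional_of_pure[OF \<psi>])
  ultimately show ?thesis
    unfolding finite_coordinates_def using assms(1) b lin by blast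
qed

end

context real_space
begin

text \<open>The norm attains a positive minimum on the unit sphere of the maximum norm.\<close>

lemma coordinates_bounded_by_norm:
  fixes J :: "'j set"
  assumes V: "finite_coordinates V J b \<kappa>" and \<nu>: "is_norm V \<nu>"
  obtains C where "C \<ge> 0" "\<And>j U. j \<in> J \<Longrightarrow> U \<in> carrier V \<Longrightarrow> \<bar>\<kappa> j U\<bar> \<le> C * \<nu> U"
proof -
  have J: "finite J" "b \<in> J \<rightarrow> carrier V" and lin: "\<And>j. j \<in> J \<Longrightarrow> linear_functional V (\<kappa> j)"
    and dual: "\<And>i j. i \<in> J \<Longrightarrow> j \<in> J \<Longrightarrow> \<kappa> j (b i) = of_bool (i = j)"
    and exp: "\<And>U. U \<in> carrier V \<Longrightarrow> U = finsum V (\<lambda>j. \<kappa> j U \<odot> b j) J"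
    using V unfolding finite_coordinates_def by blast+
  define s where "s c = finsum V (\<lambda>j. c j \<odot> b j) J" for c :: "'j \<Rightarrow> real"
  have term_closed: "(\<lambda>j. c j \<odot> b j) \<in> J \<rightarrow> carrier V" for c using J by auto
  have s_closed: "s c \<in> carrier V" for c unfolding s_def by (rule finsum_closed[OF term_closed])
  have s_diff: "s c \<ominus> s c' = s (\<lambda>j. c j - c' j)" for c c'
  proof -
    have "s (\<lambda>j. c j + (-1) * c' j) = s c \<oplus> s (\<lambda>j. (-1) * c' j)"
      unfolding s_def by (rule finsum_smult_distrib[OF J(2)])
    also have "s (\<lambda>j. (-1) * c' j) = (-1) \<odot> s c'"
      unfolding s_def by (rule finsum_smult_scale[OF J])
    finally show ?thesis by (simp add: smult_minus_one[OF s_closed] minus_eq)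
  qed
  have \<nu>s: "\<nu> (s c) \<le> (\<Sum>j\<in>J. \<bar>c j\<bar> * \<nu> (b j))" for c
  proof -
    have "\<nu> (s c) \<le> (\<Sum>j\<in>J. \<nu> (c j \<odot> b j))" unfolding s_def by (rule norm_finsum_le[OF \<nu> J(1) term_closed])
    also have "\<dots> = (\<Sum>j\<in>J. \<bar>c j\<bar> * \<nu> (b j))"
      by (rule sum.cong) (use J in \<open>auto simp: is_normD(3)[OF \<nu>] Pi_def\<close>)
    finally show ?thesis .
  qed
  have lip: "\<bar>\<nu> (s c) - \<nu> (s c')\<bar> \<le> (\<Sum>j\<in>J. \<bar>c j - c' j\<bar> * \<nu> (b j))" for c c'
    using norm_triangle_sub[OF \<nu> s_closed s_closed, of c c'] norm_triangle_sub[OF \<nu> s_closed s_closed, of c' c]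
      \<nu>s[of "\<lambda>j. c j - c' j"] \<nu>s[of "\<lambda>j. c' j - c j"]
    by (simp add: s_diff abs_minus_commute)
  \<comment> \<open>The index type may be infinite while J is finite. Coefficients outside J are
    fixed to be 0, so that X is a product of compact sets in the full function space.\<close>
  define X where "X = PiE UNIV (\<lambda>j. if j \<in> J then {-1..1::real} else {0})"
  have "compactin (product_topology (\<lambda>_. euclidean) UNIV) X"
    unfolding X_def by (subst compactin_PiE) auto
  hence X: "compact X" by (simp add: euclidean_product_topology)
  define E where "E = X \<inter> (\<Union>j\<in>J. {c. \<bar>c j\<bar> = 1})"
  have "closed (\<Union>j\<in>J. {c :: 'j \<Rightarrow> real. \<bar>c j\<bar> = 1})"
  proof (intro closed_UN J(1) ballI)
    show "closed {c :: 'j \<Rightarrow> real. \<bar>c j\<bar> = 1}" for j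
      by (rule closed_Collect_eq[OF continuous_on_rabs[OF continuous_on_product_coordinates] continuous_on_const])
  qed
  hence E: "compact E" unfolding E_def using X by (rule compact_Int_closed[rotated])
  have cont: "continuous_on E (\<lambda>c. \<nu> (s c))"
    unfolding continuous_on_def
  proof
    fix c assume "c \<in> E"
    have "continuous_on UNIV (\<lambda>c'. \<Sum>j\<in>J. \<bar>c' j - c j\<bar> * \<nu> (b j))"
      by (intro continuous_on_sum continuous_on_mult continuous_on_rabs continuous_on_diff
          continuous_on_product_coordinates continuous_on_const)
    hence "continuous_on E (\<lambda>c'. \<Sum>j\<in>J. \<bar>c' j - c j\<bar> * \<nu> (b j))"
      by (rule continuous_on_subset) simp
    hence "((\<lambda>c'. \<Sum>j\<in>J. \<bar>c' j - c j\<bar> * \<nu> (b j)) \<longlongrightarrow> (\<Sum>j\<in>J. \<bar>c j - c j\<bar> * \<nu> (b j))) (at c within E)"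
      using \<open>c \<in> E\<close> unfolding continuous_on_def by blast
    hence "((\<lambda>c'. \<Sum>j\<in>J. \<bar>c' j - c j\<bar> * \<nu> (b j)) \<longlongrightarrow> 0) (at c within E)" by simp
    hence "((\<lambda>c'. \<nu> (s c') - \<nu> (s c)) \<longlongrightarrow> 0) (at c within E)"
      by (rule Lim_null_comparison[rotated]) (use lip in auto)
    then show "((\<lambda>c. \<nu> (s c)) \<longlongrightarrow> \<nu> (s c)) (at c within E)" by (simp add: LIM_zero_iff)
  qed
  have \<kappa>s: "\<kappa> j (s c) = c j" if j: "j \<in> J" for j c
  proof -
    have "\<kappa> j (s c) = (\<Sum>i\<in>J. \<kappa> j (c i \<odot> b i))"
      unfolding s_def by (rule linear_functional_finsum[OF lin[OF j] J(1) term_closed])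
    also have "\<dots> = (\<Sum>i\<in>J. if i = j then c j else 0)"
      by (rule sum.cong) (use J j dual in \<open>auto simp: linear_functionalD(2)[OF lin[OF j]] Pi_def\<close>)
    finally show ?thesis using J j by simp
  qed
  have pos: "\<nu> (s c) > 0" if c: "c \<in> E" for c
  proof -
    from c obtain j where j: "j \<in> J" "\<bar>c j\<bar> = 1" unfolding E_def by auto
    hence "\<kappa> j (s c) \<noteq> 0" using \<kappa>s by auto
    hence "s c \<noteq> \<zero>" using linear_functional_zero[OF lin[OF j(1)]] by metis
    then show ?thesis using is_normD(1,2)[OF \<nu> s_closed, of c] by linarith
  qed
  obtain \<delta> where \<delta>: "\<delta> > 0" "\<And>c. c \<in> E \<Longrightarrow> \<delta> \<le> \<nu> (s c)"
  \<comment> \<open>The sphere is empty when J is, and then any positive \<delta> will do.\<close>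
  proof (cases "E = {}")
    case True
    then show thesis by (intro that[of 1]) auto
  next
    case False
    then obtain c0 where "c0 \<in> E" "\<forall>c\<in>E. \<nu> (s c0) \<le> \<nu> (s c)"
      using continuous_attains_inf[OF E False cont] by blast
    then show thesis using pos by (intro that[of "\<nu> (s c0)"]) auto
  qed
  have "\<bar>\<kappa> j U\<bar> \<le> 1 / \<delta> * \<nu> U" if j: "j \<in> J" and U: "U \<in> carrier V" for j U
  proof -
    define M where "M = Max ((\<lambda>j. \<bar>\<kappa> j U\<bar>) ` J)"
    have le: "\<bar>\<kappa> i U\<bar> \<le> M" if "i \<in> J" for i unfolding M_def using J that by auto
    have "M \<in> (\<lambda>j. \<bar>\<kappa> j U\<bar>) ` J" unfolding M_def using J j by (intro Max_in) auto
    then obtain i where i: "i \<in> J" "M = \<bar>\<kappa> i U\<bar>" by auto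
    show ?thesis
    proof (cases "M = 0")
      case True
      then show ?thesis using le[OF j] is_normD(1)[OF \<nu> U] \<delta> by simp
    next
      case False
      hence M: "M > 0" using i by auto
      define c where "c j = (if j \<in> J then 1 / M * \<kappa> j U else 0)" for j
      have "c \<in> E" unfolding E_def X_def
      proof (intro IntI PiE_I)
        show "c j \<in> (if j \<in> J then {-1..1} else {0})" for j
          using le[of j] M unfolding c_def by (auto simp: field_simps abs_le_iff)
        show "c \<in> (\<Union>j\<in>J. {c. \<bar>c j\<bar> = 1})"
          using i M unfolding c_def by (auto intro!: bexI[of _ i])
      qed auto
      hence "\<delta> \<le> \<nu> (s c)" by (rule \<delta>)
      also have "s c = finsum V (\<lambda>j. (1 / M * \<kappa> j U) \<odot> b j) J"
        unfolding s_def c_def by (rule finsum_cong') (use J in auto)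
      also have "\<dots> = (1 / M) \<odot> finsum V (\<lambda>j. \<kappa> j U \<odot> b j) J"
        by (rule finsum_smult_scale[OF J])
      also have "finsum V (\<lambda>j. \<kappa> j U \<odot> b j) J = U" using exp[OF U] by simp
      also have "\<nu> ((1 / M) \<odot> U) = 1 / M * \<nu> U" using is_normD(3)[OF \<nu> U] M by simp
      finally have "M \<le> 1 / \<delta> * \<nu> U" using M \<delta> by (simp add: field_simps)
      with le[OF j] show ?thesis by linarith
    qed
  qed
  with \<delta> show thesis by (intro that[of "1 / \<delta>"]) auto
qed

lemma linear_functional_bounded_by_norm:
  assumes V: "finite_coordinates V J b \<kappa>" and \<nu>: "is_norm V \<nu>" and \<theta>: "linear_functional V \<theta>"
  obtains C where "C \<ge> 0" "\<And>U. U \<in> carrier V \<Longrightarrow> \<bar>\<theta> U\<bar> \<le> C * \<nu> U"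
proof -
  obtain C where C: "C \<ge> 0" "\<And>j U. j \<in> J \<Longrightarrow> U \<in> carrier V \<Longrightarrow> \<bar>\<kappa> j U\<bar> \<le> C * \<nu> U"
    using coordinates_bounded_by_norm[OF V \<nu>] by blast
  have J: "finite J" "b \<in> J \<rightarrow> carrier V"
    and exp: "\<And>U. U \<in> carrier V \<Longrightarrow> U = finsum V (\<lambda>j. \<kappa> j U \<odot> b j) J"
    using V unfolding finite_coordinates_def by blast+
  have "\<bar>\<theta> U\<bar> \<le> (\<Sum>j\<in>J. C * \<bar>\<theta> (b j)\<bar>) * \<nu> U" if U: "U \<in> carrier V" for U
  proof -
    have "\<theta> U = \<theta> (finsum V (\<lambda>j. \<kappa> j U \<odot> b j) J)" using exp[OF U] by simp
    also have "\<dots> = (\<Sum>j\<in>J. \<theta> (\<kappa> j U \<odot> b j))"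
      by (rule linear_functional_finsum[OF \<theta> J(1)]) (use J in auto)
    also have "\<dots> = (\<Sum>j\<in>J. \<kappa> j U * \<theta> (b j))"
      by (rule sum.cong) (use J in \<open>auto simp: linear_functionalD(2)[OF \<theta>] Pi_def\<close>)
    finally have "\<bar>\<theta> U\<bar> \<le> (\<Sum>j\<in>J. \<bar>\<kappa> j U * \<theta> (b j)\<bar>)" by (simp add: sum_abs)
    also have "\<dots> \<le> (\<Sum>j\<in>J. (C * \<bar>\<theta> (b j)\<bar>) * \<nu> U)"
    proof (rule sum_mono)
      fix j assume "j \<in> J"
      from mult_right_mono[OF C(2)[OF this U], of "\<bar>\<theta> (b j)\<bar>"]
      show "\<bar>\<kappa> j U * \<theta> (b j)\<bar> \<le> C * \<bar>\<theta> (b j)\<bar> * \<nu> U" by (simp add: abs_mult mult_ac)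
    qed
    finally show ?thesis by (simp add: sum_distrib_right)
  qed
  moreover have "(\<Sum>j\<in>J. C * \<bar>\<theta> (b j)\<bar>) \<ge> 0" using C by (intro sum_nonneg) auto
  ultimately show thesis using that by blast
qed

end

section \<open>The abelianization\<close>

definition ab_class :: "('a, 'm) monoid_scheme \<Rightarrow> 'a \<Rightarrow> 'a set" where
  "ab_class G x = derived G (carrier G) #>\<^bsub>G\<^esub> x"

lemma ab_proj_eq: "ab_proj G x = pure_tensor (abelianization G) (ab_class G x) 1"
  by (simp add: ab_proj_def ab_class_def)

context group
begin

lemma derived_normal: "derived G (carrier G) \<lhd> G"
  by (rule derived_is_normal[OF normal_self])

lemma comm_group_abelianization: "comm_group (abelianization G)"
  unfolding abelianization_def by (rule derived_quot_is_comm_group)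

lemma carrier_abelianization: "carrier (abelianization G) = ab_class G ` carrier G"
  unfolding abelianization_def carrier_FactGroup ab_class_def by (rule refl)

lemma ab_class_closed [simp, intro]: "x \<in> carrier G \<Longrightarrow> ab_class G x \<in> carrier (abelianization G)"
  by (simp add: carrier_abelianization)

lemma ab_class_hom: "ab_class G \<in> hom G (abelianization G)"
  using normal.r_coset_hom_Mod[OF derived_normal] unfolding abelianization_def ab_class_def .

lemma ab_class_mult:
  "x \<in> carrier G \<Longrightarrow> y \<in> carrier G \<Longrightarrow> ab_class G (x \<otimes> y) = ab_class G x \<otimes>\<^bsub>abelianization G\<^esub> ab_class G y"
  using ab_class_hom by (rule hom_mult)

lemma group_hom_ab_class: "group_hom G (abelianization G) (ab_class G)"
  using ab_class_hom comm_group_abelianization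
  by (simp add: group_hom_def group_hom_axioms_def comm_group.axioms(2) group_axioms)

lemma ab_class_eq_iff:
  assumes x: "x \<in> carrier G" and y: "y \<in> carrier G"
  shows "ab_class G x = ab_class G y \<longleftrightarrow> (\<exists>k\<in>derived G (carrier G). x = k \<otimes> y)"
proof -
  have sub: "subgroup (derived G (carrier G)) G" using derived_normal by (rule normal_imp_subgroup)
  have "ab_class G x = ab_class G y \<longleftrightarrow> x \<in> derived G (carrier G) #> y"
    unfolding ab_class_def using repr_independence[OF _ y sub] rcos_self[OF x sub] by metis
  then show ?thesis unfolding r_coset_def by auto
qed

lemma finite_generating_set_abelianization:
  assumes "finite_generating_set G S"
  shows "finite (ab_class G ` S)" "ab_class G ` S \<subseteq> carrier (abelianization G)"
    "generate (abelianization G) (ab_class G ` S) = carrier (abelianization G)"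
  using assms group_hom.generate_img[OF group_hom_ab_class, of S]
  unfolding finite_generating_set_def carrier_abelianization by auto

lemma ab_proj_closed [simp, intro]: "x \<in> carrier G \<Longrightarrow> ab_proj G x \<in> carrier (real_abelianization G)"
  unfolding ab_proj_eq by (rule comm_group.pure_tensor_carrier[OF comm_group_abelianization]) simp

lemma ab_proj_mult:
  "x \<in> carrier G \<Longrightarrow> y \<in> carrier G
    \<Longrightarrow> ab_proj G (x \<otimes> y) = ab_proj G x \<oplus>\<^bsub>real_abelianization G\<^esub> ab_proj G y"
  unfolding ab_proj_eq ab_class_mult
  by (rule comm_group.pure_tensor_add_left[OF comm_group_abelianization]) auto

lemma real_space_abelianization: "real_space (real_abelianization G)"
  by (rule comm_group.real_space_real_tensor[OF comm_group_abelianization])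

lemma ab_proj_one: "ab_proj G \<one> = \<zero>\<^bsub>real_abelianization G\<^esub>"
proof -
  interpret V: real_space "real_abelianization G" by (rule real_space_abelianization)
  show ?thesis using ab_proj_mult[of \<one> \<one>] by (metis V.add.l_cancel_one' ab_proj_closed l_one one_closed)
qed

lemma ab_proj_inv:
  assumes "x \<in> carrier G"
  shows "ab_proj G (inv x) = \<ominus>\<^bsub>real_abelianization G\<^esub> ab_proj G x"
proof -
  interpret V: real_space "real_abelianization G" by (rule real_space_abelianization)
  have "ab_proj G (inv x) \<oplus>\<^bsub>real_abelianization G\<^esub> ab_proj G x = \<zero>\<^bsub>real_abelianization G\<^esub>"
    using ab_proj_mult[of "inv x" x] assms by (simp add: ab_proj_one)
  then show ?thesis using assms by (metis V.minus_equality ab_proj_closed inv_closed)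
qed

lemma ab_proj_pow:
  assumes "x \<in> carrier G"
  shows "ab_proj G (x [^] (n::nat)) = real n \<odot>\<^bsub>real_abelianization G\<^esub> ab_proj G x"
proof -
  interpret V: real_space "real_abelianization G" by (rule real_space_abelianization)
  show ?thesis
    by (induction n) (use assms in \<open>auto simp: ab_proj_one ab_proj_mult V.smult_add_left V.a_comm\<close>)
qed

text \<open>An additive function into the reals kills commutators, so its value can be read off from
  any representative of a coset of the derived subgroup.\<close>

lemma additive_factors:
  fixes f :: "'a \<Rightarrow> real"
  assumes f: "\<And>x y. x \<in> carrier G \<Longrightarrow> y \<in> carrier G \<Longrightarrow> f (x \<otimes> y) = f x + f y"
  obtains g where "g \<in> real_hom (abelianization G)" "\<And>x. x \<in> carrier G \<Longrightarrow> g (ab_class G x) = f x"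
proof -
  have one: "f \<one> = 0" using f[of \<one> \<one>] by simp
  have f_inv: "f (inv x) = - f x" if "x \<in> carrier G" for x using f[of "inv x" x] that one by simp
  have sub: "derived_set G (carrier G) \<subseteq> carrier G" by (rule derived_set_in_carrier) simp
  have comm: "f h = 0" if "h \<in> derived_set G (carrier G)" for h
    using that by (auto simp: f f_inv)
  have der: "f k = 0" if "k \<in> derived G (carrier G)" for k
    using that unfolding derived_def
  proof (induction rule: generate.induct)
    case (inv h)
    have "h \<in> carrier G" by (rule subsetD[OF sub inv])
    then show ?case using comm[OF inv] f_inv by simp
  next
    case (eng h1 h2)
    have "h1 \<in> carrier G" "h2 \<in> carrier G"
      by (rule subsetD[OF generate_incl[OF sub]], rule eng)+
    then show ?case using f[of h1 h2] eng.IH by simp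
  qed (rule one, rule comm)
  define g where "g X = f (SOME x. x \<in> carrier G \<and> X = ab_class G x)" for X
  have g: "g (ab_class G x) = f x" if x: "x \<in> carrier G" for x
  proof -
    define y where "y = (SOME y. y \<in> carrier G \<and> ab_class G x = ab_class G y)"
    have y: "y \<in> carrier G \<and> ab_class G x = ab_class G y"
      unfolding y_def by (rule someI_ex) (use x in blast)
    then obtain k where k: "k \<in> derived G (carrier G)" "x = k \<otimes> y" using ab_class_eq_iff[OF x] by blast
    have "k \<in> carrier G" using k derived_in_carrier by blast
    then have "f x = f y" using f[of k y] y der[OF k(1)] k(2) by simp
    then show ?thesis unfolding g_def y_def by simp
  qed
  have "g \<in> real_hom (abelianization G)"
    unfolding real_hom_def carrier_abelianization by (auto simp: ab_class_mult[symmetric] g f)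
  then show thesis using g that by blast
qed

lemma additive_functional_ab_class:
  assumes "\<phi> \<in> real_hom (abelianization G)" "x \<in> carrier G"
  shows "functional_of \<phi> (ab_proj G x) = \<phi> (ab_class G x)"
  unfolding ab_proj_eq
  by (subst comm_group.functional_of_pure[OF comm_group_abelianization assms(1)]) (use assms(2) in auto)

lemma length_function_norm:
  assumes \<nu>: "is_norm (real_abelianization G) \<nu>"
  shows "length_function G (\<lambda>x. \<nu> (ab_proj G x))"
proof -
  interpret V: real_space "real_abelianization G" by (rule real_space_abelianization)
  show ?thesis unfolding length_function_def
    using is_normD[OF \<nu>] by (auto simp: ab_proj_one ab_proj_inv ab_proj_mult V.norm_minus[OF \<nu>])
qed

lemma length_function_abs_hom:
  assumes "\<phi> \<in> real_hom (abelianization G)"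
  shows "length_function G (\<lambda>x. \<bar>\<phi> (ab_class G x)\<bar>)"
proof -
  have mult: "\<phi> (ab_class G (x \<otimes> y)) = \<phi> (ab_class G x) + \<phi> (ab_class G y)"
    if "x \<in> carrier G" "y \<in> carrier G" for x y
    using assms that unfolding real_hom_def by (auto simp: ab_class_mult)
  have one: "\<phi> (ab_class G \<one>) = 0" using mult[of \<one> \<one>] by simp
  have "\<phi> (ab_class G (inv x)) = - \<phi> (ab_class G x)" if "x \<in> carrier G" for x
    using mult[of "inv x" x] that one by simp
  then show ?thesis unfolding length_function_def by (auto simp: one mult)
qed

text \<open>A length modulo the derived subgroup is constant on its cosets, so it descends to the
  abelianization and obeys the linear bound there. By the last clause, bounded abelianized
  coordinates give bounded distance to the derived subgroup, which is how the hypothesis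
  \<open>base\<close> of \<open>sublinear_path\<close> is met.\<close>

theorem real_abelianization_coordinates:
  assumes S: "finite_generating_set G S"
  obtains J \<psi> where "finite J" "J \<subseteq> carrier (abelianization G)"
    "\<And>j. j \<in> J \<Longrightarrow> \<psi> j \<in> real_hom (abelianization G)"
    "finite_coordinates (real_abelianization G) J (\<lambda>j. pure_tensor (abelianization G) j 1) (\<lambda>j. functional_of (\<psi> j))"
    "\<And>L. length_function G L \<Longrightarrow> \<exists>C. \<forall>x\<in>carrier G.
      quotient_length G L (derived G (carrier G)) x \<le> C * (1 + (\<Sum>j\<in>J. \<bar>\<psi> j (ab_class G x)\<bar>))"
proof -
  interpret A: comm_group "abelianization G" by (rule comm_group_abelianization)
  obtain J \<psi> d where J: "finite J" "J \<subseteq> carrier (abelianization G)"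
    "\<And>j. j \<in> J \<Longrightarrow> \<psi> j \<in> real_hom (abelianization G)"
    and dual: "\<And>i j. i \<in> J \<Longrightarrow> j \<in> J \<Longrightarrow> \<psi> j i = of_bool (i = j)"
    and d: "(d::int) > 0" "\<And>a. a \<in> carrier (abelianization G) \<Longrightarrow>
      \<exists>n. a [^]\<^bsub>abelianization G\<^esub> d = A.int_comb J n \<and> (\<forall>j\<in>J. of_int (n j) = d * \<psi> j a)"
    and len: "\<And>L. length_function (abelianization G) L
      \<Longrightarrow> \<exists>C. \<forall>a\<in>carrier (abelianization G). L a \<le> C * (1 + (\<Sum>j\<in>J. \<bar>\<psi> j a\<bar>))"
    by (rule A.real_coordinates[OF finite_generating_set_abelianization[OF S]]) blast
  show thesis
  proof (rule that[OF J A.finite_coordinates_real_tensor[OF J dual d]])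
    fix L assume L: "length_function G L"
    define Q where "Q = quotient_length G L (derived G (carrier G))"
    have Q: "length_function G Q" unfolding Q_def by (rule length_function_quotient[OF L derived_normal])
    have Q_class: "Q x = Q y" if xy: "x \<in> carrier G" "y \<in> carrier G" "ab_class G x = ab_class G y" for x y
    proof -
      from xy obtain k where k: "k \<in> derived G (carrier G)" "x = k \<otimes> y" using ab_class_eq_iff by blast
      have "k \<in> carrier G" using k derived_in_carrier by blast
      with fcong_quotient_length[OF L derived_normal k(1)] xy(2) show ?thesis
        unfolding fcong_def Q_def k(2) by (metis l_one one_closed)
    qed
    define LA where "LA X = Q (SOME x. x \<in> carrier G \<and> X = ab_class G x)" for X
    have LA: "LA (ab_class G x) = Q x" if x: "x \<in> carrier G" for x
    proof -
      have "(SOME y. y \<in> carrier G \<and> ab_class G x = ab_class G y) \<in> carrier G \<and>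
        ab_class G x = ab_class G (SOME y. y \<in> carrier G \<and> ab_class G x = ab_class G y)"
        by (rule someI_ex) (use x in blast)
      then show ?thesis unfolding LA_def using Q_class x by metis
    qed
    have "length_function (abelianization G) LA"
      unfolding length_function_def carrier_abelianization
      using length_functionD[OF Q] LA group_hom.hom_one[OF group_hom_ab_class]
        group_hom.hom_inv[OF group_hom_ab_class]
      by (auto simp: ab_class_mult[symmetric] simp flip: group_hom.hom_one[OF group_hom_ab_class] group_hom.hom_inv[OF group_hom_ab_class])
    from len[OF this] obtain C where "\<forall>a\<in>carrier (abelianization G). LA a \<le> C * (1 + (\<Sum>j\<in>J. \<bar>\<psi> j a\<bar>))" by blast
    then have "\<forall>x\<in>carrier G. Q x \<le> C * (1 + (\<Sum>j\<in>J. \<bar>\<psi> j (ab_class G x)\<bar>))"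
      using LA by (metis ab_class_closed)
    then show "\<exists>C. \<forall>x\<in>carrier G.
      quotient_length G L (derived G (carrier G)) x \<le> C * (1 + (\<Sum>j\<in>J. \<bar>\<psi> j (ab_class G x)\<bar>))"
      unfolding Q_def by blast
  qed
qed

end

section \<open>The induced linear map\<close>

lemma linear_between_zero:
  assumes "real_space V" "real_space W" and L: "linear_between V W L"
  shows "L \<zero>\<^bsub>V\<^esub> = \<zero>\<^bsub>W\<^esub>"
proof -
  interpret V: real_space V by fact
  interpret W: real_space W by fact
  have "L (0 \<odot>\<^bsub>V\<^esub> \<zero>\<^bsub>V\<^esub>) = 0 \<odot>\<^bsub>W\<^esub> L \<zero>\<^bsub>V\<^esub>" by (rule linear_betweenD[OF L]) simp
  then show ?thesis using linear_betweenD(1)[OF L V.zero_closed] by simp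
qed

lemma linear_between_diff:
  assumes "real_space V" "real_space W" and L: "linear_between V W L"
    and xy: "x \<in> carrier V" "y \<in> carrier V"
  shows "L (x \<ominus>\<^bsub>V\<^esub> y) = L x \<ominus>\<^bsub>W\<^esub> L y"
proof -
  interpret V: real_space V by fact
  interpret W: real_space W by fact
  have "L (x \<ominus>\<^bsub>V\<^esub> y) = L x \<oplus>\<^bsub>W\<^esub> L ((-1) \<odot>\<^bsub>V\<^esub> y)"
    using xy by (simp add: V.minus_eq V.smult_minus_one[symmetric] linear_betweenD(2)[OF L])
  also have "L ((-1) \<odot>\<^bsub>V\<^esub> y) = \<ominus>\<^bsub>W\<^esub> L y"
    using xy linear_betweenD[OF L] by (simp add: W.smult_minus_one)
  finally show ?thesis by (simp add: W.minus_eq)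
qed

lemma linear_between_finsum:
  assumes "real_space V" "real_space W" and L: "linear_between V W L"
    and "finite J" "f \<in> J \<rightarrow> carrier V"
  shows "L (finsum V f J) = finsum W (\<lambda>j. L (f j)) J"
proof -
  interpret V: real_space V by fact
  interpret W: real_space W by fact
  show ?thesis using assms(4,5)
  proof (induction J rule: finite_induct)
    case empty
    show ?case using linear_between_zero[OF assms(1-3)] by simp
  next
    case (insert j J)
    have "(\<lambda>j. L (f j)) \<in> insert j J \<rightarrow> carrier W" using insert.prems linear_betweenD(1)[OF L] by auto
    then show ?case using insert linear_betweenD(2)[OF L] by (auto simp: Pi_def)
  qed
qed

lemma linear_between_compose:
  assumes "linear_between V W L" "linear_between U V K"
  shows "linear_between U W (\<lambda>x. L (K x))"
  using assms unfolding linear_between_def by (auto simp: Pi_def)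

lemma (in comm_group) linear_between_tensor_eqI:
  assumes "real_space W" and L: "linear_between (real_tensor G) W L" "linear_between (real_tensor G) W L'"
    and eq: "\<And>a. a \<in> carrier G \<Longrightarrow> L (pure_tensor G a 1) = L' (pure_tensor G a 1)"
    and U: "U \<in> carrier (real_tensor G)"
  shows "L U = L' U"
  using U
proof (induction U rule: real_tensor_induct)
  case zero
  show ?case unfolding linear_between_zero[OF real_space_real_tensor assms(1) L(1)]
    linear_between_zero[OF real_space_real_tensor assms(1) L(2)] ..
next
  case (pure a r)
  have "pure_tensor G a r = r \<odot>\<^bsub>real_tensor G\<^esub> pure_tensor G a 1" using pure by (simp add: smult_pure_tensor)
  then show ?case using linear_betweenD(3)[OF L(1)] linear_betweenD(3)[OF L(2)] eq[OF pure] pure by simp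
next
  case (diff x y)
  then show ?case using linear_between_diff[OF real_space_real_tensor assms(1) L(1)]
      linear_between_diff[OF real_space_real_tensor assms(1) L(2)] by simp
qed

text \<open>At every power of x both linear maps stay within a fixed distance of p, while their
  difference scales with the exponent; so they agree on the image of N. That image spans the tensor
  product over the reals.\<close>

theorem linear_approximation_unique:
  assumes N: "group N" and W: "real_space W" and \<nu>: "is_norm W \<nu>"
    and p: "\<And>x. x \<in> carrier N \<Longrightarrow> p x \<in> carrier W"
    and L: "linear_between (real_abelianization N) W L" "linear_between (real_abelianization N) W L'"
    and bd: "bdd_above ((\<lambda>x. \<nu> (p x \<ominus>\<^bsub>W\<^esub> L (ab_proj N x))) ` carrier N)"
      "bdd_above ((\<lambda>x. \<nu> (p x \<ominus>\<^bsub>W\<^esub> L' (ab_proj N x))) ` carrier N)"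
    and U: "U \<in> carrier (real_abelianization N)"
  shows "L U = L' U"
proof -
  interpret N: group N by (rule N)
  interpret A: comm_group "abelianization N" by (rule N.comm_group_abelianization)
  interpret V: real_space "real_abelianization N" by (rule N.real_space_abelianization)
  interpret W: real_space W by (rule W)
  obtain C C' where C: "\<And>x. x \<in> carrier N \<Longrightarrow> \<nu> (p x \<ominus>\<^bsub>W\<^esub> L (ab_proj N x)) \<le> C"
    "\<And>x. x \<in> carrier N \<Longrightarrow> \<nu> (p x \<ominus>\<^bsub>W\<^esub> L' (ab_proj N x)) \<le> C'"
    using bd unfolding bdd_above_def by auto
  have eq: "L (ab_proj N x) = L' (ab_proj N x)" if x: "x \<in> carrier N" for x
  proof -
    define D where "D = L (ab_proj N x) \<ominus>\<^bsub>W\<^esub> L' (ab_proj N x)"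
    note c = linear_betweenD(1)[OF L(1) N.ab_proj_closed] linear_betweenD(1)[OF L(2) N.ab_proj_closed]
    have D: "D \<in> carrier W" unfolding D_def using c x by simp
    have "\<nu> D = 0"
    proof (rule eq_0_if_multiples_bounded)
      fix n :: nat
      let ?y = "x [^]\<^bsub>N\<^esub> n"
      have y: "?y \<in> carrier N" using x by simp
      have "real n \<odot>\<^bsub>W\<^esub> D = L (ab_proj N ?y) \<ominus>\<^bsub>W\<^esub> L' (ab_proj N ?y)"
        unfolding D_def using c x
        by (simp add: N.ab_proj_pow linear_betweenD(3)[OF L(1)] linear_betweenD(3)[OF L(2)]
            W.minus_eq W.smult_add_right W.smult_smult flip: W.smult_minus_one)
      also have "\<dots> = (p ?y \<ominus>\<^bsub>W\<^esub> L' (ab_proj N ?y)) \<ominus>\<^bsub>W\<^esub> (p ?y \<ominus>\<^bsub>W\<^esub> L (ab_proj N ?y))"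
        using c[OF y] p[OF y] by (simp add: W.minus_eq W.minus_add W.a_ac W.r_neg1 W.r_neg2)
      finally have "\<nu> (real n \<odot>\<^bsub>W\<^esub> D) \<le> \<nu> (p ?y \<ominus>\<^bsub>W\<^esub> L' (ab_proj N ?y)) + \<nu> (p ?y \<ominus>\<^bsub>W\<^esub> L (ab_proj N ?y))"
        using W.norm_diff_le[OF \<nu>] c[OF y] p[OF y] by simp
      also have "\<dots> \<le> C' + C" by (intro add_mono C y)
      finally show "real n * \<bar>\<nu> D\<bar> \<le> C' + C" using is_normD(1,3)[OF \<nu> D] by simp
    qed
    hence "D = \<zero>\<^bsub>W\<^esub>" using is_normD(2)[OF \<nu> D] by simp
    then show ?thesis unfolding D_def by (rule W.diff_eq_zeroD[OF _ c(1)[OF x] c(2)[OF x]])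
  qed
  show ?thesis
  proof (rule A.linear_between_tensor_eqI[OF W L _ U])
    fix a assume "a \<in> carrier (abelianization N)"
    then obtain x where x: "x \<in> carrier N" "a = ab_class N x" unfolding N.carrier_abelianization by blast
    show "L (pure_tensor (abelianization N) a 1) = L' (pure_tensor (abelianization N) a 1)"
      using eq[OF x(1)] unfolding ab_proj_eq x(2) .
  qed
qed

text \<open>The norm is arbitrary on purpose: surjectivity applies this result with the roles of the
  two groups exchanged and with a norm pulled back along L.\<close>

theorem linear_approximation_exists:
  assumes N: "group N" and nil: "nilpotent_group N" and M: "group M" and T: "finite_generating_set M T"
    and \<Psi>: "\<Psi> \<in> carrier N \<rightarrow> carrier M"
    and \<nu>: "is_norm (real_abelianization M) \<nu>" and def: "bounded_abelian_defect N M \<nu> \<Psi>"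
  obtains L where "linear_between (real_abelianization N) (real_abelianization M) L"
    "bdd_above ((\<lambda>x. \<nu> (ab_proj M (\<Psi> x) \<ominus>\<^bsub>real_abelianization M\<^esub> L (ab_proj N x))) ` carrier N)"
proof -
  interpret N: group N by (rule N)
  interpret M: group M by (rule M)
  interpret A: comm_group "abelianization N" by (rule N.comm_group_abelianization)
  interpret V: real_space "real_abelianization N" by (rule N.real_space_abelianization)
  interpret W: real_space "real_abelianization M" by (rule M.real_space_abelianization)
  obtain J \<psi> where J: "finite J" "J \<subseteq> carrier (abelianization M)"
    and hom: "\<And>j. j \<in> J \<Longrightarrow> \<psi> j \<in> real_hom (abelianization M)"
    and coord: "finite_coordinates (real_abelianization M) J
      (\<lambda>j. pure_tensor (abelianization M) j 1) (\<lambda>j. functional_of (\<psi> j))"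
    by (rule M.real_abelianization_coordinates[OF T]) blast
  define b where "b j = pure_tensor (abelianization M) j 1" for j
  define \<kappa> where "\<kappa> j = functional_of (\<psi> j)" for j
  have b: "b \<in> J \<rightarrow> carrier (real_abelianization M)"
    and lin: "\<And>j. j \<in> J \<Longrightarrow> linear_functional (real_abelianization M) (\<kappa> j)"
    and exp: "\<And>U. U \<in> carrier (real_abelianization M)
      \<Longrightarrow> U = finsum (real_abelianization M) (\<lambda>j. \<kappa> j U \<odot>\<^bsub>real_abelianization M\<^esub> b j) J"
    using coord unfolding finite_coordinates_def b_def \<kappa>_def by blast+
  obtain K where K: "K \<ge> 0" "\<And>j U. j \<in> J \<Longrightarrow> U \<in> carrier (real_abelianization M) \<Longrightarrow> \<bar>\<kappa> j U\<bar> \<le> K * \<nu> U"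
    using W.coordinates_bounded_by_norm[OF coord \<nu>] unfolding \<kappa>_def by blast
  obtain D where D: "\<And>x y. x \<in> carrier N \<Longrightarrow> y \<in> carrier N \<Longrightarrow>
    \<nu> (ab_proj M (\<Psi> (x \<otimes>\<^bsub>N\<^esub> y)) \<ominus>\<^bsub>real_abelianization M\<^esub> ab_proj M (\<Psi> x)
      \<ominus>\<^bsub>real_abelianization M\<^esub> ab_proj M (\<Psi> y)) \<le> D"
    using def unfolding bounded_abelian_defect_def bdd_above_def by auto
  have \<Psi>c: "\<Psi> x \<in> carrier M" if "x \<in> carrier N" for x using \<Psi> that by auto
  define q where "q j x = \<kappa> j (ab_proj M (\<Psi> x))" for j x
  have "\<exists>f. (\<forall>x\<in>carrier N. \<bar>q j x - functional_of f (ab_proj N x)\<bar> \<le> K * D) \<and> f \<in> real_hom (abelianization N)"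
    if j: "j \<in> J" for j
  proof -
    \<comment> \<open>The coordinate \<kappa> j is at most K times the norm, so applying it to the
      defect of \<Psi> shows q j to be a quasimorphism of defect K * D.\<close>
    have "\<bar>q j (x \<otimes>\<^bsub>N\<^esub> y) - q j x - q j y\<bar> \<le> K * D" if xy: "x \<in> carrier N" "y \<in> carrier N" for x y
    proof -
      let ?d = "ab_proj M (\<Psi> (x \<otimes>\<^bsub>N\<^esub> y)) \<ominus>\<^bsub>real_abelianization M\<^esub> ab_proj M (\<Psi> x)
        \<ominus>\<^bsub>real_abelianization M\<^esub> ab_proj M (\<Psi> y)"
      have c: "ab_proj M (\<Psi> (x \<otimes>\<^bsub>N\<^esub> y)) \<in> carrier (real_abelianization M)"
        "ab_proj M (\<Psi> x) \<in> carrier (real_abelianization M)" "ab_proj M (\<Psi> y) \<in> carrier (real_abelianization M)"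
        using \<Psi>c xy by auto
      have "q j (x \<otimes>\<^bsub>N\<^esub> y) - q j x - q j y = \<kappa> j ?d"
        unfolding q_def using c by (simp add: W.linear_functional_diff[OF lin[OF j]])
      also have "\<bar>\<dots>\<bar> \<le> K * \<nu> ?d" by (rule K(2)[OF j]) (use c in simp)
      also have "\<dots> \<le> K * D" by (rule mult_left_mono[OF D[OF xy] K(1)])
      finally show ?thesis .
    qed
    then obtain f where f: "\<And>x. x \<in> carrier N \<Longrightarrow> \<bar>q j x - f x\<bar> \<le> K * D"
      "\<And>x y. x \<in> carrier N \<Longrightarrow> y \<in> carrier N \<Longrightarrow> f (x \<otimes>\<^bsub>N\<^esub> y) = f x + f y"
      using N.quasimorphism_nilpotent[OF nil] by metis
    obtain g where g: "g \<in> real_hom (abelianization N)" "\<And>x. x \<in> carrier N \<Longrightarrow> g (ab_class N x) = f x"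
      using N.additive_factors[of f] f(2) by blast
    have "\<forall>x\<in>carrier N. \<bar>q j x - functional_of g (ab_proj N x)\<bar> \<le> K * D"
      using f(1) g N.additive_functional_ab_class[OF g(1)] by simp
    then show ?thesis using g(1) by blast
  qed
  then obtain f where f: "\<And>j x. j \<in> J \<Longrightarrow> x \<in> carrier N \<Longrightarrow> \<bar>q j x - functional_of (f j) (ab_proj N x)\<bar> \<le> K * D"
    and fhom: "\<And>j. j \<in> J \<Longrightarrow> f j \<in> real_hom (abelianization N)" by metis
  note flin = A.linear_functional_of[OF fhom]
  \<comment> \<open>The homomorphisms that approximate the coordinates of \<Psi> become the
    coordinates of L.\<close>
  define L where "L U = finsum (real_abelianization M) (\<lambda>j. functional_of (f j) U \<odot>\<^bsub>real_abelianization M\<^esub> b j) J" for U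
  have L: "linear_between (real_abelianization N) (real_abelianization M) L"
    unfolding linear_between_def
  proof (intro conjI ballI allI)
    show "L \<in> carrier (real_abelianization N) \<rightarrow> carrier (real_abelianization M)"
      unfolding L_def by (rule funcsetI, rule W.finsum_closed) (use b in auto)
    fix x assume x: "x \<in> carrier (real_abelianization N)"
    have "L (r \<odot>\<^bsub>real_abelianization N\<^esub> x)
      = finsum (real_abelianization M) (\<lambda>j. (r * functional_of (f j) x) \<odot>\<^bsub>real_abelianization M\<^esub> b j) J" for r
      unfolding L_def by (rule W.finsum_cong') (use b x in \<open>auto simp: linear_functionalD(2)[OF flin] Pi_def\<close>)
    then show "L (r \<odot>\<^bsub>real_abelianization N\<^esub> x) = r \<odot>\<^bsub>real_abelianization M\<^esub> L x" for r
      unfolding L_def using W.finsum_smult_scale[OF J(1) b] by simp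
    fix y assume y: "y \<in> carrier (real_abelianization N)"
    have "L (x \<oplus>\<^bsub>real_abelianization N\<^esub> y) = finsum (real_abelianization M)
        (\<lambda>j. (functional_of (f j) x + functional_of (f j) y) \<odot>\<^bsub>real_abelianization M\<^esub> b j) J"
      unfolding L_def by (rule W.finsum_cong') (use b x y in \<open>auto simp: linear_functionalD(1)[OF flin] Pi_def\<close>)
    then show "L (x \<oplus>\<^bsub>real_abelianization N\<^esub> y) = L x \<oplus>\<^bsub>real_abelianization M\<^esub> L y"
      unfolding L_def using W.finsum_smult_distrib[OF b] by simp
  qed
  have "\<nu> (ab_proj M (\<Psi> x) \<ominus>\<^bsub>real_abelianization M\<^esub> L (ab_proj N x)) \<le> (\<Sum>j\<in>J. K * D * \<nu> (b j))"
    if x: "x \<in> carrier N" for x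
  proof -
    let ?U = "ab_proj M (\<Psi> x)" and ?W = "real_abelianization M"
    let ?f = "\<lambda>j. functional_of (f j) (ab_proj N x)"
    have U: "?U \<in> carrier ?W" using \<Psi>c[OF x] by simp
    have Lc: "L (ab_proj N x) \<in> carrier ?W" using linear_betweenD(1)[OF L] x by simp
    have "?U \<ominus>\<^bsub>?W\<^esub> L (ab_proj N x) = ?U \<oplus>\<^bsub>?W\<^esub> ((-1) \<odot>\<^bsub>?W\<^esub> L (ab_proj N x))"
      using Lc by (simp add: W.minus_eq W.smult_minus_one)
    also have "(-1) \<odot>\<^bsub>?W\<^esub> L (ab_proj N x) = finsum ?W (\<lambda>j. ((-1) * ?f j) \<odot>\<^bsub>?W\<^esub> b j) J"
      unfolding L_def by (rule W.finsum_smult_scale[OF J(1) b, symmetric])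
    also have "?U \<oplus>\<^bsub>?W\<^esub> \<dots> = finsum ?W (\<lambda>j. q j x \<odot>\<^bsub>?W\<^esub> b j) J \<oplus>\<^bsub>?W\<^esub> \<dots>"
      unfolding q_def using exp[OF U] by simp
    also have "\<dots> = finsum ?W (\<lambda>j. (q j x + (-1) * ?f j) \<odot>\<^bsub>?W\<^esub> b j) J"
      by (rule W.finsum_smult_distrib[OF b, symmetric])
    also have "\<nu> \<dots> \<le> (\<Sum>j\<in>J. \<nu> ((q j x + (-1) * ?f j) \<odot>\<^bsub>?W\<^esub> b j))"
      by (rule W.norm_finsum_le[OF \<nu> J(1)]) (use b in auto)
    also have "\<dots> \<le> (\<Sum>j\<in>J. K * D * \<nu> (b j))"
    proof (rule sum_mono)
      fix j assume j: "j \<in> J"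
      have bj: "b j \<in> carrier ?W" using b j by auto
      have "\<nu> ((q j x + (-1) * ?f j) \<odot>\<^bsub>?W\<^esub> b j) = \<bar>q j x - ?f j\<bar> * \<nu> (b j)"
        using is_normD(3)[OF \<nu> bj] by simp
      also have "\<dots> \<le> K * D * \<nu> (b j)" by (rule mult_right_mono[OF f[OF j x] is_normD(1)[OF \<nu> bj]])
      finally show "\<nu> ((q j x + (-1) * ?f j) \<odot>\<^bsub>?W\<^esub> b j) \<le> K * D * \<nu> (b j)" .
    qed
    finally show ?thesis .
  qed
  then show thesis using that[OF L] by (meson bdd_aboveI2)
qed

text \<open>The definite description in \<open>L_ab\<close> requires uniqueness as a HOL function.
  Restricting to the carrier turns uniqueness on the carrier, given by
  \<open>linear_approximation_unique\<close>, into that.\<close>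

theorem L_ab_approximates:
  assumes N: "group N" and nil: "nilpotent_group N" and M: "group M" and T: "finite_generating_set M T"
    and \<Psi>: "\<Psi> \<in> carrier N \<rightarrow> carrier M"
    and \<nu>: "is_norm (real_abelianization M) \<nu>" and def: "bounded_abelian_defect N M \<nu> \<Psi>"
  shows "linear_between (real_abelianization N) (real_abelianization M) (L_ab N M \<nu> \<Psi>)"
    "bdd_above ((\<lambda>x. \<nu> (ab_proj M (\<Psi> x) \<ominus>\<^bsub>real_abelianization M\<^esub> L_ab N M \<nu> \<Psi> (ab_proj N x))) ` carrier N)"
proof -
  interpret N: group N by (rule N)
  interpret M: group M by (rule M)
  let ?V = "real_abelianization N" and ?W = "real_abelianization M"
  define P where "P L \<longleftrightarrow> L \<in> extensional (carrier ?V) \<and> linear_between ?V ?W L \<and>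
       bdd_above ((\<lambda>x. \<nu> (ab_proj M (\<Psi> x) \<ominus>\<^bsub>?W\<^esub> L (ab_proj N x))) ` carrier N)" for L
  interpret V: real_space ?V by (rule N.real_space_abelianization)
  obtain L where L: "linear_between ?V ?W L"
    "bdd_above ((\<lambda>x. \<nu> (ab_proj M (\<Psi> x) \<ominus>\<^bsub>?W\<^esub> L (ab_proj N x))) ` carrier N)"
    by (rule linear_approximation_exists[OF assms])
  have "linear_between ?V ?W (restrict L (carrier ?V))"
    using L(1) unfolding linear_between_def by (auto simp: Pi_def)
  moreover have "(\<lambda>x. \<nu> (ab_proj M (\<Psi> x) \<ominus>\<^bsub>?W\<^esub> restrict L (carrier ?V) (ab_proj N x))) ` carrier N
      = (\<lambda>x. \<nu> (ab_proj M (\<Psi> x) \<ominus>\<^bsub>?W\<^esub> L (ab_proj N x))) ` carrier N"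
    by (rule image_cong) auto
  ultimately have P: "P (restrict L (carrier ?V))" unfolding P_def using L(2) by simp
  have PD: "linear_between ?V ?W L"
    "bdd_above ((\<lambda>x. \<nu> (ab_proj M (\<Psi> x) \<ominus>\<^bsub>?W\<^esub> L (ab_proj N x))) ` carrier N)" if "P L" for L
    using that unfolding P_def by simp_all
  have pc: "ab_proj M (\<Psi> x) \<in> carrier ?W" if "x \<in> carrier N" for x using that \<Psi> by auto
  have "P (THE L. P L)"
  proof (rule theI[of P])
    show "P (restrict L (carrier ?V))" by (rule P)
    fix L' assume L': "P L'"
    show "L' = restrict L (carrier ?V)"
    proof (rule extensionalityI)
      fix U assume U: "U \<in> carrier ?V"
      show "L' U = restrict L (carrier ?V) U"
        by (rule linear_approximation_unique[OF N M.real_space_abelianization \<nu> pc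
              PD(1)[OF L'] PD(1)[OF P] PD(2)[OF L'] PD(2)[OF P] U])
    qed (use L' P in \<open>auto simp: P_def\<close>)
  qed
  moreover have "L_ab N M \<nu> \<Psi> = (THE L. P L)" unfolding L_ab_def P_def ..
  ultimately show "linear_between ?V ?W (L_ab N M \<nu> \<Psi>)"
    "bdd_above ((\<lambda>x. \<nu> (ab_proj M (\<Psi> x) \<ominus>\<^bsub>?W\<^esub> L_ab N M \<nu> \<Psi> (ab_proj N x))) ` carrier N)"
    unfolding P_def by simp_all
qed

section \<open>The induced linear map is an isomorphism\<close>

text \<open>
  A path in \<open>N\<close> approximating the ray through a kernel vector of \<open>L\<close> has linear speed, while its
  image under \<open>\<Psi>\<close> has bounded abelianization and therefore sublinear speed.
\<close>

theorem linear_approximation_injective: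
  fixes N :: "('a, 'm) monoid_scheme" and M :: "('b, 'n) monoid_scheme" and A B :: real
  assumes N: "group N" and M: "group M" and nil: "nilpotent_group M"
    and S: "finite_generating_set N S" and T: "finite_generating_set M T"
    and \<Psi>: "\<And>x. x \<in> carrier N \<Longrightarrow> \<Psi> x \<in> carrier M" and A: "A > 0"
    and lower: "\<And>x y. x \<in> carrier N \<Longrightarrow> y \<in> carrier N
      \<Longrightarrow> word_dist N S x y / A - B \<le> word_dist M T (\<Psi> x) (\<Psi> y)"
    and upper: "\<And>x y. x \<in> carrier N \<Longrightarrow> y \<in> carrier N
      \<Longrightarrow> word_dist M T (\<Psi> x) (\<Psi> y) \<le> A * word_dist N S x y + B"
    and \<nu>: "is_norm (real_abelianization M) \<nu>"
    and L: "linear_between (real_abelianization N) (real_abelianization M) L"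
    and approx: "\<And>x. x \<in> carrier N
      \<Longrightarrow> \<nu> (ab_proj M (\<Psi> x) \<ominus>\<^bsub>real_abelianization M\<^esub> L (ab_proj N x)) \<le> C0"
    and U: "U \<in> carrier (real_abelianization N)" and LU: "L U = \<zero>\<^bsub>real_abelianization M\<^esub>"
  shows "U = \<zero>\<^bsub>real_abelianization N\<^esub>"
proof -
  interpret N: group N by (rule N)
  interpret M: group M by (rule M)
  interpret A: comm_group "abelianization N" by (rule N.comm_group_abelianization)
  interpret V: real_space "real_abelianization N" by (rule N.real_space_abelianization)
  interpret W: real_space "real_abelianization M" by (rule M.real_space_abelianization)
  let ?V = "real_abelianization N" and ?W = "real_abelianization M"
  let ?WM = "\<lambda>x. real (word_length M T x)" and ?WN = "\<lambda>x. real (word_length N S x)"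
  obtain J \<psi> where J: "finite J" "J \<subseteq> carrier (abelianization N)"
    and hom: "\<And>j. j \<in> J \<Longrightarrow> \<psi> j \<in> real_hom (abelianization N)"
    and coord: "finite_coordinates ?V J (\<lambda>j. pure_tensor (abelianization N) j 1) (\<lambda>j. functional_of (\<psi> j))"
    by (rule N.real_abelianization_coordinates[OF S]) blast
  define b where "b j = pure_tensor (abelianization N) j 1" for j
  define c where "c j = functional_of (\<psi> j) U" for j
  have b: "b \<in> J \<rightarrow> carrier ?V" and expU: "U = finsum ?V (\<lambda>j. c j \<odot>\<^bsub>?V\<^esub> b j) J"
    and dual: "\<And>i j. i \<in> J \<Longrightarrow> j \<in> J \<Longrightarrow> functional_of (\<psi> j) (b i) = of_bool (i = j)"
    using coord U unfolding finite_coordinates_def b_def c_def by blast+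
  \<comment> \<open>U may have irrational coordinates. The path follows the ray through U at the
    integer points with coordinates rounded down; its increments have exponents \<lfloor>c
    j\<rfloor> or \<lfloor>c j\<rfloor> + 1, so only finitely many occur.\<close>
  define fl where "fl n j = \<lfloor>real n * c j\<rfloor>" for n j
  define e where "e n = A.int_comb J (\<lambda>j. fl (Suc n) j - fl n j)" for n
  have ec: "e n \<in> carrier (abelianization N)" for n unfolding e_def using J(2) by (rule A.int_comb_closed)
  define rep where "rep a = (SOME x. x \<in> carrier N \<and> ab_class N x = a)" for a
  have rep: "rep (e n) \<in> carrier N" "ab_class N (rep (e n)) = e n" for n
  proof -
    have "\<exists>x. x \<in> carrier N \<and> ab_class N x = e n"
      using ec[of n] unfolding N.carrier_abelianization by blast
    from someI_ex[OF this] show "rep (e n) \<in> carrier N" "ab_class N (rep (e n)) = e n"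
      unfolding rep_def by blast+
  qed
  define x where "x = rec_nat \<one>\<^bsub>N\<^esub> (\<lambda>n y. y \<otimes>\<^bsub>N\<^esub> rep (e n))"
  have x0: "x 0 = \<one>\<^bsub>N\<^esub>" and xSuc: "x (Suc n) = x n \<otimes>\<^bsub>N\<^esub> rep (e n)" for n
    unfolding x_def by simp_all
  have xc: "x n \<in> carrier N" for n by (induction n) (use rep in \<open>auto simp: x0 xSuc\<close>)
  have cl: "ab_class N (x n) = A.int_comb J (fl n)" for n
  proof (induction n)
    case 0
    have "A.int_comb J (fl 0) = A.int_comb J (\<lambda>j. 0 * fl 0 j)"
      by (rule A.int_comb_cong[OF J(2)]) (simp add: fl_def)
    also have "\<dots> = \<one>\<^bsub>abelianization N\<^esub>" unfolding A.int_comb_pow[OF J, symmetric] by simp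
    finally show ?case using group_hom.hom_one[OF N.group_hom_ab_class] by (simp add: x0)
  next
    case (Suc n)
    have "ab_class N (x (Suc n)) = A.int_comb J (fl n) \<otimes>\<^bsub>abelianization N\<^esub> e n"
      unfolding xSuc using N.ab_class_mult[OF xc[of n]] rep[of n] Suc by simp
    also have "\<dots> = A.int_comb J (\<lambda>j. fl n j + (fl (Suc n) j - fl n j))"
      unfolding e_def by (rule A.int_comb_add[OF J(2), symmetric])
    finally show ?case by simp
  qed
  have fin_e: "finite (range e)"
  proof (rule finite_subset)
    show "range e \<subseteq> A.int_comb J ` PiE J (\<lambda>j. {\<lfloor>c j\<rfloor>..\<lfloor>c j\<rfloor> + 1})"
    proof
      fix a assume "a \<in> range e"
      then obtain n where n: "a = e n" by auto
      let ?d = "restrict (\<lambda>j. fl (Suc n) j - fl n j) J"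
      have "\<lfloor>c j\<rfloor> \<le> fl (Suc n) j - fl n j \<and> fl (Suc n) j - fl n j \<le> \<lfloor>c j\<rfloor> + 1" for j
      proof -
        have "real (Suc n) * c j = real n * c j + c j" by (simp add: algebra_simps)
        then show ?thesis unfolding fl_def by (simp only:) linarith
      qed
      hence "?d \<in> PiE J (\<lambda>j. {\<lfloor>c j\<rfloor>..\<lfloor>c j\<rfloor> + 1})" by auto
      moreover have "a = A.int_comb J ?d" unfolding n e_def by (rule A.int_comb_cong[OF J(2)]) simp
      ultimately show "a \<in> A.int_comb J ` PiE J (\<lambda>j. {\<lfloor>c j\<rfloor>..\<lfloor>c j\<rfloor> + 1})" by blast
    qed
    show "finite (A.int_comb J ` PiE J (\<lambda>j. {\<lfloor>c j\<rfloor>..\<lfloor>c j\<rfloor> + 1}))"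
      by (intro finite_imageI finite_PiE J(1)) simp
  qed
  obtain R where R: "\<And>n. ?WN (rep (e n)) \<le> R"
  proof -
    have "finite ((\<lambda>a. ?WN (rep a)) ` range e)" using fin_e by (rule finite_imageI)
    then obtain R where "\<forall>r\<in>(\<lambda>a. ?WN (rep a)) ` range e. r \<le> R"
      using bdd_above_finite unfolding bdd_above_def by blast
    then show thesis using that by blast
  qed
  define y where "y n = \<Psi> (x n)" for n
  have yc: "y n \<in> carrier M" for n unfolding y_def by (rule \<Psi>[OF xc])
  have incr: "?WM (inv\<^bsub>M\<^esub> y a \<otimes>\<^bsub>M\<^esub> y (Suc a)) \<le> A * R + B" for a
  proof -
    have "rep (e a) \<in> carrier N" by (rule rep)
    then have "inv\<^bsub>N\<^esub> x a \<otimes>\<^bsub>N\<^esub> x (Suc a) = rep (e a)"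
      unfolding xSuc using xc[of a] by (simp add: N.m_assoc[symmetric])
    then have "word_dist N S (x a) (x (Suc a)) \<le> R" unfolding word_dist_def using R by simp
    then have "A * word_dist N S (x a) (x (Suc a)) + B \<le> A * R + B" using A by simp
    with upper[OF xc[of a] xc[of "Suc a"]] show ?thesis unfolding word_dist_def y_def by linarith
  qed
  \<comment> \<open>L annihilates U, so along the path only the rounding error contributes:
    multiples of the vectors L (b j) by numbers of absolute value at most 1. C0 is the approximation
    error of L.\<close>
  define R' where "R' = C0 + (\<Sum>j\<in>J. \<nu> (L (b j)))"
  have bounded: "\<nu> (ab_proj M (y n)) \<le> R'" for n
  proof -
    let ?p = "ab_proj N (x n)"
    define D where "D = finsum ?V (\<lambda>j. (of_int (fl n j) - real n * c j) \<odot>\<^bsub>?V\<^esub> b j) J"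
    have Dt: "(\<lambda>j. (of_int (fl n j) - real n * c j) \<odot>\<^bsub>?V\<^esub> b j) \<in> J \<rightarrow> carrier ?V" using b by auto
    have Dc: "D \<in> carrier ?V" unfolding D_def by (rule V.finsum_closed[OF Dt])
    have "?p = finsum ?V (\<lambda>j. of_int (fl n j) \<odot>\<^bsub>?V\<^esub> b j) J"
      unfolding ab_proj_eq cl b_def by (rule A.pure_tensor_int_comb[OF J])
    also have "\<dots> = finsum ?V (\<lambda>j. ((of_int (fl n j) - real n * c j) + real n * c j) \<odot>\<^bsub>?V\<^esub> b j) J"
      by (simp only: diff_add_cancel)
    also have "\<dots> = D \<oplus>\<^bsub>?V\<^esub> finsum ?V (\<lambda>j. (real n * c j) \<odot>\<^bsub>?V\<^esub> b j) J"
      unfolding D_def by (rule V.finsum_smult_distrib[OF b])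
    also have "finsum ?V (\<lambda>j. (real n * c j) \<odot>\<^bsub>?V\<^esub> b j) J = real n \<odot>\<^bsub>?V\<^esub> U"
      unfolding V.finsum_smult_scale[OF J(1) b] using expU by simp
    finally have p_eq: "?p = D \<oplus>\<^bsub>?V\<^esub> real n \<odot>\<^bsub>?V\<^esub> U" .
    have "L ?p = L D \<oplus>\<^bsub>?W\<^esub> real n \<odot>\<^bsub>?W\<^esub> L U"
      unfolding p_eq linear_betweenD(2)[OF L Dc V.smult_closed[OF U]] linear_betweenD(3)[OF L U] ..
    also have "\<dots> = L D" unfolding LU using linear_betweenD(1)[OF L Dc] by simp
    also have "L D = finsum ?W (\<lambda>j. L ((of_int (fl n j) - real n * c j) \<odot>\<^bsub>?V\<^esub> b j)) J"
      unfolding D_def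
      by (rule linear_between_finsum[OF N.real_space_abelianization M.real_space_abelianization L J(1) Dt])
    finally have "\<nu> (L ?p) \<le> (\<Sum>j\<in>J. \<nu> (L ((of_int (fl n j) - real n * c j) \<odot>\<^bsub>?V\<^esub> b j)))"
      using W.norm_finsum_le[OF \<nu> J(1), of "\<lambda>j. L ((of_int (fl n j) - real n * c j) \<odot>\<^bsub>?V\<^esub> b j)"]
        linear_betweenD(1)[OF L] Dt by (simp add: Pi_def)
    also have "\<dots> \<le> (\<Sum>j\<in>J. \<nu> (L (b j)))"
    proof (rule sum_mono)
      fix j assume j: "j \<in> J"
      have bj: "b j \<in> carrier ?V" using b j by auto
      note Lbj = linear_betweenD(1)[OF L bj]
      have "\<nu> (L ((of_int (fl n j) - real n * c j) \<odot>\<^bsub>?V\<^esub> b j)) = \<bar>of_int (fl n j) - real n * c j\<bar> * \<nu> (L (b j))"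
        unfolding linear_betweenD(3)[OF L bj] by (rule is_normD(3)[OF \<nu> Lbj])
      also have "\<dots> \<le> 1 * \<nu> (L (b j))"
      proof (rule mult_right_mono[OF _ is_normD(1)[OF \<nu> Lbj]])
        show "\<bar>of_int (fl n j) - real n * c j\<bar> \<le> 1" unfolding fl_def by linarith
      qed
      finally show "\<nu> (L ((of_int (fl n j) - real n * c j) \<odot>\<^bsub>?V\<^esub> b j)) \<le> \<nu> (L (b j))" by simp
    qed
    finally have "\<nu> (L ?p) \<le> (\<Sum>j\<in>J. \<nu> (L (b j)))" .
    moreover have "\<nu> (ab_proj M (y n)) \<le> \<nu> (ab_proj M (y n) \<ominus>\<^bsub>?W\<^esub> L ?p) + \<nu> (L ?p)"
      by (rule W.norm_triangle_sub[OF \<nu> M.ab_proj_closed[OF yc] linear_betweenD(1)[OF L N.ab_proj_closed[OF xc]]])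
    moreover have "\<nu> (ab_proj M (y n) \<ominus>\<^bsub>?W\<^esub> L ?p) \<le> C0" unfolding y_def by (rule approx[OF xc])
    ultimately show ?thesis unfolding R'_def by linarith
  qed
  have base: "\<exists>m>0. \<forall>a. quotient_length M ?WM (derived M (carrier M)) (inv\<^bsub>M\<^esub> y a \<otimes>\<^bsub>M\<^esub> y (a + m)) < \<epsilon> * real m"
    if "\<epsilon> > 0" for \<epsilon>
  proof -
    obtain I \<xi> where I: "finite I" "I \<subseteq> carrier (abelianization M)"
      and \<xi>: "\<And>i. i \<in> I \<Longrightarrow> \<xi> i \<in> real_hom (abelianization M)"
      and coordM: "finite_coordinates ?W I (\<lambda>j. pure_tensor (abelianization M) j 1) (\<lambda>j. functional_of (\<xi> j))"
      and len: "\<And>L. length_function M L \<Longrightarrow> \<exists>C. \<forall>x\<in>carrier M. quotient_length M L (derived M (carrier M)) x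
        \<le> C * (1 + (\<Sum>i\<in>I. \<bar>\<xi> i (ab_class M x)\<bar>))"
      by (rule M.real_abelianization_coordinates[OF T], rule that) (assumption | rule meta_mp)+
    obtain C where C: "\<forall>x\<in>carrier M. quotient_length M ?WM (derived M (carrier M)) x
        \<le> C * (1 + (\<Sum>i\<in>I. \<bar>\<xi> i (ab_class M x)\<bar>))" using len[OF M.length_function_word_length[OF T]] by blast
    obtain K where K: "K \<ge> 0" "\<And>i Z. i \<in> I \<Longrightarrow> Z \<in> carrier ?W \<Longrightarrow> \<bar>functional_of (\<xi> i) Z\<bar> \<le> K * \<nu> Z"
      using W.coordinates_bounded_by_norm[OF coordM \<nu>] by blast
    \<comment> \<open>A bound for the length modulo the derived subgroup of any increment of y,
      however long; it lies below \<epsilon> * m for all large m. The absolute value guards against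
      a negative C.\<close>
    define Q where "Q = \<bar>C\<bar> * (1 + (\<Sum>i\<in>I. K * (2 * R')))"
    have ql: "quotient_length M ?WM (derived M (carrier M)) (inv\<^bsub>M\<^esub> y a \<otimes>\<^bsub>M\<^esub> y a') \<le> Q" for a a'
    proof -
      let ?z = "inv\<^bsub>M\<^esub> y a \<otimes>\<^bsub>M\<^esub> y a'"
      have z: "?z \<in> carrier M" using yc by simp
      have "\<nu> (ab_proj M ?z) \<le> 2 * R'"
        using M.length_function_left_quotient[OF M.length_function_norm[OF \<nu>] yc[of a] yc[of a']]
          bounded[of a] bounded[of a'] by linarith
      hence \<xi>z: "\<bar>\<xi> i (ab_class M ?z)\<bar> \<le> K * (2 * R')" if i: "i \<in> I" for i
        using K(2)[OF i M.ab_proj_closed[OF z]] mult_left_mono[OF _ K(1)]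
        unfolding M.additive_functional_ab_class[OF \<xi>[OF i] z] by (meson order_trans)
      have "quotient_length M ?WM (derived M (carrier M)) ?z \<le> C * (1 + (\<Sum>i\<in>I. \<bar>\<xi> i (ab_class M ?z)\<bar>))"
        using C z by blast
      also have "\<dots> \<le> \<bar>C\<bar> * (1 + (\<Sum>i\<in>I. \<bar>\<xi> i (ab_class M ?z)\<bar>))"
        by (rule mult_right_mono) (auto intro: add_nonneg_nonneg sum_nonneg)
      also have "\<dots> \<le> Q" unfolding Q_def
        by (intro mult_left_mono add_left_mono sum_mono \<xi>z) auto
      finally show ?thesis .
    qed
    obtain m :: nat where m: "Q / \<epsilon> < m" using reals_Archimedean2 by blast
    have "Q < \<epsilon> * real (Suc m)" using m \<open>\<epsilon> > 0\<close> by (simp add: field_simps)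
    then have "\<forall>a. quotient_length M ?WM (derived M (carrier M)) (inv\<^bsub>M\<^esub> y a \<otimes>\<^bsub>M\<^esub> y (a + Suc m)) < \<epsilon> * real (Suc m)"
      using ql by (meson le_less_trans)
    then show ?thesis by (intro exI[of _ "Suc m"]) simp
  qed
  have c0: "c j = 0" if j: "j \<in> J" for j
  proof (rule ccontr)
    assume cj: "c j \<noteq> 0"
    obtain K where K: "K > 0" "\<And>z. z \<in> carrier N \<Longrightarrow> \<bar>\<psi> j (ab_class N z)\<bar> \<le> K * ?WN z"
      using N.length_function_le_word_length[OF N.length_function_abs_hom[OF hom[OF j]] S] by blast
    \<comment> \<open>Chosen so that K * A * \<epsilon> is half of the absolute value of c j. If the
      image path has speed at most \<epsilon>, coordinate j of the path in N grows at no more than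
      half the rate that its rounded values prescribe.\<close>
    define \<epsilon> where "\<epsilon> = \<bar>c j\<bar> / (2 * K * A)"
    have \<epsilon>: "\<epsilon> > 0" unfolding \<epsilon>_def using cj K A by simp
    obtain m where m: "m > 0" "\<And>k. ?WM (inv\<^bsub>M\<^esub> y 0 \<otimes>\<^bsub>M\<^esub> y (k * m)) \<le> \<epsilon> * real (k * m)"
      using M.sublinear_path[OF nil T yc incr base \<epsilon>] by blast
    have "real m * c j / 2 = 0"
    proof (rule eq_0_if_multiples_bounded)
      fix k :: nat
      let ?n = "k * m"
      have "\<psi> j (ab_class N (x ?n)) = of_int (fl ?n j)"
      proof -
        have "\<psi> j (A.int_comb J (fl ?n)) = (\<Sum>i\<in>J. fl ?n i * \<psi> j i)"
          by (rule A.real_hom_int_comb[OF hom[OF j] J])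
        also have "\<dots> = (\<Sum>i\<in>J. if i = j then real_of_int (fl ?n j) else 0)"
        proof (rule sum.cong)
          fix i assume i: "i \<in> J"
          have "\<psi> j i = of_bool (i = j)"
            using dual[OF i j] A.functional_of_pure[OF hom[OF j] subsetD[OF J(2) i], of 1] unfolding b_def by simp
          then show "fl ?n i * \<psi> j i = (if i = j then real_of_int (fl ?n j) else 0)" by simp
        qed simp
        finally show ?thesis unfolding cl using J j by simp
      qed
      hence "\<bar>real_of_int (fl ?n j)\<bar> \<le> K * ?WN (x ?n)" using K(2)[OF xc, of ?n] by simp
      moreover have "\<bar>real ?n * c j\<bar> - 1 \<le> \<bar>real_of_int (fl ?n j)\<bar>" unfolding fl_def by linarith
      moreover have "?WN (x ?n) \<le> A * (\<epsilon> * real ?n + B)"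
      proof -
        have "?WN (x ?n) / A - B \<le> \<epsilon> * real ?n"
          using lower[OF xc[of 0] xc[of ?n]] m(2)[of k] xc[of ?n] unfolding word_dist_def y_def x0 by simp
        then show ?thesis using A by (simp add: field_simps)
      qed
      hence "K * ?WN (x ?n) \<le> K * (A * (\<epsilon> * real ?n + B))" using K(1) by simp
      moreover have "K * (A * (\<epsilon> * real ?n + B)) = \<bar>real ?n * c j\<bar> / 2 + K * A * B"
        unfolding \<epsilon>_def using K(1) A by (simp add: field_simps abs_mult)
      ultimately have "\<bar>real ?n * c j\<bar> / 2 \<le> 1 + K * A * B" by linarith
      then show "real k * \<bar>real m * c j / 2\<bar> \<le> 1 + K * A * B" by (simp add: abs_mult mult.assoc)
    qed
    then show False using m(1) cj by simp
  qed
  have "U = finsum ?V (\<lambda>j. (0 * c j) \<odot>\<^bsub>?V\<^esub> b j) J"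
    by (subst expU, rule V.finsum_cong') (use c0 b in auto)
  also have "\<dots> = 0 \<odot>\<^bsub>?V\<^esub> U" unfolding V.finsum_smult_scale[OF J(1) b] using expU by simp
  finally show ?thesis using U by simp
qed

text \<open>
  For surjectivity, pull the norm back along the injective map \<open>L\<close>: with respect to this norm a coarse
  inverse of \<open>\<Psi>\<close> has bounded abelian defect, and its linear approximation is a right inverse of \<open>L\<close>.
\<close>

theorem linear_approximation_surjective:
  fixes N :: "('a, 'm) monoid_scheme" and M :: "('b, 'n) monoid_scheme" and B :: real
  assumes N: "group N" and M: "group M" and nil: "nilpotent_group M"
    and S: "finite_generating_set N S" and T: "finite_generating_set M T"
    and \<Psi>: "\<And>x. x \<in> carrier N \<Longrightarrow> \<Psi> x \<in> carrier M"
    and coarse: "\<And>z. z \<in> carrier M \<Longrightarrow> \<exists>x\<in>carrier N. word_dist M T (\<Psi> x) z \<le> B"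
    and \<nu>: "is_norm (real_abelianization M) \<nu>"
    and L: "linear_between (real_abelianization N) (real_abelianization M) L"
    and approx: "\<And>x. x \<in> carrier N
      \<Longrightarrow> \<nu> (ab_proj M (\<Psi> x) \<ominus>\<^bsub>real_abelianization M\<^esub> L (ab_proj N x)) \<le> C0"
    and inj: "\<And>U. U \<in> carrier (real_abelianization N) \<Longrightarrow> L U = \<zero>\<^bsub>real_abelianization M\<^esub>
      \<Longrightarrow> U = \<zero>\<^bsub>real_abelianization N\<^esub>"
    and Z: "Z \<in> carrier (real_abelianization M)"
  shows "Z \<in> L ` carrier (real_abelianization N)"
proof -
  interpret N: group N by (rule N)
  interpret M: group M by (rule M)
  interpret V: real_space "real_abelianization N" by (rule N.real_space_abelianization)
  interpret W: real_space "real_abelianization M" by (rule M.real_space_abelianization)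
  let ?V = "real_abelianization N" and ?W = "real_abelianization M"
  note Lc = linear_betweenD(1)[OF L]
  have L0: "L \<zero>\<^bsub>?V\<^esub> = \<zero>\<^bsub>?W\<^esub>" by (rule linear_between_zero[OF N.real_space_abelianization M.real_space_abelianization L])
  have \<nu>': "is_norm ?V (\<lambda>U. \<nu> (L U))"
    unfolding is_norm_def
  proof (intro conjI ballI allI)
    fix x assume x: "x \<in> carrier ?V"
    show "0 \<le> \<nu> (L x)" by (rule is_normD(1)[OF \<nu> Lc[OF x]])
    show "\<nu> (L x) = 0 \<longleftrightarrow> x = \<zero>\<^bsub>?V\<^esub>" using is_normD(2)[OF \<nu> Lc[OF x]] inj[OF x] L0 by auto
    show "\<nu> (L (r \<odot>\<^bsub>?V\<^esub> x)) = \<bar>r\<bar> * \<nu> (L x)" for r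
      unfolding linear_betweenD(3)[OF L x] by (rule is_normD(3)[OF \<nu> Lc[OF x]])
    fix y assume y: "y \<in> carrier ?V"
    show "\<nu> (L (x \<oplus>\<^bsub>?V\<^esub> y)) \<le> \<nu> (L x) + \<nu> (L y)"
      unfolding linear_betweenD(2)[OF L x y] by (rule is_normD(4)[OF \<nu> Lc[OF x] Lc[OF y]])
  qed
  obtain K where K: "K > 0" "\<And>z. z \<in> carrier M \<Longrightarrow> \<nu> (ab_proj M z) \<le> K * real (word_length M T z)"
    using M.length_function_le_word_length[OF M.length_function_norm[OF \<nu>] T] by blast
  obtain \<Theta> where \<Theta>: "\<And>z. z \<in> carrier M \<Longrightarrow> \<Theta> z \<in> carrier N"
    "\<And>z. z \<in> carrier M \<Longrightarrow> word_dist M T (\<Psi> (\<Theta> z)) z \<le> B"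
    using coarse by metis
  \<comment> \<open>K * B accounts for the passage from z to \<Psi> (\<Theta> z), at word distance
    at most B, and C0 for the approximation of the latter by L.\<close>
  define D where "D = C0 + K * B"
  have near: "\<nu> (ab_proj M z \<ominus>\<^bsub>?W\<^esub> L (ab_proj N (\<Theta> z))) \<le> D" if z: "z \<in> carrier M" for z
  proof -
    let ?p = "\<Psi> (\<Theta> z)"
    have p: "?p \<in> carrier M" by (rule \<Psi>[OF \<Theta>(1)[OF z]])
    have "\<nu> (ab_proj M z \<ominus>\<^bsub>?W\<^esub> ab_proj M ?p) = \<nu> (ab_proj M (inv\<^bsub>M\<^esub> ?p \<otimes>\<^bsub>M\<^esub> z))"
      using p z by (simp add: M.ab_proj_mult M.ab_proj_inv W.minus_eq W.a_comm)
    also have "\<dots> \<le> K * word_dist M T ?p z" unfolding word_dist_def by (rule K(2)) (use p z in simp)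
    also have "\<dots> \<le> K * B" using K(1) \<Theta>(2)[OF z] by simp
    finally have "\<nu> (ab_proj M z \<ominus>\<^bsub>?W\<^esub> ab_proj M ?p) \<le> K * B" .
    moreover have "\<nu> (ab_proj M ?p \<ominus>\<^bsub>?W\<^esub> L (ab_proj N (\<Theta> z))) \<le> C0" by (rule approx[OF \<Theta>(1)[OF z]])
    moreover have "\<nu> (ab_proj M z \<ominus>\<^bsub>?W\<^esub> L (ab_proj N (\<Theta> z)))
        \<le> \<nu> (ab_proj M z \<ominus>\<^bsub>?W\<^esub> ab_proj M ?p) + \<nu> (ab_proj M ?p \<ominus>\<^bsub>?W\<^esub> L (ab_proj N (\<Theta> z)))"
      by (rule W.norm_diff_triangle[OF \<nu> M.ab_proj_closed[OF z] M.ab_proj_closed[OF p] Lc[OF N.ab_proj_closed[OF \<Theta>(1)[OF z]]]])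
    ultimately show ?thesis unfolding D_def by linarith
  qed
  have defect: "bounded_abelian_defect M N (\<lambda>U. \<nu> (L U)) \<Theta>"
    unfolding bounded_abelian_defect_def
  proof (rule bdd_aboveI2, clarify)
    fix a b assume a: "a \<in> carrier M" and b: "b \<in> carrier M"
    let ?P = "\<lambda>z. ab_proj N (\<Theta> z)"
    have ab: "a \<otimes>\<^bsub>M\<^esub> b \<in> carrier M" using a b by simp
    have Pc: "?P z \<in> carrier ?V" if "z \<in> carrier M" for z by (rule N.ab_proj_closed[OF \<Theta>(1)[OF that]])
    note LP = Lc[OF Pc]
    note linear_diff = linear_between_diff[OF N.real_space_abelianization M.real_space_abelianization L]
    have "L (?P (a \<otimes>\<^bsub>M\<^esub> b) \<ominus>\<^bsub>?V\<^esub> ?P a \<ominus>\<^bsub>?V\<^esub> ?P b)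
        = L (?P (a \<otimes>\<^bsub>M\<^esub> b)) \<ominus>\<^bsub>?W\<^esub> (L (?P a) \<oplus>\<^bsub>?W\<^esub> L (?P b))"
      unfolding V.diff_diff_eq[OF Pc[OF ab] Pc[OF a] Pc[OF b]]
        linear_diff[OF Pc[OF ab] V.a_closed[OF Pc[OF a] Pc[OF b]]] linear_betweenD(2)[OF L Pc[OF a] Pc[OF b]] ..
    also have "\<nu> \<dots> \<le> \<nu> (L (?P (a \<otimes>\<^bsub>M\<^esub> b)) \<ominus>\<^bsub>?W\<^esub> ab_proj M (a \<otimes>\<^bsub>M\<^esub> b))
        + \<nu> (ab_proj M (a \<otimes>\<^bsub>M\<^esub> b) \<ominus>\<^bsub>?W\<^esub> (L (?P a) \<oplus>\<^bsub>?W\<^esub> L (?P b)))"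
      by (rule W.norm_diff_triangle[OF \<nu> LP[OF ab] M.ab_proj_closed[OF ab] W.a_closed[OF LP[OF a] LP[OF b]]])
    also have "\<nu> (L (?P (a \<otimes>\<^bsub>M\<^esub> b)) \<ominus>\<^bsub>?W\<^esub> ab_proj M (a \<otimes>\<^bsub>M\<^esub> b)) \<le> D"
      unfolding W.norm_diff_commute[OF \<nu> LP[OF ab] M.ab_proj_closed[OF ab]] by (rule near[OF ab])
    also have "\<nu> (ab_proj M (a \<otimes>\<^bsub>M\<^esub> b) \<ominus>\<^bsub>?W\<^esub> (L (?P a) \<oplus>\<^bsub>?W\<^esub> L (?P b)))
        \<le> \<nu> (ab_proj M a \<ominus>\<^bsub>?W\<^esub> L (?P a)) + \<nu> (ab_proj M b \<ominus>\<^bsub>?W\<^esub> L (?P b))"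
      unfolding M.ab_proj_mult[OF a b]
      by (rule W.norm_add_diff_le[OF \<nu> M.ab_proj_closed[OF a] M.ab_proj_closed[OF b] LP[OF a] LP[OF b]])
    also have "\<dots> \<le> D + D" by (rule add_mono[OF near[OF a] near[OF b]])
    finally show "\<nu> (L (?P (a \<otimes>\<^bsub>M\<^esub> b) \<ominus>\<^bsub>?V\<^esub> ?P a \<ominus>\<^bsub>?V\<^esub> ?P b)) \<le> D + (D + D)" by simp
  qed
  have \<Theta>f: "\<Theta> \<in> carrier M \<rightarrow> carrier N" using \<Theta>(1) by (rule funcsetI)
  obtain L' where L': "linear_between ?W ?V L'"
    and bd: "bdd_above ((\<lambda>z. \<nu> (L (ab_proj N (\<Theta> z) \<ominus>\<^bsub>?V\<^esub> L' (ab_proj M z)))) ` carrier M)"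
    by (rule linear_approximation_exists[OF M nil N S \<Theta>f \<nu>' defect])
  obtain E where E: "\<And>z. z \<in> carrier M \<Longrightarrow> \<nu> (L (ab_proj N (\<Theta> z) \<ominus>\<^bsub>?V\<^esub> L' (ab_proj M z))) \<le> E"
    using bd unfolding bdd_above_def by auto
  \<comment> \<open>The composition of L with L' and the identity both approximate the projection of
    M with bounded error, so uniqueness of linear approximations identifies them.\<close>
  have "L (L' Z) = Z"
  proof (rule linear_approximation_unique[OF M M.real_space_abelianization \<nu> _ _ _ _ _ Z])
    show "ab_proj M z \<in> carrier ?W" if "z \<in> carrier M" for z by (rule M.ab_proj_closed[OF that])
    show "linear_between ?W ?W (\<lambda>U. L (L' U))" by (rule linear_between_compose[OF L L'])
    show "linear_between ?W ?W (\<lambda>U. U)" unfolding linear_between_def by auto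
    show "bdd_above ((\<lambda>z. \<nu> (ab_proj M z \<ominus>\<^bsub>?W\<^esub> L (L' (ab_proj M z)))) ` carrier M)"
    proof (rule bdd_aboveI2)
      fix z assume z: "z \<in> carrier M"
      note c = N.ab_proj_closed[OF \<Theta>(1)[OF z]] linear_betweenD(1)[OF L' M.ab_proj_closed[OF z]]
      have "\<nu> (ab_proj M z \<ominus>\<^bsub>?W\<^esub> L (L' (ab_proj M z))) \<le> \<nu> (ab_proj M z \<ominus>\<^bsub>?W\<^esub> L (ab_proj N (\<Theta> z)))
          + \<nu> (L (ab_proj N (\<Theta> z)) \<ominus>\<^bsub>?W\<^esub> L (L' (ab_proj M z)))"
        by (rule W.norm_diff_triangle[OF \<nu> M.ab_proj_closed[OF z] Lc[OF c(1)] Lc[OF c(2)]])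
      also have "\<dots> \<le> D + E"
        unfolding linear_between_diff[OF N.real_space_abelianization M.real_space_abelianization L c, symmetric]
        by (rule add_mono[OF near[OF z] E[OF z]])
      finally show "\<nu> (ab_proj M z \<ominus>\<^bsub>?W\<^esub> L (L' (ab_proj M z))) \<le> D + E" .
    qed
    show "bdd_above ((\<lambda>z. \<nu> (ab_proj M z \<ominus>\<^bsub>?W\<^esub> ab_proj M z)) ` carrier M)"
    proof (rule bdd_aboveI2)
      fix z assume z: "z \<in> carrier M"
      show "\<nu> (ab_proj M z \<ominus>\<^bsub>?W\<^esub> ab_proj M z) \<le> 0"
        using is_normD(2)[OF \<nu> W.zero_closed] M.ab_proj_closed[OF z] by (simp add: W.minus_eq W.r_neg)
    qed
  qed
  then show ?thesis using linear_betweenD(1)[OF L' Z] by (metis image_eqI)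
qed

section \<open>Coarse harmonic coordinates\<close>

text \<open>A linear functional on a finite-dimensional space is bounded by any norm, so the bounded
  error of L passes to each coordinate. Additivity is recorded for the passage to G and H, where
  corrections from a finite set are split off.\<close>

theorem transported_functional:
  assumes N: "group N" and nilN: "nilpotent_group N" and M: "group M" and nilM: "nilpotent_group M"
    and qi: "quasi_isometry N M \<Psi>" and \<nu>: "is_norm (real_abelianization M) \<nu>"
    and def: "bounded_abelian_defect N M \<nu> \<Psi>" and \<phi>: "\<phi> \<in> real_hom (abelianization N)"
  defines "\<theta> \<equiv> functional_of (T_map N M \<nu> \<Psi> \<phi>)"
  shows "\<exists>C. \<forall>x\<in>carrier N. \<bar>\<theta> (ab_proj M (\<Psi> x)) - functional_of \<phi> (ab_proj N x)\<bar> \<le> C"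
    and "\<And>a b. a \<in> carrier M \<Longrightarrow> b \<in> carrier M
      \<Longrightarrow> \<theta> (ab_proj M (a \<otimes>\<^bsub>M\<^esub> b)) = \<theta> (ab_proj M a) + \<theta> (ab_proj M b)"
proof -
  interpret N: group N by (rule N)
  interpret M: group M by (rule M)
  interpret A: comm_group "abelianization N" by (rule N.comm_group_abelianization)
  interpret AM: comm_group "abelianization M" by (rule M.comm_group_abelianization)
  interpret V: real_space "real_abelianization N" by (rule N.real_space_abelianization)
  interpret W: real_space "real_abelianization M" by (rule M.real_space_abelianization)
  let ?V = "real_abelianization N" and ?W = "real_abelianization M"
  obtain S T and A B :: real where \<Psi>: "\<Psi> \<in> carrier N \<rightarrow> carrier M"
    and S: "finite_generating_set N S" and T: "finite_generating_set M T" and A: "A \<ge> 1"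
    and dist: "\<forall>x\<in>carrier N. \<forall>y\<in>carrier N.
         word_dist N S x y / A - B \<le> word_dist M T (\<Psi> x) (\<Psi> y) \<and>
         word_dist M T (\<Psi> x) (\<Psi> y) \<le> A * word_dist N S x y + B"
    and coarse: "\<forall>z\<in>carrier M. \<exists>x\<in>carrier N. word_dist M T (\<Psi> x) z \<le> B"
    using qi unfolding quasi_isometry_def by blast
  have \<Psi>c: "\<Psi> x \<in> carrier M" if "x \<in> carrier N" for x using \<Psi> that by auto
  define L where "L = L_ab N M \<nu> \<Psi>"
  have L: "linear_between ?V ?W L" unfolding L_def by (rule L_ab_approximates[OF N nilN M T \<Psi> \<nu> def])
  have "bdd_above ((\<lambda>x. \<nu> (ab_proj M (\<Psi> x) \<ominus>\<^bsub>?W\<^esub> L (ab_proj N x))) ` carrier N)"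
    unfolding L_def by (rule L_ab_approximates[OF N nilN M T \<Psi> \<nu> def])
  then obtain C0 where approx: "\<And>x. x \<in> carrier N \<Longrightarrow> \<nu> (ab_proj M (\<Psi> x) \<ominus>\<^bsub>?W\<^esub> L (ab_proj N x)) \<le> C0"
    unfolding bdd_above_def by auto
  note Lc = linear_betweenD(1)[OF L]
  have ker: "U = \<zero>\<^bsub>?V\<^esub>" if "U \<in> carrier ?V" "L U = \<zero>\<^bsub>?W\<^esub>" for U
    by (rule linear_approximation_injective[OF N M nilM S T \<Psi>c _ _ _ \<nu> L approx that, where A = A and B = B])
      (use A dist in auto)
  have surj: "Z \<in> L ` carrier ?V" if "Z \<in> carrier ?W" for Z
    by (rule linear_approximation_surjective[OF N M nilM S T \<Psi>c _ \<nu> L approx ker that, where B = B])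
      (use coarse in simp_all)
  have inj: "inj_on L (carrier ?V)"
  proof (rule inj_onI)
    fix x y assume xy: "x \<in> carrier ?V" "y \<in> carrier ?V" "L x = L y"
    have "L (x \<ominus>\<^bsub>?V\<^esub> y) = L x \<ominus>\<^bsub>?W\<^esub> L y"
      by (rule linear_between_diff[OF N.real_space_abelianization M.real_space_abelianization L xy(1,2)])
    also have "\<dots> = \<zero>\<^bsub>?W\<^esub>" using xy Lc[OF xy(2)] by (simp add: W.minus_eq W.r_neg)
    finally have "x \<ominus>\<^bsub>?V\<^esub> y = \<zero>\<^bsub>?V\<^esub>" using xy by (intro ker) auto
    then show "x = y" by (rule V.diff_eq_zeroD[OF _ xy(1,2)])
  qed
  define K where "K = inv_into (carrier ?V) L"
  have Kc: "K Z \<in> carrier ?V" and LK: "L (K Z) = Z" if "Z \<in> carrier ?W" for Z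
    unfolding K_def by (rule inv_into_into[OF surj[OF that]], rule f_inv_into_f[OF surj[OF that]])
  have KL: "K (L U) = U" if "U \<in> carrier ?V" for U
    unfolding K_def by (rule inv_into_f_f[OF inj that])
  define \<tau> where "\<tau> Z = functional_of \<phi> (K Z)" for Z
  have \<tau>: "linear_functional ?W \<tau>"
    unfolding linear_functional_def
  proof (intro conjI ballI allI)
    note lin = linear_functionalD[OF A.linear_functional_of[OF \<phi>]]
    fix x assume x: "x \<in> carrier ?W"
    \<comment> \<open>Linearity of the inverse: the argument is rewritten as a value of L, where K
      cancels.\<close>
    have "K (r \<odot>\<^bsub>?W\<^esub> x) = K (L (r \<odot>\<^bsub>?V\<^esub> K x))" for r
      unfolding linear_betweenD(3)[OF L Kc[OF x]] LK[OF x] ..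
    then show "\<tau> (r \<odot>\<^bsub>?W\<^esub> x) = r * \<tau> x" for r
      unfolding \<tau>_def using KL[OF V.smult_closed[OF Kc[OF x]]] lin(2)[OF Kc[OF x]] by simp
    fix y assume y: "y \<in> carrier ?W"
    have "K (x \<oplus>\<^bsub>?W\<^esub> y) = K (L (K x \<oplus>\<^bsub>?V\<^esub> K y))"
      unfolding linear_betweenD(2)[OF L Kc[OF x] Kc[OF y]] LK[OF x] LK[OF y] ..
    then show "\<tau> (x \<oplus>\<^bsub>?W\<^esub> y) = \<tau> x + \<tau> y"
      unfolding \<tau>_def using KL[OF V.a_closed[OF Kc[OF x] Kc[OF y]]] lin(1)[OF Kc[OF x] Kc[OF y]] by simp
  qed
  have T_map: "T_map N M \<nu> \<Psi> \<phi> a = \<tau> (pure_tensor (abelianization M) a 1)" for a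
    unfolding T_map_def \<tau>_def K_def L_def ..
  have hom: "T_map N M \<nu> \<Psi> \<phi> \<in> real_hom (abelianization M)"
    unfolding real_hom_def T_map
    using AM.pure_tensor_add_left linear_functionalD(1)[OF \<tau>] AM.pure_tensor_carrier by auto
  \<comment> \<open>\<open>T_map\<close> yields a function on the abelianization, and
    \<open>functional_of\<close> extends it again to the tensor product. Agreement with \<tau> is
    checked on the projections of elements of M, the points at which the conclusions evaluate
    \<theta>.\<close>
  have \<theta>: "\<theta> (ab_proj M z) = \<tau> (ab_proj M z)" if "z \<in> carrier M" for z
    unfolding \<theta>_def M.additive_functional_ab_class[OF hom that] by (simp only: T_map ab_proj_eq)
  show "\<theta> (ab_proj M (a \<otimes>\<^bsub>M\<^esub> b)) = \<theta> (ab_proj M a) + \<theta> (ab_proj M b)"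
    if a: "a \<in> carrier M" and b: "b \<in> carrier M" for a b
    unfolding \<theta>[OF a] \<theta>[OF b] \<theta>[OF M.m_closed[OF a b]]
    using linear_functionalD(1)[OF \<tau> M.ab_proj_closed[OF a] M.ab_proj_closed[OF b]] M.ab_proj_mult[OF a b]
    by simp
  obtain J \<psi> where coord: "finite_coordinates ?W J
      (\<lambda>j. pure_tensor (abelianization M) j 1) (\<lambda>j. functional_of (\<psi> j))"
    by (rule M.real_abelianization_coordinates[OF T]) blast
  obtain E where E: "E \<ge> 0" "\<And>Z. Z \<in> carrier ?W \<Longrightarrow> \<bar>\<tau> Z\<bar> \<le> E * \<nu> Z"
    using W.linear_functional_bounded_by_norm[OF coord \<nu> \<tau>] by blast
  have "\<bar>\<theta> (ab_proj M (\<Psi> x)) - functional_of \<phi> (ab_proj N x)\<bar> \<le> E * C0" if x: "x \<in> carrier N" for x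
  proof -
    note c = M.ab_proj_closed[OF \<Psi>c[OF x]] Lc[OF N.ab_proj_closed[OF x]]
    have "functional_of \<phi> (ab_proj N x) = \<tau> (L (ab_proj N x))"
      unfolding \<tau>_def KL[OF N.ab_proj_closed[OF x]] ..
    then have "\<theta> (ab_proj M (\<Psi> x)) - functional_of \<phi> (ab_proj N x) = \<tau> (ab_proj M (\<Psi> x) \<ominus>\<^bsub>?W\<^esub> L (ab_proj N x))"
      unfolding \<theta>[OF \<Psi>c[OF x]] W.linear_functional_diff[OF \<tau> c] by simp
    also have "\<bar>\<dots>\<bar> \<le> E * \<nu> (ab_proj M (\<Psi> x) \<ominus>\<^bsub>?W\<^esub> L (ab_proj N x))"
      by (rule E(2)) (use c in simp)
    also have "\<dots> \<le> E * C0" by (rule mult_left_mono[OF approx[OF x] E(1)])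
    finally show ?thesis .
  qed
  then show "\<exists>C. \<forall>x\<in>carrier N. \<bar>\<theta> (ab_proj M (\<Psi> x)) - functional_of \<phi> (ab_proj N x)\<bar> \<le> C" by blast
qed

context group
begin

text \<open>Disjointness of the cosets determines the index and cancellation then determines n, so
  the definite description in \<open>extend_by_cosets\<close> denotes n.\<close>

lemma extend_by_cosets_eq:
  assumes N: "subgroup N G" and dec: "coset_decomposition G N k g"
    and n: "n \<in> N" and j: "j \<in> {1..k}"
  shows "extend_by_cosets G N k g F (n \<otimes> g j) = F n"
proof -
  have gc: "g i \<in> carrier G" if "i \<in> {1..k}" for i using dec that unfolding coset_decomposition_def by blast
  have "(THE n'. n' \<in> N \<and> (\<exists>i\<in>{1..k}. n \<otimes> g j = n' \<otimes> g i)) = n"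
  proof (rule the_equality)
    show "n \<in> N \<and> (\<exists>i\<in>{1..k}. n \<otimes> g j = n \<otimes> g i)" using n j by blast
    fix n' assume n': "n' \<in> N \<and> (\<exists>i\<in>{1..k}. n \<otimes> g j = n' \<otimes> g i)"
    then obtain i where i: "i \<in> {1..k}" "n \<otimes> g j = n' \<otimes> g i" by blast
    have "n \<otimes> g j \<in> N #> g j" using n unfolding r_coset_def by blast
    moreover have "n \<otimes> g j \<in> N #> g i" using n' i(2) unfolding r_coset_def by blast
    ultimately have "i = j"
      using dec i(1) j unfolding coset_decomposition_def disjoint_family_on_def by blast
    then show "n' = n" using i n n' gc[OF j] subgroup.mem_carrier[OF N] by (metis right_cancel)
  qed
  then show ?thesis unfolding extend_by_cosets_def by simp
qed

lemma coset_decomposition_obtain: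
  assumes dec: "coset_decomposition G N k g" and x: "x \<in> carrier G"
  obtains n j where "n \<in> N" "j \<in> {1..k}" "x = n \<otimes> g j"
  using assms unfolding coset_decomposition_def r_coset_def by blast

text \<open>Displacements take the place of distances: the bounds for \<Phi> and for its distance to
  \<Psi> may refer to different generating sets of H. Their word distances cannot be added directly,
  while elements of finite sets can be multiplied.\<close>

lemma finite_word_dist_bounded:
  assumes "finite_generating_set G S"
  shows "\<exists>D. finite D \<and> (\<forall>x\<in>carrier G. \<forall>y\<in>carrier G. word_dist G S x y \<le> R \<longrightarrow> inv x \<otimes> y \<in> D)"
  by (intro exI[of _ "{x \<in> carrier G. real (word_length G S x) \<le> R}"] conjI finite_word_ball[OF assms])
    (simp add: word_dist_def)

end

text \<open>
  Write \<open>x = n \<otimes> g j\<close> and \<open>\<Phi> x = m \<otimes> h i\<close>. Then \<open>m\<close> differs from \<open>\<Psi> n\<close> by right multiplication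
  with an element of a finite set, on which the additive coordinates of \<open>M\<close> are bounded.
\<close>

theorem theorem5:
  fixes G :: "('g, 'm) monoid_scheme" and H :: "('h, 'n) monoid_scheme"
    and N :: "'g set" and M :: "'h set"
    and \<Phi> \<Psi> :: "'g \<Rightarrow> 'h"
    and \<nu> :: "(('h set \<times> real) \<Rightarrow>\<^sub>0 int) set \<Rightarrow> real"
    and \<phi> :: "nat \<Rightarrow> 'g set \<Rightarrow> real"
    and r k l :: nat and g :: "nat \<Rightarrow> 'g" and h :: "nat \<Rightarrow> 'h"
  defines "GN \<equiv> G\<lparr>carrier := N\<rparr>" and "HM \<equiv> H\<lparr>carrier := M\<rparr>"
  defines "F_G \<equiv> extend_by_cosets G N k g (harmonic_coords GN \<phi>)"
    and "F_H \<equiv> extend_by_cosets H M l h (harmonic_coords HM (\<lambda>i. T_map GN HM \<nu> \<Psi> (\<phi> i)))"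
  assumes "group G" and "finitely_generated G" and "polynomial_growth G"
    and "group H" and "finitely_generated H" and "polynomial_growth H"
    and "quasi_isometry G H \<Phi>"
    and "subgroup N G" and "finite_index N G" and "torsion_free GN" and "nilpotent_group GN"
    and "subgroup M H" and "finite_index M H" and "torsion_free HM" and "nilpotent_group HM"
    and "quasi_isometry GN HM \<Psi>" and "at_bounded_distance N H \<Psi> \<Phi>"
    and "\<Psi> \<one>\<^bsub>G\<^esub> = \<one>\<^bsub>H\<^esub>"
    and "is_norm (real_abelianization HM) \<nu>"
    and "bounded_abelian_defect GN HM \<nu> \<Psi>"
    and "real_hom_basis (abelianization GN) r \<phi>"
    and "coset_decomposition G N k g" and "coset_decomposition H M l h"
  shows "bdd_above ((\<lambda>x. L2_set (\<lambda>i. F_H (\<Phi> x) i - F_G x i) {1..r}) ` carrier G)"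
proof -
  interpret G: group G by fact
  interpret H: group H by fact
  note N = \<open>subgroup N G\<close> and M = \<open>subgroup M H\<close>
  note decG = \<open>coset_decomposition G N k g\<close> and decH = \<open>coset_decomposition H M l h\<close>
  have GN: "group GN" unfolding GN_def by (rule subgroup.subgroup_is_group[OF N G.is_group])
  have HM: "group HM" unfolding HM_def by (rule subgroup.subgroup_is_group[OF M H.is_group])
  have carr: "carrier GN = N" "carrier HM = M" and mult: "mult HM = mult H" by (simp_all add: GN_def HM_def)
  define T where "T i = T_map GN HM \<nu> \<Psi> (\<phi> i)" for i
  have \<phi>: "\<phi> i \<in> real_hom (abelianization GN)" if "i \<in> {1..r}" for i
    using \<open>real_hom_basis (abelianization GN) r \<phi>\<close> that unfolding real_hom_basis_def by blast
  note transport = transported_functional[OF GN \<open>nilpotent_group GN\<close> HM \<open>nilpotent_group HM\<close>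
      \<open>quasi_isometry GN HM \<Psi>\<close> \<open>is_norm (real_abelianization HM) \<nu>\<close> \<open>bounded_abelian_defect GN HM \<nu> \<Psi>\<close> \<phi>]
  have "\<forall>i\<in>{1..r}. \<exists>C. \<forall>x\<in>N. \<bar>harmonic_coords HM T (\<Psi> x) i - harmonic_coords GN \<phi> x i\<bar> \<le> C"
    using transport(1) unfolding harmonic_coords_def T_def carr by blast
  then obtain C where C: "\<And>i x. i \<in> {1..r} \<Longrightarrow> x \<in> N
      \<Longrightarrow> \<bar>harmonic_coords HM T (\<Psi> x) i - harmonic_coords GN \<phi> x i\<bar> \<le> C i" by metis
  have add: "harmonic_coords HM T (a \<otimes>\<^bsub>H\<^esub> b) i = harmonic_coords HM T a i + harmonic_coords HM T b i"
    if "i \<in> {1..r}" "a \<in> M" "b \<in> M" for i a b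
    using transport(2)[OF that(1)] that(2,3) unfolding harmonic_coords_def T_def carr mult by blast
  have \<Psi>M: "\<Psi> x \<in> M" if "x \<in> N" for x
    using \<open>quasi_isometry GN HM \<Psi>\<close> that unfolding quasi_isometry_def carr by blast
  obtain S1 T1 and A1 B1 :: real where \<Phi>: "\<Phi> \<in> carrier G \<rightarrow> carrier H"
    and S1: "finite_generating_set G S1" and T1: "finite_generating_set H T1" and A1: "A1 \<ge> 1"
    and dist: "\<forall>x\<in>carrier G. \<forall>y\<in>carrier G. word_dist H T1 (\<Phi> x) (\<Phi> y) \<le> A1 * word_dist G S1 x y + B1"
    using \<open>quasi_isometry G H \<Phi>\<close> unfolding quasi_isometry_def by blast
  have \<Phi>c: "\<Phi> x \<in> carrier H" if "x \<in> carrier G" for x using \<Phi> that by auto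
  have Nc: "x \<in> carrier G" if "x \<in> N" for x using subgroup.mem_carrier[OF N that] .
  have Mc: "x \<in> carrier H" if "x \<in> M" for x using subgroup.mem_carrier[OF M that] .
  have gc: "g j \<in> carrier G" if "j \<in> {1..k}" for j using decG that unfolding coset_decomposition_def by blast
  have hc: "h j \<in> carrier H" if "j \<in> {1..l}" for j using decH that unfolding coset_decomposition_def by blast
  obtain T2 R2 where T2: "finite_generating_set H T2" and R2: "\<And>x. x \<in> N \<Longrightarrow> word_dist H T2 (\<Psi> x) (\<Phi> x) \<le> R2"
    using \<open>at_bounded_distance N H \<Psi> \<Phi>\<close> unfolding at_bounded_distance_def bdd_above_def by blast
  obtain D2 where D2: "finite D2"
    "\<forall>x\<in>carrier H. \<forall>y\<in>carrier H. word_dist H T2 x y \<le> R2 \<longrightarrow> inv\<^bsub>H\<^esub> x \<otimes>\<^bsub>H\<^esub> y \<in> D2"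
    using H.finite_word_dist_bounded[OF T2, of R2] by blast
  \<comment> \<open>If x is n times g j, the word distance of n and x is the length of g j. The sum
    bounds all these lengths, and A1 and B1 carry the bound over to \<Phi> n and \<Phi> x.\<close>
  define R1 where "R1 = A1 * (\<Sum>j\<in>{1..k}. real (word_length G S1 (g j))) + B1"
  obtain D1 where D1: "finite D1"
    "\<forall>x\<in>carrier H. \<forall>y\<in>carrier H. word_dist H T1 x y \<le> R1 \<longrightarrow> inv\<^bsub>H\<^esub> x \<otimes>\<^bsub>H\<^esub> y \<in> D1"
    using H.finite_word_dist_bounded[OF T1, of R1] by blast
  \<comment> \<open>The three factors lead from \<Psi> n to \<Phi> n, from there to \<Phi> x, and
    from \<Phi> x to its component m in M.\<close>
  define D where "D = (\<lambda>(a, b, i). a \<otimes>\<^bsub>H\<^esub> (b \<otimes>\<^bsub>H\<^esub> inv\<^bsub>H\<^esub> h i)) ` (D2 \<times> D1 \<times> {1..l})"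
  have finD: "finite D" unfolding D_def using D1(1) D2(1) by (intro finite_imageI finite_cartesian_product) auto
  define E where "E i = (\<Sum>d\<in>D. \<bar>harmonic_coords HM T d i\<bar>)" for i
  have main: "\<bar>F_H (\<Phi> x) i - F_G x i\<bar> \<le> E i + C i" if x: "x \<in> carrier G" and i: "i \<in> {1..r}" for x i
  proof -
    obtain n j where n: "n \<in> N" "j \<in> {1..k}" "x = n \<otimes>\<^bsub>G\<^esub> g j"
      by (rule G.coset_decomposition_obtain[OF decG x])
    obtain m p where m: "m \<in> M" "p \<in> {1..l}" "\<Phi> x = m \<otimes>\<^bsub>H\<^esub> h p"
      by (rule H.coset_decomposition_obtain[OF decH \<Phi>c[OF x]])
    have FG: "F_G x = harmonic_coords GN \<phi> n"
      unfolding F_G_def n(3) by (rule G.extend_by_cosets_eq[OF N decG n(1,2)])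
    have FH: "F_H (\<Phi> x) = harmonic_coords HM T m"
      unfolding F_H_def m(3) T_def by (rule H.extend_by_cosets_eq[OF M decH m(1,2)])
    define a where "a = inv\<^bsub>H\<^esub> \<Psi> n \<otimes>\<^bsub>H\<^esub> \<Phi> n"
    define b where "b = inv\<^bsub>H\<^esub> \<Phi> n \<otimes>\<^bsub>H\<^esub> \<Phi> x"
    define d where "d = a \<otimes>\<^bsub>H\<^esub> (b \<otimes>\<^bsub>H\<^esub> inv\<^bsub>H\<^esub> h p)"
    note c = Mc[OF \<Psi>M[OF n(1)]] \<Phi>c[OF Nc[OF n(1)]] \<Phi>c[OF x] hc[OF m(2)] Mc[OF m(1)]
    have "a \<in> D2" unfolding a_def using D2(2) c(1,2) R2[OF n(1)] by blast
    moreover have "b \<in> D1" unfolding b_def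
    proof (rule bspec[OF bspec[OF D1(2) c(2)] c(3), rule_format])
      have "inv\<^bsub>G\<^esub> n \<otimes>\<^bsub>G\<^esub> x = g j"
        unfolding n(3) using Nc[OF n(1)] gc[OF n(2)] by (simp add: G.m_assoc[symmetric])
      then have "word_dist G S1 n x = real (word_length G S1 (g j))" unfolding word_dist_def by simp
      also have "\<dots> \<le> (\<Sum>j\<in>{1..k}. real (word_length G S1 (g j)))"
        by (rule member_le_sum) (use n(2) in auto)
      finally have "A1 * word_dist G S1 n x + B1 \<le> R1" unfolding R1_def using A1 by simp
      with dist Nc[OF n(1)] x show "word_dist H T1 (\<Phi> n) (\<Phi> x) \<le> R1" by (meson order_trans)
    qed
    ultimately have dD: "d \<in> D" unfolding D_def d_def using m(2) by force
    have "d = inv\<^bsub>H\<^esub> \<Psi> n \<otimes>\<^bsub>H\<^esub> ((\<Phi> n \<otimes>\<^bsub>H\<^esub> inv\<^bsub>H\<^esub> \<Phi> n) \<otimes>\<^bsub>H\<^esub> (\<Phi> x \<otimes>\<^bsub>H\<^esub> inv\<^bsub>H\<^esub> h p))"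
      unfolding d_def a_def b_def using c(1-4) by (simp only: H.m_assoc H.inv_closed H.m_closed)
    also have "\<Phi> x \<otimes>\<^bsub>H\<^esub> inv\<^bsub>H\<^esub> h p = m" unfolding m(3) using c(4,5) by (simp add: H.m_assoc)
    also have "inv\<^bsub>H\<^esub> \<Psi> n \<otimes>\<^bsub>H\<^esub> ((\<Phi> n \<otimes>\<^bsub>H\<^esub> inv\<^bsub>H\<^esub> \<Phi> n) \<otimes>\<^bsub>H\<^esub> m) = inv\<^bsub>H\<^esub> \<Psi> n \<otimes>\<^bsub>H\<^esub> m"
      using c(2,5) by simp
    finally have d: "d = inv\<^bsub>H\<^esub> \<Psi> n \<otimes>\<^bsub>H\<^esub> m" .
    \<comment> \<open>D is only a subset of H, but this element is a quotient of two elements of M,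
      and the coordinates are additive on M.\<close>
    have dM: "d \<in> M" unfolding d
      by (rule subgroup.m_closed[OF M subgroup.m_inv_closed[OF M \<Psi>M[OF n(1)]] m(1)])
    have "m = \<Psi> n \<otimes>\<^bsub>H\<^esub> d" unfolding d using c(1,5) by (simp add: H.m_assoc[symmetric])
    then have "harmonic_coords HM T m i = harmonic_coords HM T (\<Psi> n) i + harmonic_coords HM T d i"
      using add[OF i \<Psi>M[OF n(1)] dM] by simp
    moreover have "\<bar>harmonic_coords HM T d i\<bar> \<le> E i"
      unfolding E_def by (rule member_le_sum[OF dD _ finD]) simp
    ultimately show ?thesis unfolding FG FH using C[OF i n(1)] by linarith
  qed
  show ?thesis
  proof (rule bdd_aboveI2)
    fix x assume x: "x \<in> carrier G"
    have "L2_set (\<lambda>i. F_H (\<Phi> x) i - F_G x i) {1..r} \<le> (\<Sum>i\<in>{1..r}. \<bar>F_H (\<Phi> x) i - F_G x i\<bar>)"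
      by (rule L2_set_le_sum_abs)
    also have "\<dots> \<le> (\<Sum>i\<in>{1..r}. E i + C i)" by (rule sum_mono[OF main[OF x]])
    finally show "L2_set (\<lambda>i. F_H (\<Phi> x) i - F_G x i) {1..r} \<le> (\<Sum>i\<in>{1..r}. E i + C i)" .
  qed
qed

end
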